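(* Fix an integer $d \geq 3$ and a real number $\lambda < d$. For infinitely many positive integers $n$ (with $n\to\infty$), let $G=G_n$ be an $(n,d,\lambda)$ graph whose girth is at least $g=g(n)$, where $g > 10\log_{d-1}\log n$. Let $w_0\in V(G)$, let $\widetilde{W}=(w_0,w_1,\ldots,w_n)$ be a non-backtracking random walk of length $n$ on $G$ starting from $w_0$, and for each integer $t\ge 0$ let $$N_t = \Big|\big\{ v \in V(G) : |\{1\leq i\leq n : w_i=v\}|=t \big\}\Big|$$ be the number of vertices which $\widetilde{W}$ visits precisely $t$ times. Define $$F(x) = \left(1 + x\,\frac{\log\log\log n}{\log\log n}\right)\frac{\log n}{\log\log n}.$$ Then for every fixed $\delta>0$, with high probability (the probability that both of the following hold simultaneously tends to $1$ as $n\to\infty$): $$\left|\frac{N_t}{n/(\mathrm{e}\,t!)} - 1\right| \leq \frac{1}{\log\log\log n}\quad\text{for all integers } 0\le t < F(1-\delta),$$ and $$N_t = 0\quad\text{for all integers } t > F(1+\delta).$$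
   Context: An $(n,d,\lambda)$ graph is a $d$-regular undirected graph on $n$ vertices such that, if $d=\lambda_1\ge\lambda_2\ge\dots\ge\lambda_n$ are the eigenvalues of its adjacency matrix, then $\max_{i>1}|\lambda_i| = \lambda$. The girth is the length of a shortest cycle. A non-backtracking random walk of length $k$ on $G$ starting from a vertex $w_0$ is a random sequence $(w_0,\ldots,w_k)$ of vertices, where $w_1$ is a uniformly chosen neighbor of $w_0$ and, for $i\ge 2$, given $w_0,\ldots,w_{i-1}$, the vertex $w_i$ is chosen uniformly among all neighbors of $w_{i-1}$ other than $w_{i-2}$. All logarithms without an indicated base are natural; $\log_{d-1}$ is the logarithm to base $d-1$. *)

theory Defs
  imports
    "HOL-Probability.Probability"
    "HOL-Computational_Algebra.Polynomial"
    "Jordan_Normal_Form.Char_Poly"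
    "Graph_Theory.Graph_Theory"
begin

text \<open>Finite simple undirected graphs are rendered by the locale \<^locale>\<open>pair_graph\<close>
  (finite, loop-free, symmetric arc relation): an edge is a pair of opposite arcs.\<close>

definition adj_matrix :: "'a pair_pre_digraph \<Rightarrow> 'a list \<Rightarrow> real mat" where
  "adj_matrix G vs = Matrix.mat (length vs) (length vs)
     (\<lambda>(i, j). if (vs ! i, vs ! j) \<in> parcs G then 1 else 0)"

text \<open>Eigenvalues with multiplicity in decreasing order, indexed from 0. If \<open>G\<close> is undirected then
  the matrix is real symmetric, so the characteristic polynomial has all its roots in the reals and
  this list has length \<open>length vs\<close>.\<close>

definition adj_eigenvalues :: "'a pair_pre_digraph \<Rightarrow> 'a list \<Rightarrow> real list" where
  "adj_eigenvalues G vs = rev (sorted_list_of_multiset (proots (char_poly (adj_matrix G vs))))"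

text \<open>The eigenvalues do not depend on the enumeration \<open>vs\<close> of the vertices, so the existential
  quantifier below merely picks one.\<close>

definition ndl_graph :: "nat \<Rightarrow> nat \<Rightarrow> real \<Rightarrow> 'a pair_pre_digraph \<Rightarrow> bool" where
  "ndl_graph n d lam G \<longleftrightarrow>
     pair_graph G \<and> card (pverts G) = n \<and> (\<forall>v\<in>pverts G. out_degree (with_proj G) v = d) \<and>
     (\<exists>vs. distinct vs \<and> set vs = pverts G \<and>
        adj_eigenvalues G vs ! 0 = real d \<and>
        Max {\<bar>adj_eigenvalues G vs ! i\<bar> | i. 1 \<le> i \<and> i < n} = lam)"

text \<open>The bound \<open>3 \<le> length p\<close> excludes traversing one edge back and forth, which is a directed
  cycle of length 2. The girth of a forest is \<open>\<infinity>\<close>.\<close>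

definition girth :: "'a pair_pre_digraph \<Rightarrow> enat" where
  "girth G = (INF p \<in> {p. pre_digraph.cycle (with_proj G) p \<and> 3 \<le> length p}. enat (length p))"

definition nb_next :: "'a pair_pre_digraph \<Rightarrow> 'a list \<Rightarrow> 'a set" where
  "nb_next G ws = {v. (last ws, v) \<in> parcs G \<and>
     (2 \<le> length ws \<longrightarrow> v \<noteq> ws ! (length ws - 2))}"

text \<open>Law of \<open>[w\<^sub>0, \<dots>, w\<^sub>k]\<close>. If all degrees are at least 2, then \<open>nb_next\<close> is finite
  and nonempty at every step, so that \<^const>\<open>pmf_of_set\<close> is the uniform distribution.\<close>

primrec nb_walk :: "'a pair_pre_digraph \<Rightarrow> 'a \<Rightarrow> nat \<Rightarrow> 'a list pmf" where
  "nb_walk G w 0 = return_pmf [w]"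
| "nb_walk G w (Suc k) =
     bind_pmf (nb_walk G w k) (\<lambda>ws. map_pmf (\<lambda>v. ws @ [v]) (pmf_of_set (nb_next G ws)))"

text \<open>Visits are counted at times \<open>1, \<dots>, k\<close> only, where \<open>ws = [w\<^sub>0, \<dots>, w\<^sub>k]\<close>.\<close>

definition num_visited :: "'a pair_pre_digraph \<Rightarrow> 'a list \<Rightarrow> nat \<Rightarrow> nat" where
  "num_visited G ws t =
     card {v \<in> pverts G. card {i. 1 \<le> i \<and> i < length ws \<and> ws ! i = v} = t}"

definition visit_threshold :: "nat \<Rightarrow> real \<Rightarrow> real" where
  "visit_threshold n x =
     (1 + x * (ln (ln (ln (real n))) / ln (ln (real n)))) * (ln (real n) / ln (ln (real n)))"

end

theory Submission
  imports Defs "HOL-Real_Asymp.Real_Asymp"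
begin

text \<open>Write \<open>L = ln n\<close>. The spectral gap makes the walk mix in \<open>\<tau> = O(L)\<close> steps: after that, every
  vertex has probability \<open>(1 \<plusminus> 1/n)/n\<close> regardless of the past. Within \<open>\<tau>\<close> steps, the girth forbids
  a return before time \<open>h \<approx> 5 log\<^bsub>d-1\<^esub> L\<close> and bounds each later hitting probability by
  \<open>(d-1)\<^sup>-\<^sup>h = O(L\<^sup>-\<^sup>5)\<close>, since the walk has to follow a unique path in its last \<open>h\<close> steps; so all short
  gaps together contribute \<open>\<beta> = O(L\<^sup>-\<^sup>4)\<close>. Hence the factorial moments of order \<open>m = O(L)\<close> of the visit
  counts of one or two far apart vertices agree with those of independent Poisson variables of mean
  1 up to a relative error \<open>O(m\<^sup>2 \<beta>) = O(L\<^sup>-\<^sup>2)\<close>. Bonferroni's inequalities turn this into the probabilities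
  of exactly \<open>t\<close> visits, the second moment method gives concentration of \<open>N\<^sub>t\<close> with an error that
  survives the union bound over the at most \<open>L\<close> relevant \<open>t\<close>, and the first moment excludes larger
  visit counts.\<close>

section \<open>Regular graphs and their adjacency operator\<close>

text \<open>The walk is not Markov on vertices, while the hypothesis speaks of the adjacency
  operator A. The bridge is \<open>inflow\<close>: hitting probabilities summed over the previous
  vertex satisfy a three-term recurrence in A, and a quadratic Lyapunov function turns a bound on
  the Rayleigh quotient of sum-zero functions into exponential decay. All rates depend on d and lam
  only, so the bounds are uniform in the graph. For the moments, a visit to u acts as a renewal: the
  walk restarts at u with some unknown previous vertex, so bounds uniform in that vertex allow
  induction on the order of the moment. The radius h is half the girth bound, because two walks of
  length h with equal ends close up within 2h steps; this turns the constant 10 into the exponent 5.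
  Vertices near the start and pairs of close vertices are not Poisson. Each ball has at most d^h
  vertices, a power of log n, whereas n/t! below the threshold exceeds every power of log n.
  Bonferroni sums are cut off at order about 2 log n. Once 1/t! is factored out, the relative errors
  of the moments enter with weights 1/j!, whose sum is bounded; so a relative error of moments stays
  a relative error of probabilities.\<close>

locale regular_graph =
  fixes V :: "'a set" and E :: "('a \<times> 'a) set" and d :: nat
  assumes finite_V: "finite V"
    and E_subset: "E \<subseteq> V \<times> V"
    and E_sym: "(x, y) \<in> E \<Longrightarrow> (y, x) \<in> E"
    and E_irrefl: "(x, x) \<notin> E"
    and card_nbrs: "x \<in> V \<Longrightarrow> card (E `` {x}) = d"
    and degree_ge_3: "3 \<le> d"
begin

definition adj :: "('a \<Rightarrow> real) \<Rightarrow> 'a \<Rightarrow> real" where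
  "adj f x = (\<Sum>y\<in>E `` {x}. f y)"

definition inner_V :: "('a \<Rightarrow> real) \<Rightarrow> ('a \<Rightarrow> real) \<Rightarrow> real" where
  "inner_V f g = (\<Sum>x\<in>V. f x * g x)"

lemma nbrs_subset: "E `` {x} \<subseteq> V"
  using E_subset by auto

lemma finite_nbrs [simp]: "finite (E `` {x})"
  using nbrs_subset finite_V by (rule finite_subset)

lemma E_in_V: "(x, y) \<in> E \<Longrightarrow> x \<in> V" "(x, y) \<in> E \<Longrightarrow> y \<in> V"
  using E_subset by auto

lemma sum_nbrs_swap: "(\<Sum>x\<in>V. \<Sum>y\<in>E `` {x}. h x y) = (\<Sum>x\<in>V. \<Sum>y\<in>E `` {x}. h y x)"
  for h :: "'a \<Rightarrow> 'a \<Rightarrow> real"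
proof -
  have *: "(\<Sum>x\<in>V. \<Sum>y\<in>E `` {x}. h x y) = (\<Sum>(x, y)\<in>E. h x y)" for h :: "'a \<Rightarrow> 'a \<Rightarrow> real"
    by (subst sum.Sigma) (auto simp: finite_V intro!: sum.cong dest: E_in_V)
  have "(\<Sum>(x, y)\<in>E. h x y) = (\<Sum>(x, y)\<in>E. h y x)"
    by (rule sum.reindex_bij_witness[of _ prod.swap prod.swap]) (auto dest: E_sym)
  then show ?thesis by (simp add: *)
qed

lemma inner_adj: "inner_V (adj f) g = inner_V f (adj g)"
proof -
  have "inner_V (adj f) g = (\<Sum>x\<in>V. \<Sum>y\<in>E `` {x}. f y * g x)"
    by (simp add: inner_V_def adj_def sum_distrib_right)
  also have "\<dots> = (\<Sum>x\<in>V. \<Sum>y\<in>E `` {x}. f x * g y)"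
    by (rule sum_nbrs_swap)
  finally show ?thesis by (simp add: inner_V_def adj_def sum_distrib_left)
qed

lemma sum_adj: "(\<Sum>x\<in>V. adj f x) = real d * (\<Sum>x\<in>V. f x)"
proof -
  have "(\<Sum>x\<in>V. adj f x) = (\<Sum>x\<in>V. \<Sum>y\<in>E `` {x}. f x)"
    unfolding adj_def by (rule sum_nbrs_swap)
  also have "\<dots> = (\<Sum>x\<in>V. real d * f x)" by (intro sum.cong) (auto simp: card_nbrs)
  finally show ?thesis by (simp add: sum_distrib_left)
qed

lemma adj_const: "x \<in> V \<Longrightarrow> adj (\<lambda>_. c) x = real d * c"
  by (simp add: adj_def card_nbrs)

lemma adj_add: "adj (\<lambda>x. f x + g x) x = adj f x + adj g x"
  and adj_diff: "adj (\<lambda>x. f x - g x) x = adj f x - adj g x"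
  and adj_cmult: "adj (\<lambda>x. c * f x) x = c * adj f x"
  by (simp_all add: adj_def sum.distrib sum_subtractf sum_distrib_left)

lemma inner_V_add_left: "inner_V (\<lambda>x. f x + g x) h = inner_V f h + inner_V g h"
  and inner_V_diff_left: "inner_V (\<lambda>x. f x - g x) h = inner_V f h - inner_V g h"
  and inner_V_cmult_left: "inner_V (\<lambda>x. c * f x) h = c * inner_V f h"
  by (simp_all add: inner_V_def sum.distrib sum_subtractf sum_distrib_left algebra_simps)

lemma inner_V_commute: "inner_V f g = inner_V g f"
  by (simp add: inner_V_def mult.commute)

lemma inner_V_add_right: "inner_V h (\<lambda>x. f x + g x) = inner_V h f + inner_V h g"
  and inner_V_diff_right: "inner_V h (\<lambda>x. f x - g x) = inner_V h f - inner_V h g"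
  and inner_V_cmult_right: "inner_V h (\<lambda>x. c * f x) = c * inner_V h f"
  by (simp_all add: inner_V_commute[of h] inner_V_add_left inner_V_diff_left inner_V_cmult_left)

lemma inner_V_self_nonneg: "0 \<le> inner_V f f"
  by (simp add: inner_V_def sum_nonneg)

lemma inner_V_cong: "(\<And>x. x \<in> V \<Longrightarrow> f x = f' x) \<Longrightarrow> (\<And>x. x \<in> V \<Longrightarrow> g x = g' x) \<Longrightarrow>
    inner_V f g = inner_V f' g'"
  unfolding inner_V_def by (rule sum.cong) auto

lemma sq_le_inner: "x \<in> V \<Longrightarrow> (f x)\<^sup>2 \<le> inner_V f f"
  unfolding inner_V_def power2_eq_square by (rule member_le_sum) (auto simp: finite_V)

end

section \<open>The Rayleigh quotient\<close>

context regular_graph begin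

text \<open>The vertex type may be infinite, but these functions lie in a product of intervals
  [-1,1] on V and of {0} off V. The product is compact by Tychonoff, and both equations are closed
  conditions.\<close>

lemma compact_unit_sphere:
  "compact {f :: 'a \<Rightarrow> real. (\<forall>x. x \<notin> V \<longrightarrow> f x = 0) \<and> sum f V = 0 \<and> inner_V f f = 1}" (is "compact ?K")
proof -
  define B where "B = (\<Pi>\<^sub>E x\<in>UNIV. if x \<in> V then {-1..1::real} else {0})"
  have "compactin (product_topology (\<lambda>_. euclidean) UNIV) B"
    unfolding B_def compactin_PiE by auto
  then have B: "compact B"
    by (simp add: euclidean_product_topology)
  have *: "continuous_on UNIV (\<lambda>f::'a \<Rightarrow> real. f x)" for x
    by simp
  have c1: "continuous_on UNIV (\<lambda>f::'a \<Rightarrow> real. sum f V)"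
    by (intro continuous_intros *)
  have c2: "continuous_on UNIV (\<lambda>f::'a \<Rightarrow> real. inner_V f f)"
    unfolding inner_V_def by (intro continuous_intros *)
  have "closed ({f. sum f V = 0} \<inter> {f. inner_V f f = 1})"
    using closed_Collect_eq[OF c1 continuous_on_const] closed_Collect_eq[OF c2 continuous_on_const]
    by (rule closed_Int)
  then have "compact (B \<inter> ({f. sum f V = 0} \<inter> {f. inner_V f f = 1}))"
    by (rule compact_Int_closed[OF B])
  also have "B \<inter> ({f. sum f V = 0} \<inter> {f. inner_V f f = 1}) = ?K"
  proof -
    have "f \<in> B" if "f \<in> ?K" for f
    proof -
      have "\<bar>f x\<bar> \<le> 1" if "x \<in> V" for x
        using sq_le_inner[OF that, of f] \<open>f \<in> ?K\<close> by (simp add: abs_square_le_1)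
      with that show ?thesis by (auto simp: B_def abs_le_iff minus_le_iff)
    qed
    then show ?thesis by (auto simp: B_def PiE_iff split: if_splits)
  qed
  finally show ?thesis .
qed

text \<open>First-order condition at a maximum: for nonzero a, the choice t = a / (|b| + 1) makes
  the linear term outweigh the quadratic one.\<close>

lemma quadratic_nonpos_imp_linear_zero:
  fixes a b :: real
  assumes "\<And>t. t * a + t\<^sup>2 * b \<le> 0" shows "a = 0"
proof (rule ccontr)
  assume "a \<noteq> 0"
  define c where "c = \<bar>b\<bar> + 1"
  define t where "t = a / c"
  have c: "c > 0" "c + b > 0" by (auto simp: c_def)
  have "t * a + t\<^sup>2 * b = (a\<^sup>2 / c) * ((c + b) / c)"
    using c by (simp add: t_def power2_eq_square field_simps)
  moreover have "a\<^sup>2 / c > 0" "(c + b) / c > 0" using \<open>a \<noteq> 0\<close> c by simp_all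
  ultimately have "t * a + t\<^sup>2 * b > 0" by (metis mult_pos_pos)
  with assms[of t] show False by simp
qed

text \<open>A maximiser of the Rayleigh quotient on the orthogonal complement of the constants is an
  eigenvector.\<close>

lemma rayleigh_bound_signed:
  fixes \<epsilon> lam :: real
  assumes eps: "\<epsilon> = 1 \<or> \<epsilon> = -1"
    and eig: "\<And>\<mu> f. \<lbrakk>\<And>x. x \<in> V \<Longrightarrow> adj f x = \<mu> * f x; \<exists>x\<in>V. f x \<noteq> 0; sum f V = 0\<rbrakk> \<Longrightarrow> \<bar>\<mu>\<bar> \<le> lam"
    and f: "sum f V = 0"
  shows "\<epsilon> * inner_V (adj f) f \<le> lam * inner_V f f"
proof (cases "inner_V f f = 0")
  case True
  then have "\<forall>x\<in>V. f x = 0"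
    by (auto simp: inner_V_def sum_nonneg_eq_0_iff finite_V)
  then have "inner_V (adj f) f = 0" by (simp add: inner_V_def)
  then show ?thesis using True by simp
next
  case False
  define K where "K = {f :: 'a \<Rightarrow> real. (\<forall>x. x \<notin> V \<longrightarrow> f x = 0) \<and> sum f V = 0 \<and> inner_V f f = 1}"
  define n where "n f = (\<lambda>x. if x \<in> V then f x / sqrt (inner_V f f) else 0)" for f
  have nK: "n f \<in> K" and nf: "inner_V (adj (n f)) (n f) = inner_V (adj f) f / inner_V f f"
    if "sum f V = 0" "inner_V f f \<noteq> 0" for f
  proof -
    have pos: "inner_V f f > 0" using that inner_V_self_nonneg[of f] by linarith
    have nV: "n f x = (1 / sqrt (inner_V f f)) * f x" if "x \<in> V" for x using that by (simp add: n_def)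
    have "adj (n f) x = adj (\<lambda>x. (1 / sqrt (inner_V f f)) * f x) x" for x
      unfolding adj_def by (intro sum.cong refl nV) (auto dest: E_in_V)
    then have an: "adj (n f) x = (1 / sqrt (inner_V f f)) * adj f x" for x
      by (simp only: adj_cmult)
    have "inner_V (n f) (n f) = inner_V (\<lambda>x. (1 / sqrt (inner_V f f)) * f x) (\<lambda>x. (1 / sqrt (inner_V f f)) * f x)"
      by (intro inner_V_cong nV)
    also have "\<dots> = 1" using pos by (simp only: inner_V_cmult_left inner_V_cmult_right) simp
    finally have "inner_V (n f) (n f) = 1" .
    moreover have "sum (n f) V = (1 / sqrt (inner_V f f)) * sum f V"
      unfolding sum_distrib_left by (intro sum.cong nV) auto
    ultimately show "n f \<in> K" using that by (auto simp: K_def n_def)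
    have "inner_V (adj (n f)) (n f) = inner_V (\<lambda>x. (1 / sqrt (inner_V f f)) * adj f x) (\<lambda>x. (1 / sqrt (inner_V f f)) * f x)"
      by (intro inner_V_cong nV an)
    also have "\<dots> = inner_V (adj f) f / inner_V f f" using pos
      by (simp only: inner_V_cmult_left inner_V_cmult_right) simp
    finally show "inner_V (adj (n f)) (n f) = inner_V (adj f) f / inner_V f f" .
  qed
  have *: "continuous_on UNIV (\<lambda>f::'a \<Rightarrow> real. f x)" for x
    by simp
  have "continuous_on UNIV (\<lambda>f::'a \<Rightarrow> real. \<epsilon> * inner_V (adj f) f)"
    unfolding inner_V_def adj_def by (intro continuous_intros *)
  then have "continuous_on K (\<lambda>f. \<epsilon> * inner_V (adj f) f)"
    by (rule continuous_on_subset) simp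
  moreover have "compact K" unfolding K_def by (rule compact_unit_sphere)
  moreover have "K \<noteq> {}" using nK[OF f False] by auto
  ultimately obtain g where g: "g \<in> K" and gmax: "\<And>h. h \<in> K \<Longrightarrow> \<epsilon> * inner_V (adj h) h \<le> \<epsilon> * inner_V (adj g) g"
    using continuous_attains_sup[of K] by blast
  define M where "M = \<epsilon> * inner_V (adj g) g"
  have le: "\<epsilon> * inner_V (adj h) h \<le> M * inner_V h h" if "sum h V = 0" for h
  proof (cases "inner_V h h = 0")
    case True
    then have "\<forall>x\<in>V. h x = 0"
      by (auto simp: inner_V_def sum_nonneg_eq_0_iff finite_V)
    then have "inner_V (adj h) h = 0" by (simp add: inner_V_def)
    then show ?thesis using True by simp
  next
    case False
    then have "inner_V h h > 0" using inner_V_self_nonneg[of h] by linarith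
    moreover have "\<epsilon> * (inner_V (adj h) h / inner_V h h) \<le> M"
      using gmax[OF nK[OF that False]] by (simp add: nf[OF that False] M_def)
    ultimately show ?thesis by (simp add: field_simps)
  qed
  have g0: "sum g V = 0" and g1: "inner_V g g = 1" using g by (auto simp: K_def)
  \<comment> \<open>The residual of the eigenvector equation. It has sum 0, so the maximiser
    \<open>g\<close> may be moved in its direction; the first-order change is
    \<open>2 * inner_V r r\<close>, and maximality makes \<open>r\<close> vanish on V. The sign
    \<epsilon> treats both ends of the spectrum at once.\<close>
  define r where "r = (\<lambda>x. \<epsilon> * adj g x - M * g x)"
  have r0: "sum r V = 0"
    by (simp add: r_def sum_subtractf sum_distrib_left[symmetric] sum_adj g0)
  have "t * (2 * inner_V r r) + t\<^sup>2 * (\<epsilon> * inner_V (adj r) r - M * inner_V r r) \<le> 0" for t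
  proof -
    define h where "h = (\<lambda>x. g x + t * r x)"
    have hr: "adj h x = adj g x + t * adj r x" for x
      by (simp add: h_def adj_add adj_cmult)
    have "sum h V = 0" by (simp add: h_def sum.distrib sum_distrib_left[symmetric] g0 r0)
    from le[OF this] have "\<epsilon> * inner_V (adj h) h - M * inner_V h h \<le> 0" by simp
    have e1: "inner_V (adj h) h = inner_V (adj g) g + 2 * t * inner_V (adj g) r + t\<^sup>2 * inner_V (adj r) r"
    proof -
      have "inner_V (adj r) g = inner_V (adj g) r" by (metis inner_adj inner_V_commute)
      then show ?thesis
        unfolding h_def[symmetric] hr[abs_def]
        by (simp add: h_def hr inner_V_add_left inner_V_add_right inner_V_cmult_left inner_V_cmult_right power2_eq_square algebra_simps)
    qed
    have e2: "inner_V h h = 1 + 2 * t * inner_V g r + t\<^sup>2 * inner_V r r"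
      using inner_V_commute[of r g]
      by (simp add: h_def inner_V_add_left inner_V_add_right inner_V_cmult_left inner_V_cmult_right power2_eq_square algebra_simps g1)
    have e3: "inner_V r r = \<epsilon> * inner_V (adj g) r - M * inner_V g r"
      unfolding r_def by (subst inner_V_diff_left) (simp only: inner_V_cmult_left)
    have e4: "\<epsilon> * inner_V (adj g) g = M" by (simp add: M_def)
    have e5: "\<epsilon> * (a0 + 2 * t * a1 + t\<^sup>2 * a2) - m * (1 + 2 * t * b1 + t\<^sup>2 * c) =
        t * (2 * c) + t\<^sup>2 * (\<epsilon> * a2 - m * c)"
      if "c = \<epsilon> * a1 - m * b1" "\<epsilon> * a0 = m" for a0 a1 a2 b1 c m :: real
    proof -
      have "\<epsilon> * (a0 + 2 * t * a1 + t\<^sup>2 * a2) - m * (1 + 2 * t * b1 + t\<^sup>2 * c) =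
          (\<epsilon> * a0 - m) + 2 * t * (\<epsilon> * a1 - m * b1) + t\<^sup>2 * (\<epsilon> * a2 - m * c)"
        by (simp add: algebra_simps)
      then show ?thesis unfolding that(1)[symmetric] that(2) by simp
    qed
    have "\<epsilon> * inner_V (adj h) h - M * inner_V h h =
        t * (2 * inner_V r r) + t\<^sup>2 * (\<epsilon> * inner_V (adj r) r - M * inner_V r r)"
      unfolding e1 e2 by (rule e5[OF e3 e4])
    then show ?thesis using \<open>\<epsilon> * inner_V (adj h) h - M * inner_V h h \<le> 0\<close> by simp
  qed
  then have "2 * inner_V r r = 0" by (rule quadratic_nonpos_imp_linear_zero)
  then have rz: "\<forall>x\<in>V. r x = 0" by (auto simp: inner_V_def sum_nonneg_eq_0_iff finite_V)
  have "\<bar>\<epsilon> * M\<bar> \<le> lam"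
  proof (rule eig)
    show "adj g x = \<epsilon> * M * g x" if "x \<in> V" for x
      using rz that eps by (auto simp: r_def)
    have "inner_V g g = 0" if "\<forall>x\<in>V. g x = 0" using that by (simp add: inner_V_def)
    then show "\<exists>x\<in>V. g x \<noteq> 0" using g1 by auto
    show "sum g V = 0" by (rule g0)
  qed
  then have "M \<le> lam" using eps by auto
  then show ?thesis using le[OF f] mult_right_mono[OF _ inner_V_self_nonneg[of f], of M lam] by linarith
qed

lemma rayleigh_bound:
  fixes lam :: real
  assumes eig: "\<And>\<mu> f. \<lbrakk>\<And>x. x \<in> V \<Longrightarrow> adj f x = \<mu> * f x; \<exists>x\<in>V. f x \<noteq> 0; sum f V = 0\<rbrakk> \<Longrightarrow> \<bar>\<mu>\<bar> \<le> lam"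
    and f: "sum f V = 0"
  shows "\<bar>inner_V (adj f) f\<bar> \<le> lam * inner_V f f"
proof -
  have "\<epsilon> * inner_V (adj f) f \<le> lam * inner_V f f" if "\<epsilon> = 1 \<or> \<epsilon> = -1" for \<epsilon>
    using that eig f by (rule rayleigh_bound_signed)
  from this[of 1] this[of "-1"] show ?thesis by simp
qed

end

section \<open>Eigenvalues of the adjacency matrix\<close>

unbundle no vec_syntax

text \<open>Replacing rows \<open>a\<close> and \<open>b\<close> of the identity by two independent left eigenvectors
  gives a matrix \<open>R\<close> such that \<open>x - \<mu>\<close> can be pulled out of two rows of \<open>R (xI - A)\<close>.\<close>

lemma char_poly_double_root:
  fixes A :: "real mat" and u w :: "nat \<Rightarrow> real"
  assumes A: "A \<in> carrier_mat n n" and ab: "a < n" "b < n"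
    and indep: "u a * w b - u b * w a \<noteq> 0"
    and u: "\<And>j. j < n \<Longrightarrow> (\<Sum>i<n. u i * A $$ (i, j)) = \<mu> * u j"
    and w: "\<And>j. j < n \<Longrightarrow> (\<Sum>i<n. w i * A $$ (i, j)) = \<mu> * w j"
  shows "[:- \<mu>, 1:] ^ 2 dvd char_poly A"
proof -
  have "a \<noteq> b" using indep by auto
  define R where "R = Matrix.mat n n (\<lambda>(i, j). if i = a then u j else if i = b then w j else if i = j then 1 else 0)"
  define R' where "R' = map_mat (\<lambda>c. [:c:]) R"
  have R: "R \<in> carrier_mat n n" by (simp add: R_def)
  then have R': "R' \<in> carrier_mat n n" by (simp add: R'_def)
  interpret lift: inj_comm_ring_hom "\<lambda>c::real. [:c:]"
    by unfold_locales auto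
  have detR': "det R' = [:det R:]"
    unfolding R'_def by (rule lift.hom_det)
  \<comment> \<open>Outside rows a and b the matrix is the identity, so a kernel vector is supported
    on {a, b}, where it solves a 2x2 system whose determinant is nonzero by
    \<open>indep\<close>.\<close>
  have "det R \<noteq> 0"
  proof
    assume "det R = 0"
    then obtain v where v: "v \<in> carrier_vec n" "v \<noteq> 0\<^sub>v n" "R *\<^sub>v v = 0\<^sub>v n"
      using det_0_iff_vec_prod_zero_field[OF R] by auto
    have row: "(\<Sum>j<n. R $$ (i, j) * v $ j) = 0" if "i < n" for i
    proof -
      have "(R *\<^sub>v v) $ i = (\<Sum>j<n. R $$ (i, j) * v $ j)"
        using that R v(1) by (simp add: scalar_prod_def atLeast0LessThan)
      then show ?thesis using v(3) that by simp
    qed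
    have v0: "v $ i = 0" if "i < n" "i \<noteq> a" "i \<noteq> b" for i
    proof -
      have "(\<Sum>j<n. R $$ (i, j) * v $ j) = (\<Sum>j<n. if j = i then v $ j else 0)"
        using that by (intro sum.cong) (auto simp: R_def)
      then show ?thesis using row[OF that(1)] that by simp
    qed
    have two: "(\<Sum>j<n. h j * v $ j) = h a * v $ a + h b * v $ b" for h :: "nat \<Rightarrow> real"
    proof -
      have "(\<Sum>j<n. h j * v $ j) = (\<Sum>j\<in>{a, b}. h j * v $ j)"
        using ab by (intro sum.mono_neutral_right) (auto simp: v0)
      then show ?thesis using \<open>a \<noteq> b\<close> by simp
    qed
    have "(\<Sum>j<n. R $$ (a, j) * v $ j) = (\<Sum>j<n. u j * v $ j)"
      using ab by (intro sum.cong) (auto simp: R_def)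
    then have 1: "u a * v $ a + u b * v $ b = 0" using row[OF ab(1)] two[of u] by simp
    have "(\<Sum>j<n. R $$ (b, j) * v $ j) = (\<Sum>j<n. w j * v $ j)"
      using ab \<open>a \<noteq> b\<close> by (intro sum.cong) (auto simp: R_def)
    then have 2: "w a * v $ a + w b * v $ b = 0" using row[OF ab(2)] two[of w] by simp
    have "(u a * w b - u b * w a) * v $ a = w b * (u a * v $ a + u b * v $ b) - u b * (w a * v $ a + w b * v $ b)"
      by (simp add: algebra_simps)
    then have "v $ a = 0" using indep 1 2 by simp
    have "(u a * w b - u b * w a) * v $ b = u a * (w a * v $ a + w b * v $ b) - w a * (u a * v $ a + u b * v $ b)"
      by (simp add: algebra_simps)
    then have "v $ b = 0" using indep 1 2 by simp
    have "v = 0\<^sub>v n"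
    proof (rule eq_vecI)
      show "v $ i = 0\<^sub>v n $ i" if "i < dim_vec (0\<^sub>v n)" for i
        using that v0[of i] \<open>v $ a = 0\<close> \<open>v $ b = 0\<close> by (cases "i = a"; cases "i = b") auto
    qed (use v(1) in auto)
    with v(2) show False by simp
  qed
  define p where "p = [:- \<mu>, 1:]"
  define X where "X = char_poly_matrix A"
  have X: "X \<in> carrier_mat n n" using A by (simp add: X_def)
  have X_index: "X $$ (i, j) = (if i = j then [:0, 1:] else 0) - [:A $$ (i, j):]" if "i < n" "j < n" for i j
    using that A by (simp add: X_def char_poly_matrix_def)
  \<comment> \<open>The product R' X with the factor p divided out of rows a and b, where
    \<open>eigen_row\<close> shows it to be p times a constant row.\<close>
  define C where "C = Matrix.mat n n (\<lambda>(i, j). if i = a then [:u j:] else if i = b then [:w j:] else (R' * X) $$ (i, j))"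
  have C: "C \<in> carrier_mat n n" by (simp add: C_def)
  have eigen_row: "(\<Sum>k<n. [:h k:] * X $$ (k, j)) = p * [:h j:]"
    if h: "\<And>j. j < n \<Longrightarrow> (\<Sum>i<n. h i * A $$ (i, j)) = \<mu> * h j" and j: "j < n" for h :: "nat \<Rightarrow> real" and j
  proof -
    have "(\<Sum>k<n. [:h k:] * X $$ (k, j)) = (\<Sum>k<n. (if k = j then [:0, h k:] else 0) - [:h k * A $$ (k, j):])"
      using j by (intro sum.cong) (auto simp: X_index algebra_simps)
    also have "\<dots> = [:0, h j:] - (\<Sum>k<n. [:h k * A $$ (k, j):])"
      using j by (simp add: sum_subtractf)
    also have "(\<Sum>k<n. [:h k * A $$ (k, j):]) = [:\<Sum>k<n. h k * A $$ (k, j):]"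
      by (rule lift.hom_sum[symmetric])
    finally show ?thesis by (simp add: h[OF j] p_def)
  qed
  have "R' * X = multrow a p (multrow b p C)"
  proof (rule eq_matI)
    fix i j assume ij: "i < dim_row (multrow a p (multrow b p C))" "j < dim_col (multrow a p (multrow b p C))"
    then have ij: "i < n" "j < n" using C by auto
    have RX: "(R' * X) $$ (i, j) = (\<Sum>k<n. R' $$ (i, k) * X $$ (k, j))"
      using ij R' X by (simp add: scalar_prod_def atLeast0LessThan)
    consider "i = a" | "i = b" | "i \<noteq> a" "i \<noteq> b" by blast
    then show "(R' * X) $$ (i, j) = multrow a p (multrow b p C) $$ (i, j)"
    proof cases
      case 1
      have "(\<Sum>k<n. R' $$ (i, k) * X $$ (k, j)) = (\<Sum>k<n. [:u k:] * X $$ (k, j))"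
        using ij 1 by (intro sum.cong) (auto simp: R'_def R_def)
      then show ?thesis unfolding RX using 1 ij C \<open>a \<noteq> b\<close> eigen_row[OF u ij(2)] by (simp add: C_def)
    next
      case 2
      have "(\<Sum>k<n. R' $$ (i, k) * X $$ (k, j)) = (\<Sum>k<n. [:w k:] * X $$ (k, j))"
        using ij 2 \<open>a \<noteq> b\<close> by (intro sum.cong) (auto simp: R'_def R_def)
      then show ?thesis unfolding RX using 2 ij C \<open>a \<noteq> b\<close> eigen_row[OF w ij(2)] by (simp add: C_def)
    next
      case 3
      then show ?thesis using ij C by (simp add: C_def)
    qed
  qed (use R' X C in auto)
  then have "det (R' * X) = p * (p * det C)"
    using ab C by (simp add: det_multrow)
  moreover have "det (R' * X) = [:det R:] * char_poly A"
    unfolding det_mult[OF R' X] detR' by (simp add: X_def char_poly_def)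
  ultimately have "p ^ 2 dvd Polynomial.smult (det R) (char_poly A)"
    by (simp add: power2_eq_square mult.assoc)
  then show ?thesis using \<open>det R \<noteq> 0\<close> by (simp add: p_def dvd_smult_iff)
qed

lemma ndl_graph_regular:
  assumes "ndl_graph n d lam G" and "3 \<le> d"
  shows "regular_graph (pverts G) (parcs G) d"
proof -
  have G: "pair_graph G" and deg: "\<And>v. v \<in> pverts G \<Longrightarrow> out_degree (with_proj G) v = d"
    using assms(1) by (auto simp: ndl_graph_def)
  interpret pair_graph G by (rule G)
  show ?thesis
  proof
    show "card (parcs G `` {x}) = d" if "x \<in> pverts G" for x
    proof -
      have "bij_betw snd (out_arcs (with_proj G) x) (parcs G `` {x})"
        by (rule bij_betwI[of _ _ _ "\<lambda>y. (x, y)"]) (auto simp: out_arcs_def)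
      then show ?thesis using deg[OF that] bij_betw_same_card by (force simp: out_degree_def)
    qed
    show "(y, x) \<in> parcs G" if "(x, y) \<in> parcs G" for x y
      using that pair_sym_arcs by (auto simp: symmetric_def sym_def)
    show "(x, x) \<notin> parcs G" for x using pair_no_loops by force
  qed (use pair_finite_verts assms(2) in_arcsD1 in_arcsD2 in auto)
qed

text \<open>The list of roots records algebraic multiplicities, and lam controls only the entries
  after the first. So the one critical case is \<mu> at index 0, that is \<mu> = d. There f and the
  constant 1 are independent eigenvectors, hence d is at least a double root and occurs again at a
  later index.\<close>

lemma ndl_graph_eigenvalue_le:
  fixes f :: "'a \<Rightarrow> real"
  assumes ndl: "ndl_graph n d lam G" and d: "3 \<le> d" and lam: "lam < real d"
    and f: "\<And>x. x \<in> pverts G \<Longrightarrow> (\<Sum>y\<in>parcs G `` {x}. f y) = \<mu> * f x"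
    and fnz: "\<exists>x\<in>pverts G. f x \<noteq> 0" and f0: "sum f (pverts G) = 0"
  shows "\<bar>\<mu>\<bar> \<le> lam"
proof -
  interpret regular_graph "pverts G" "parcs G" d
    using ndl d by (rule ndl_graph_regular)
  obtain vs where vs: "distinct vs" "set vs = pverts G" "card (pverts G) = n"
    and e0: "adj_eigenvalues G vs ! 0 = real d"
    and Mx: "Max {\<bar>adj_eigenvalues G vs ! i\<bar> | i. 1 \<le> i \<and> i < n} = lam"
    using ndl by (auto simp: ndl_graph_def)
  have len: "length vs = n" using vs distinct_card by force
  define A where "A = adj_matrix G vs"
  have A: "A \<in> carrier_mat n n" by (simp add: A_def adj_matrix_def len)
  have A_index: "A $$ (i, j) = (if (vs ! i, vs ! j) \<in> parcs G then 1 else 0)" if "i < n" "j < n" for i j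
    using that by (simp add: A_def adj_matrix_def len)
  have bij: "bij_betw ((!) vs) {..<n} (pverts G)"
    using vs len by (auto intro!: bij_betw_nth)
  have Asym: "A $$ (i, j) = A $$ (j, i)" if "i < n" "j < n" for i j
    using that E_sym by (auto simp: A_index)
  have rowsum: "(\<Sum>j<n. A $$ (i, j) * h (vs ! j)) = (\<Sum>y\<in>parcs G `` {vs ! i}. h y)" if "i < n" for i and h :: "'a \<Rightarrow> real"
  proof -
    have "(\<Sum>j<n. A $$ (i, j) * h (vs ! j)) = (\<Sum>j<n. if (vs ! i, vs ! j) \<in> parcs G then h (vs ! j) else 0)"
      using that by (intro sum.cong) (auto simp: A_index)
    also have "\<dots> = (\<Sum>y\<in>pverts G. if (vs ! i, y) \<in> parcs G then h y else 0)"
      by (rule sum.reindex_bij_betw[OF bij])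
    also have "\<dots> = (\<Sum>y\<in>parcs G `` {vs ! i}. h y)"
      using E_in_V by (intro sum.mono_neutral_cong_right finite_V) auto
    finally show ?thesis .
  qed
  have vsV: "vs ! i \<in> pverts G" if "i < n" for i using that len nth_mem[of i vs] vs(2) by simp
  define P where "P = char_poly A"
  have Pnz: "P \<noteq> 0" using degree_monic_char_poly[OF A] by (auto simp: P_def)
  define es where "es = adj_eigenvalues G vs"
  have mes: "mset es = proots P"
    by (simp add: es_def adj_eigenvalues_def P_def A_def)
  have "length es \<le> n"
    using size_proots_le[of P] degree_monic_char_poly[OF A] mes
    by (metis P_def size_mset)
  have le_lam: "\<bar>es ! i\<bar> \<le> lam" if "1 \<le> i" "i < length es" for i
  proof -
    have "finite {\<bar>es ! i\<bar> | i. 1 \<le> i \<and> i < n}" by simp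
    then have "\<bar>es ! i\<bar> \<le> Max {\<bar>es ! i\<bar> | i. 1 \<le> i \<and> i < n}"
      by (rule Max_ge) (use that \<open>length es \<le> n\<close> in auto)
    then show ?thesis using Mx by (simp add: es_def)
  qed
  have "n > 0" using fnz vs finite_V by (auto simp: card_gt_0_iff)
  have "poly P \<mu> = 0"
  proof -
    have "eigenvector A (vec n (\<lambda>i. f (vs ! i))) \<mu>"
      unfolding eigenvector_def
    proof (intro conjI)
      obtain i where "i < n" "f (vs ! i) \<noteq> 0" using fnz vs len by (metis in_set_conv_nth)
      then have "vec n (\<lambda>i. f (vs ! i)) $ i \<noteq> 0\<^sub>v n $ i" by simp
      then show "vec n (\<lambda>i. f (vs ! i)) \<noteq> 0\<^sub>v (dim_row A)" using A by auto
      show "A *\<^sub>v vec n (\<lambda>i. f (vs ! i)) = \<mu> \<cdot>\<^sub>v vec n (\<lambda>i. f (vs ! i))"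
      proof (rule eq_vecI)
        fix i assume "i < dim_vec (\<mu> \<cdot>\<^sub>v vec n (\<lambda>i. f (vs ! i)))"
        then have i: "i < n" by simp
        have "(A *\<^sub>v vec n (\<lambda>i. f (vs ! i))) $ i = (\<Sum>j<n. A $$ (i, j) * f (vs ! j))"
          using i A by (simp add: scalar_prod_def atLeast0LessThan)
        then show "(A *\<^sub>v vec n (\<lambda>i. f (vs ! i))) $ i = (\<mu> \<cdot>\<^sub>v vec n (\<lambda>i. f (vs ! i))) $ i"
          using i rowsum[OF i] f vsV by simp
      qed (use A in auto)
    qed (use A in auto)
    then show ?thesis using eigenvalue_root_char_poly[OF A] by (auto simp: eigenvalue_def P_def)
  qed
  then have "\<mu> \<in> set es" using Pnz mes by (metis mem_Collect_eq set_count_proots set_mset_mset)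
  then obtain i where i: "i < length es" "es ! i = \<mu>" by (auto simp: in_set_conv_nth)
  show ?thesis
  proof (cases "i = 0")
    case False
    then show ?thesis using le_lam[of i] i by simp
  next
    case True
    then have mu: "\<mu> = real d" using i e0 by (simp add: es_def)
    obtain x where x: "x \<in> pverts G" "f x \<noteq> 0" using fnz by blast
    \<comment> \<open>A nonzero function of sum 0 is not constant; two vertices with different
      values witness its independence of the constant 1.\<close>
    have "\<exists>y\<in>pverts G. f y \<noteq> f x"
    proof (rule ccontr)
      assume "\<not> ?thesis"
      then have "sum f (pverts G) = n * f x" using vs(3) by simp
      then show False using f0 x \<open>n > 0\<close> by simp
    qed
    then obtain y where y: "y \<in> pverts G" "f y \<noteq> f x" by blast
    obtain a b where ab: "a < n" "b < n" "vs ! a = x" "vs ! b = y"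
      using x y vs len by (metis in_set_conv_nth)
    have "[:- \<mu>, 1:] ^ 2 dvd P"
      unfolding P_def
    proof (rule char_poly_double_root[OF A ab(1,2), of "\<lambda>_. 1" "\<lambda>i. f (vs ! i)"])
      show "1 * f (vs ! b) - 1 * f (vs ! a) \<noteq> 0" using ab y by simp
      fix j assume j: "j < n"
      have "(\<Sum>i<n. 1 * A $$ (i, j)) = (\<Sum>i<n. A $$ (j, i) * (\<lambda>_. 1) (vs ! i))"
        using j by (intro sum.cong) (auto simp: Asym)
      then show "(\<Sum>i<n. 1 * A $$ (i, j)) = \<mu> * 1"
        using rowsum[OF j, of "\<lambda>_. 1"] card_nbrs[OF vsV[OF j]] mu by simp
      have "(\<Sum>i<n. f (vs ! i) * A $$ (i, j)) = (\<Sum>i<n. A $$ (j, i) * f (vs ! i))"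
        using j by (intro sum.cong) (auto simp: Asym)
      then show "(\<Sum>i<n. f (vs ! i) * A $$ (i, j)) = \<mu> * f (vs ! j)"
        using rowsum[OF j, of f] f vsV[OF j] by simp
    qed
    then have "2 \<le> order \<mu> P" using Pnz by (simp add: order_max)
    then have "2 \<le> count (mset es) \<mu>" using Pnz by (simp add: mes)
    moreover obtain e es' where es': "es = e # es'" using i by (cases es) auto
    ultimately have "\<mu> \<in> set es'" by (auto simp flip: count_greater_zero_iff set_mset_mset split: if_splits)
    then obtain j where "j < length es'" "es' ! j = \<mu>" by (auto simp: in_set_conv_nth)
    then show ?thesis using le_lam[of "Suc j"] es' by simp
  qed
qed

section \<open>The non-backtracking walk\<close>

context regular_graph begin

text \<open>The state of the non-backtracking walk is the pair of its previous and current vertex. As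
  there are no loops, the start is described by the state \<open>(w\<^sub>0, w\<^sub>0)\<close>, which forbids nothing.\<close>

definition nxt :: "'a \<Rightarrow> 'a \<Rightarrow> 'a set" where
  "nxt y x = {z. (x, z) \<in> E \<and> z \<noteq> y}"

text \<open>Expectation of F over the list of the next k vertices, the current vertex x not
  included, by conditioning on the first step. As a finite recursion it lets the whole analysis
  proceed by induction on k; \<open>expectation_fut\<close> ties it to the probability mass
  function.\<close>

primrec ev :: "nat \<Rightarrow> ('a list \<Rightarrow> real) \<Rightarrow> 'a \<Rightarrow> 'a \<Rightarrow> real" where
  "ev 0 F y x = F []"
| "ev (Suc k) F y x = (\<Sum>z\<in>nxt y x. ev k (\<lambda>zs. F (z # zs)) x z) / real (card (nxt y x))"

text \<open>The probability of being at v at time exactly k, from previous vertex y and current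
  vertex x; earlier visits to v are allowed.\<close>

primrec hit :: "nat \<Rightarrow> 'a \<Rightarrow> 'a \<Rightarrow> 'a \<Rightarrow> real" where
  "hit 0 y x v = (if x = v then 1 else 0)"
| "hit (Suc k) y x v = (\<Sum>z\<in>nxt y x. hit k x z v) / real (card (nxt y x))"

lemma nxt_eq: "nxt y x = E `` {x} - {y}"
  by (auto simp: nxt_def)

lemma finite_nxt [simp]: "finite (nxt y x)"
  by (simp add: nxt_eq)

lemma nxt_subset: "nxt y x \<subseteq> V"
  using nbrs_subset by (auto simp: nxt_eq)

lemma nxt_in_V: "z \<in> nxt y x \<Longrightarrow> z \<in> V"
  using nxt_subset by auto

lemma card_nxt: "x \<in> V \<Longrightarrow> card (nxt y x) = (if (x, y) \<in> E then d - 1 else d)"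
  by (auto simp: nxt_eq card_Diff_singleton_if card_nbrs)

lemma card_nxt_ge: "x \<in> V \<Longrightarrow> d - 1 \<le> card (nxt y x)"
  by (simp add: card_nxt)

lemma card_nxt_pos: "x \<in> V \<Longrightarrow> 0 < card (nxt y x)"
  using card_nxt_ge[of x y] degree_ge_3 by linarith

lemma nxt_nonempty: "x \<in> V \<Longrightarrow> nxt y x \<noteq> {}"
  by (metis card.empty card_nxt_pos less_irrefl)

lemma avg_le:
  assumes "x \<in> V" "\<And>z. z \<in> nxt y x \<Longrightarrow> h z \<le> (c::real)"
  shows "(\<Sum>z\<in>nxt y x. h z) / real (card (nxt y x)) \<le> c"
  using sum_bounded_above[of "nxt y x" h c] assms card_nxt_pos[of x y]
  by (simp add: divide_le_eq mult.commute)

lemma hit_nonneg: "0 \<le> hit k y x v"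
  by (induction k arbitrary: y x) (auto intro!: divide_nonneg_nonneg sum_nonneg)

lemma hit_le_1: "x \<in> V \<Longrightarrow> hit k y x v \<le> 1"
proof (induction k arbitrary: y x)
  case (Suc k)
  then show ?case by (auto intro!: avg_le dest: nxt_in_V)
qed auto

text \<open>Condition on the first j steps: the assumed bound applies to whatever state has then
  been reached.\<close>

lemma hit_shift_le:
  assumes "x \<in> V" "\<And>y x. x \<in> V \<Longrightarrow> hit h y x v \<le> c"
  shows "hit (j + h) y x v \<le> c"
  using assms(1)
proof (induction j arbitrary: y x)
  case 0
  then show ?case using assms(2) by simp
next
  case (Suc j)
  then show ?case by (auto intro!: avg_le dest: nxt_in_V)
qed

lemma ev_add: "ev k (\<lambda>zs. F zs + G zs) y x = ev k F y x + ev k G y x"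
  by (induction k arbitrary: F G y x) (auto simp: sum.distrib add_divide_distrib)

lemma ev_cmult: "ev k (\<lambda>zs. c * F zs) y x = c * ev k F y x"
  by (induction k arbitrary: F y x) (auto simp: sum_distrib_left)

lemma ev_diff: "ev k (\<lambda>zs. F zs - G zs) y x = ev k F y x - ev k G y x"
  using ev_add[of k F "\<lambda>zs. -1 * G zs"] ev_cmult[of k "-1" G] by simp

lemma ev_const: "x \<in> V \<Longrightarrow> ev k (\<lambda>_. c) y x = c"
proof (induction k arbitrary: y x)
  case (Suc k)
  then have "(\<Sum>z\<in>nxt y x. ev k (\<lambda>_. c) x z) = (\<Sum>z\<in>nxt y x. c)"
    by (intro sum.cong) (auto simp: Suc.IH nxt_in_V)
  then show ?case using Suc nxt_nonempty[of x y] by simp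
qed auto

lemma ev_sum: "x \<in> V \<Longrightarrow> ev k (\<lambda>zs. \<Sum>i\<in>I. F i zs) y x = (\<Sum>i\<in>I. ev k (F i) y x)"
  by (induction I rule: infinite_finite_induct) (auto simp: ev_const ev_add)

lemma ev_mono: "(\<And>zs. F zs \<le> G zs) \<Longrightarrow> ev k F y x \<le> ev k G y x"
  by (induction k arbitrary: F G y x) (auto intro!: divide_right_mono sum_mono)

section \<open>Identification of \<open>ev\<close> with the law of the walk\<close>

primrec fut :: "nat \<Rightarrow> 'a \<Rightarrow> 'a \<Rightarrow> 'a list pmf" where
  "fut 0 y x = return_pmf []"
| "fut (Suc k) y x = bind_pmf (pmf_of_set (nxt y x)) (\<lambda>z. map_pmf ((#) z) (fut k x z))"

lemma finite_set_pmf_fut: "x \<in> V \<Longrightarrow> finite (set_pmf (fut k y x))"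
proof (induction k arbitrary: y x)
  case (Suc k)
  then show ?case by (auto simp: set_pmf_of_set nxt_nonempty dest: nxt_in_V)
qed auto

lemma expectation_fut: "x \<in> V \<Longrightarrow> measure_pmf.expectation (fut k y x) F = ev k F y x"
proof (induction k arbitrary: F y x)
  case (Suc k)
  have V: "z \<in> V" if "z \<in> nxt y x" for z using that nxt_subset by auto
  have "measure_pmf.expectation (fut (Suc k) y x) F =
      (\<Sum>z\<in>nxt y x. measure_pmf.expectation (map_pmf ((#) z) (fut k x z)) F /\<^sub>R real (card (nxt y x)))"
    unfolding fut.simps
    by (rule pmf_expectation_bind_pmf_of_set) (auto simp: nxt_nonempty Suc.prems finite_set_pmf_fut V)
  also have "\<dots> = (\<Sum>z\<in>nxt y x. ev k (\<lambda>zs. F (z # zs)) x z /\<^sub>R real (card (nxt y x)))"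
    by (intro sum.cong) (auto simp: Suc.IH V)
  also have "\<dots> = ev (Suc k) F y x"
    by (simp add: sum_distrib_left divide_inverse_commute)
  finally show ?case .
qed auto

text \<open>\<open>fut\<close> grows at the front and \<open>nb_walk\<close> at the end; this
  converts one into the other. Prepending y to the list makes
  \<open>last (butlast (y # x # zs))\<close> the correct previous vertex even when zs is
  empty.\<close>

lemma fut_snoc:
  "x \<in> V \<Longrightarrow> fut (Suc k) y x = bind_pmf (fut k y x)
     (\<lambda>zs. map_pmf (\<lambda>v. zs @ [v]) (pmf_of_set (nxt (last (butlast (y # x # zs))) (last (x # zs)))))"
proof (induction k arbitrary: y x)
  case 0
  then show ?case by (simp add: bind_return_pmf map_pmf_def)
next
  case (Suc k)
  have "fut (Suc (Suc k)) y x = bind_pmf (pmf_of_set (nxt y x)) (\<lambda>z. map_pmf ((#) z) (fut (Suc k) x z))"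
    by simp
  also have "\<dots> = bind_pmf (pmf_of_set (nxt y x)) (\<lambda>z. map_pmf ((#) z) (bind_pmf (fut k x z)
     (\<lambda>zs. map_pmf (\<lambda>v. zs @ [v]) (pmf_of_set (nxt (last (butlast (x # z # zs))) (last (z # zs)))))))"
    using Suc.prems by (intro bind_pmf_cong refl arg_cong[where f = "map_pmf _"] Suc.IH)
      (auto simp: set_pmf_of_set nxt_nonempty nxt_in_V)
  also have "\<dots> = bind_pmf (fut (Suc k) y x)
     (\<lambda>zs. map_pmf (\<lambda>v. zs @ [v]) (pmf_of_set (nxt (last (butlast (y # x # zs))) (last (x # zs)))))"
    by (simp add: map_bind_pmf bind_assoc_pmf bind_map_pmf pmf.map_comp o_def)
  finally show ?case .
qed

end

lemma prob_nb_walk: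
  assumes "regular_graph (pverts G) (parcs G) d" and w: "w \<in> pverts G"
  shows "measure_pmf.prob (nb_walk G w k) A = regular_graph.ev (parcs G) k (\<lambda>zs. indicator A (w # zs)) w w"
proof -
  interpret regular_graph "pverts G" "parcs G" d by fact
  have walk: "nb_walk G w k = map_pmf ((#) w) (fut k w w)"
  proof (induction k)
    case (Suc k)
    \<comment> \<open>For empty zs, \<open>nb_next\<close> excludes nothing while \<open>nxt\<close>
      excludes w itself; these agree because there are no loops.\<close>
    have *: "nb_next G (w # zs) = nxt (last (butlast (w # w # zs))) (last (w # zs))" for zs
    proof (cases zs rule: rev_cases)
      case Nil
      then show ?thesis using E_irrefl by (auto simp: nb_next_def nxt_def)
    next
      case (snoc us z)
      then show ?thesis
        by (cases us rule: rev_cases) (auto simp: nb_next_def nxt_def nth_append butlast_append)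
    qed
    have "nb_walk G w (Suc k) = bind_pmf (fut k w w)
        (\<lambda>zs. map_pmf (\<lambda>v. (w # zs) @ [v]) (pmf_of_set (nxt (last (butlast (w # w # zs))) (last (w # zs)))))"
      by (simp add: Suc.IH bind_map_pmf *)
    also have "\<dots> = map_pmf ((#) w) (fut (Suc k) w w)"
      unfolding fut_snoc[OF w] by (simp add: map_bind_pmf pmf.map_comp o_def)
    finally show ?case .
  qed auto
  have "measure_pmf.prob (nb_walk G w k) A = measure_pmf.expectation (nb_walk G w k) (indicator A)"
    by simp
  also have "\<dots> = measure_pmf.expectation (fut k w w) (\<lambda>zs. indicator A (w # zs))"
    unfolding walk integral_map_pmf ..
  also have "\<dots> = ev k (\<lambda>zs. indicator A (w # zs)) w w"
    by (rule expectation_fut[OF w])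
  finally show ?thesis .
qed

section \<open>Short cycles and hitting probabilities\<close>

context regular_graph begin

fun nonbacktracking :: "'a list \<Rightarrow> bool" where
  "nonbacktracking (x # y # z # zs) \<longleftrightarrow> (x, y) \<in> E \<and> x \<noteq> z \<and> nonbacktracking (y # z # zs)"
| "nonbacktracking [x, y] \<longleftrightarrow> (x, y) \<in> E"
| "nonbacktracking _ \<longleftrightarrow> True"

lemma nonbacktracking_Cons: "zs \<noteq> [] \<Longrightarrow> nonbacktracking (x # zs) \<longleftrightarrow>
    (x, hd zs) \<in> E \<and> nonbacktracking zs \<and> (tl zs \<noteq> [] \<longrightarrow> x \<noteq> hd (tl zs))"
  by (induction "x # zs" rule: nonbacktracking.induct) auto

lemma nonbacktracking_tl: "nonbacktracking xs \<Longrightarrow> nonbacktracking (tl xs)"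
  by (cases xs rule: nonbacktracking.cases) auto

lemma nonbacktracking_butlast: "nonbacktracking xs \<Longrightarrow> nonbacktracking (butlast xs)"
proof (induction xs rule: nonbacktracking.induct)
  case (1 x y z zs)
  then show ?case by (cases zs) auto
qed auto

lemma nonbacktracking_rev_append:
  assumes "nonbacktracking (x # zs)" "nonbacktracking (x # zs')" "zs \<noteq> [] \<Longrightarrow> zs' \<noteq> [] \<Longrightarrow> hd zs \<noteq> hd zs'"
  shows "nonbacktracking (rev zs @ x # zs')"
  using assms
proof (induction zs arbitrary: x zs')
  case (Cons z zs)
  have "nonbacktracking (rev zs @ z # (x # zs'))"
  proof (rule Cons.IH)
    show "nonbacktracking (z # zs)" using nonbacktracking_tl[OF Cons.prems(1)] by simp
    show "nonbacktracking (z # x # zs')"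
      using Cons.prems by (subst nonbacktracking_Cons) (auto simp: nonbacktracking_Cons intro: E_sym)
    show "hd zs \<noteq> hd (x # zs')" if "zs \<noteq> []"
      using Cons.prems(1) that by (auto simp: nonbacktracking_Cons)
  qed
  then show ?case by simp
qed auto

text \<open>Girth larger than m, in terms of walks; m steps visit a list of \<open>Suc m\<close>
  vertices.\<close>

definition no_short_cycle :: "nat \<Rightarrow> bool" where
  "no_short_cycle m \<longleftrightarrow> (\<forall>xs. nonbacktracking xs \<longrightarrow> length xs \<le> Suc m \<longrightarrow> distinct xs)"

text \<open>Strip the common initial part. If the walks then part, the reverse of one followed by
  the other is non-backtracking with at most 2h steps, yet meets the common endpoint twice.\<close>

lemma nonbacktracking_unique:
  assumes "no_short_cycle (2 * h)"
  shows "\<lbrakk>nonbacktracking (x # zs); nonbacktracking (x # zs'); length zs = length zs'; length zs \<le> h;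
    last (x # zs) = last (x # zs')\<rbrakk> \<Longrightarrow> zs = zs'"
proof (induction zs arbitrary: x zs')
  case (Cons z zs)
  then obtain z' ys where zs': "zs' = z' # ys" by (cases zs') auto
  show ?case
  proof (cases "z = z'")
    case True
    have "zs = ys"
    proof (rule Cons.IH)
      show "nonbacktracking (z # zs)" "nonbacktracking (z # ys)"
        using nonbacktracking_tl[OF Cons.prems(1)] nonbacktracking_tl[OF Cons.prems(2)] zs' True by simp_all
    qed (use Cons.prems zs' True in simp_all)
    then show ?thesis using zs' True by simp
  next
    case False
    have "nonbacktracking (rev (z # zs) @ x # zs')"
      using Cons.prems zs' False by (intro nonbacktracking_rev_append) auto
    moreover have "length (rev (z # zs) @ x # zs') \<le> Suc (2 * h)"
      using Cons.prems by simp
    ultimately have "distinct (rev (z # zs) @ x # zs')"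
      using assms unfolding no_short_cycle_def by blast
    moreover have "last (z # zs) \<in> set (rev (z # zs))" "last (z # zs) \<in> set (x # zs')"
    proof -
      show "last (z # zs) \<in> set (rev (z # zs))" by (metis last_in_set list.distinct(1) set_rev)
      have "last (z # zs) = last zs'" using Cons.prems(5) zs' by simp
      then show "last (z # zs) \<in> set (x # zs')" using zs' last_in_set[of zs'] by auto
    qed
    ultimately show ?thesis unfolding distinct_append by blast
  qed
qed auto

lemma hit_pos_imp_nonbacktracking:
  "hit k y x v > 0 \<Longrightarrow> \<exists>zs. length zs = k \<and> nonbacktracking (x # zs) \<and> (zs \<noteq> [] \<longrightarrow> hd zs \<noteq> y) \<and> last (x # zs) = v"
proof (induction k arbitrary: y x)
  case 0
  then show ?case by (auto split: if_splits)
next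
  case (Suc k)
  have "\<exists>z\<in>nxt y x. hit k x z v > 0"
  proof (rule ccontr)
    assume "\<not> ?thesis"
    then have "hit k x z v = 0" if "z \<in> nxt y x" for z using that hit_nonneg[of k x z v] by force
    then show False using Suc.prems by simp
  qed
  then obtain z zs where z: "z \<in> nxt y x" "length zs = k" "nonbacktracking (z # zs)" "zs \<noteq> [] \<longrightarrow> hd zs \<noteq> x" "last (z # zs) = v"
    using Suc.IH by blast
  then have "nonbacktracking (x # z # zs)" by (subst nonbacktracking_Cons) (auto simp: nxt_def)
  then show ?case using z by (intro exI[of _ "z # zs"]) (auto simp: nxt_def)
qed

text \<open>By uniqueness of short walks at most one neighbour of x can still lead to v in the
  remaining time, so every step costs a factor of at least d - 1.\<close>

lemma hit_le_power:
  assumes g: "no_short_cycle (2 * h)" and "k \<le> h" "x \<in> V"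
  shows "hit k y x v \<le> 1 / real (d - 1) ^ k"
  using assms(2,3)
proof (induction k arbitrary: y x)
  case (Suc k)
  have "(\<Sum>z\<in>nxt y x. hit k x z v) \<le> 1 / real (d - 1) ^ k"
  proof (cases "\<exists>z\<in>nxt y x. hit k x z v > 0")
    case True
  then obtain z where z: "z \<in> nxt y x" "hit k x z v > 0" by blast
    have "hit k x z' v = 0" if z': "z' \<in> nxt y x" "z' \<noteq> z" for z'
    proof (rule ccontr)
      assume "hit k x z' v \<noteq> 0"
      then have "hit k x z' v > 0" using hit_nonneg[of k x z' v] by simp
      then obtain zs' where zs': "length zs' = k" "nonbacktracking (z' # zs')" "zs' \<noteq> [] \<longrightarrow> hd zs' \<noteq> x" "last (z' # zs') = v"
        using hit_pos_imp_nonbacktracking by blast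
      obtain zs where zs: "length zs = k" "nonbacktracking (z # zs)" "zs \<noteq> [] \<longrightarrow> hd zs \<noteq> x" "last (z # zs) = v"
        using hit_pos_imp_nonbacktracking z(2) by blast
      have "nonbacktracking (x # z # zs)" "nonbacktracking (x # z' # zs')"
        using zs zs' z(1) z'(1) by (auto simp: nonbacktracking_Cons nxt_def)
      then have "z # zs = z' # zs'"
        by (rule nonbacktracking_unique[OF g]) (use zs zs' Suc.prems in auto)
      then show False using z' by simp
    qed
    then have "(\<Sum>z\<in>nxt y x. hit k x z v) = (\<Sum>z'\<in>{z}. hit k x z' v)"
      using z by (intro sum.mono_neutral_right) auto
    then show ?thesis using Suc.IH[of z x] Suc.prems nxt_in_V[OF z(1)] by simp
  next
    case False
    then have "(\<Sum>z\<in>nxt y x. hit k x z v) \<le> 0" by (intro sum_nonpos) force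
    then show ?thesis by (meson order_trans zero_le_divide_1_iff zero_le_power of_nat_0_le_iff)
  qed
  moreover have "0 < real (d - 1)" and "real (d - 1) \<le> real (card (nxt y x))"
    using degree_ge_3 card_nxt_ge[OF Suc.prems(2)] by (simp_all only: of_nat_le_iff of_nat_0_less_iff)
  ultimately have "hit (Suc k) y x v \<le> (1 / real (d - 1) ^ k) / real (d - 1)"
    unfolding hit.simps by (intro frac_le; (assumption | simp))
  then show ?case by (simp add: mult.commute)
qed auto

lemma hit_le_power_shift:
  assumes "no_short_cycle (2 * h)" "h \<le> i" "x \<in> V"
  shows "hit i y x v \<le> 1 / real (d - 1) ^ h"
  using hit_shift_le[OF assms(3) hit_le_power[OF assms(1) order_refl], of "i - h" y v] assms(2) by simp

text \<open>The ball of radius h - 1 around x.\<close>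

definition near :: "nat \<Rightarrow> 'a \<Rightarrow> 'a set" where
  "near h x = (\<Union>i<h. (E ^^ i) `` {x})"

lemma relpow_E_sym: "(x, y) \<in> E ^^ i \<Longrightarrow> (y, x) \<in> E ^^ i"
proof (induction i arbitrary: y)
  case (Suc i)
  then obtain z where "(x, z) \<in> E ^^ i" "(z, y) \<in> E" by auto
  then show ?case using relpow_Suc_I2[of y z E x i] Suc.IH[of z] E_sym[of z y] by simp
qed auto

lemma near_sym: "y \<in> near h x \<longleftrightarrow> x \<in> near h y"
proof -
  have "(x, y) \<in> E ^^ i \<longleftrightarrow> (y, x) \<in> E ^^ i" for i
    by (rule iffI) (erule relpow_E_sym)+
  then show ?thesis by (simp add: near_def Image_def)
qed

lemma finite_card_relpow: "x \<in> V \<Longrightarrow> finite ((E ^^ i) `` {x}) \<and> (E ^^ i) `` {x} \<subseteq> V \<and> card ((E ^^ i) `` {x}) \<le> d ^ i"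
proof (induction i)
  case (Suc i)
  have eq: "(E ^^ Suc i) `` {x} = (\<Union>y\<in>(E ^^ i) `` {x}. E `` {y})" by auto
  have "card ((E ^^ Suc i) `` {x}) \<le> (\<Sum>y\<in>(E ^^ i) `` {x}. card (E `` {y}))"
    unfolding eq using Suc by (intro card_UN_le) auto
  also have "\<dots> = (\<Sum>y\<in>(E ^^ i) `` {x}. d)"
    using Suc by (intro sum.cong) (auto simp: card_nbrs)
  also have "\<dots> \<le> d ^ Suc i" using Suc by simp
  finally show ?case using Suc nbrs_subset unfolding eq by auto
qed auto

lemma finite_near: "x \<in> V \<Longrightarrow> finite (near h x)"
  using finite_card_relpow by (auto simp: near_def)

lemma card_near: "x \<in> V \<Longrightarrow> card (near h x) \<le> d ^ h"
proof -
  assume x: "x \<in> V"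
  have "card (near h x) \<le> (\<Sum>i<h. card ((E ^^ i) `` {x}))"
    unfolding near_def by (intro card_UN_le) auto
  also have "\<dots> \<le> (\<Sum>i<h. d ^ i)" using finite_card_relpow[OF x] by (intro sum_mono) auto
  also have "\<dots> \<le> d ^ h"
  proof (induction h)
    case (Suc h)
    have "d ^ h + d ^ h \<le> d * d ^ h" using degree_ge_3 by (simp flip: mult_2)
    then show ?case using Suc by simp
  qed auto
  finally show ?thesis .
qed

lemma hit_pos_imp_relpow: "hit k y x v > 0 \<Longrightarrow> (x, v) \<in> E ^^ k"
proof (induction k arbitrary: y x)
  case 0
  then show ?case by (auto split: if_splits)
next
  case (Suc k)
  have "\<exists>z\<in>nxt y x. hit k x z v > 0"
  proof (rule ccontr)
    assume "\<not> ?thesis"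
    then have "hit k x z v = 0" if "z \<in> nxt y x" for z using that hit_nonneg[of k x z v] by force
    then show False using Suc.prems by simp
  qed
  then obtain z where "(x, z) \<in> E" "hit k x z v > 0" by (auto simp: nxt_def)
  then show ?case using relpow_Suc_I2[of x z E v k] Suc.IH[of x z] by simp
qed

text \<open>A return to x would be a repetition in a short non-backtracking walk; any other target
  lies outside the ball and is out of reach.\<close>

lemma hit_short_zero:
  assumes g: "no_short_cycle (2 * h)" and i: "0 < i" "i < h" and xu: "x = u \<or> u \<notin> near h x"
  shows "hit i y x u = 0"
proof (rule ccontr)
  assume "hit i y x u \<noteq> 0"
  then have pos: "hit i y x u > 0" using hit_nonneg[of i y x u] by simp
  show False
  proof (cases "x = u")
    case True
    obtain zs where zs: "length zs = i" "nonbacktracking (x # zs)" "last (x # zs) = u"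
      using hit_pos_imp_nonbacktracking[OF pos] by blast
    then have "distinct (x # zs)" using g i by (auto simp: no_short_cycle_def)
    moreover have "u \<in> set zs" using zs i by (auto split: if_splits)
    ultimately show False using True by simp
  next
    case False
    then show False using hit_pos_imp_relpow[OF pos] xu i by (auto simp: near_def)
  qed
qed

end

section \<open>From the girth to non-backtracking walks\<close>

lemma (in regular_graph) nonbacktracking_awalk:
  "nonbacktracking (x # xs) \<Longrightarrow> pcas x (vwalk_arcs (x # xs)) (last (x # xs)) \<and>
     pawalk_verts x (vwalk_arcs (x # xs)) = x # xs \<and> set (vwalk_arcs (x # xs)) \<subseteq> E \<and>
     length (vwalk_arcs (x # xs)) = length xs"
proof (induction xs arbitrary: x)
  case (Cons y ys)
  have "(x, y) \<in> E" "nonbacktracking (y # ys)"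
    using Cons.prems by (simp_all add: nonbacktracking_Cons)
  then show ?case using Cons.IH[of y] by simp
qed auto

text \<open>In a shortest counterexample both the tail and the list without its last vertex are
  distinct, so the only repetition is first = last and the walk is a cycle. One step would be a loop
  and two steps would backtrack, so it has at least the 3 arcs that \<open>girth\<close>
  demands.\<close>

lemma girth_imp_no_short_cycle:
  assumes rg: "regular_graph (pverts G) (parcs G) d" and girth: "enat m < girth G"
  shows "regular_graph.no_short_cycle (parcs G) m"
proof -
  interpret regular_graph "pverts G" "parcs G" d by (rule rg)
  have "distinct xs" if "nonbacktracking xs" "length xs \<le> Suc m" for xs
    using that
  proof (induction xs rule: length_induct)
    case (1 xs)
    show ?case
    proof (rule ccontr)
      assume nd: "\<not> distinct xs"
      then have ne: "xs \<noteq> []" by auto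
      obtain x ys where xs: "xs = x # ys" using ne by (cases xs) auto
      have dtl: "distinct ys"
        using 1(1)[rule_format, of ys] nonbacktracking_tl[OF 1(2)] 1(3) by (simp add: xs)
      have dbl: "distinct (butlast xs)"
        using 1(1)[rule_format, of "butlast xs"] nonbacktracking_butlast[OF 1(2)] 1(3) by (simp add: xs)
      have x: "x \<in> set ys" using nd dtl by (simp add: xs)
      then have ysne: "ys \<noteq> []" by auto
      have "x \<notin> set (butlast ys)" using dbl xs ysne by auto
      with x have lx: "last ys = x" using append_butlast_last_id[OF ysne]
        by (metis Un_iff empty_iff empty_set insert_iff list.simps(15) set_append)
      have "3 \<le> length ys"
      proof (rule ccontr)
        assume "\<not> 3 \<le> length ys"
        then consider a where "ys = [a]" | a b where "ys = [a, b]"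
          using ysne by (cases ys rule: nonbacktracking.cases) auto
        then show False using lx 1(2) xs E_irrefl by cases auto
      qed
      define p where "p = vwalk_arcs xs"
      note w = nonbacktracking_awalk[OF 1(2)[unfolded xs], folded xs p_def]
      have "pre_digraph.cycle (with_proj G) p"
        unfolding pre_digraph.cycle_def pre_digraph.awalk_def awalk_verts_with_proj_eq cas_with_proj_eq
      proof (intro exI[of _ x] conjI)
        show "x \<in> verts (with_proj G)"
          using 1(2) ysne E_in_V(1) by (auto simp: xs nonbacktracking_Cons)
        show "pcas x p x" using w lx ysne by (simp add: xs)
        show "p \<noteq> []" using w \<open>3 \<le> length ys\<close> by auto
        have "pawalk_verts x p = x # ys" using w xs by simp
        then show "distinct (tl (pawalk_verts x p))" using dtl by simp
      qed (use w in auto)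
      then have "girth G \<le> enat (length p)"
        unfolding girth_def using w \<open>3 \<le> length ys\<close> by (intro INF_lower) auto
      also have "\<dots> \<le> enat m" using w 1(3) xs by simp
      finally show False using girth by simp
    qed
  qed
  then show ?thesis by (auto simp: no_short_cycle_def)
qed

section \<open>Mixing\<close>

text \<open>At \<rho> = 1 the last inequality reads lam < q + 1 = d, so it persists slightly below 1
  by continuity. The bound 3/4 yields q \<rho>^2 \<ge> 9/8 here and closes the induction over edges
  in \<open>hit_mixing\<close>.\<close>

lemma contraction_rate_exists:
  fixes q lam :: real
  assumes "2 \<le> q" "lam < q + 1"
  obtains \<rho> :: real where "3 / 4 \<le> \<rho>" "\<rho> < 1" "1 \<le> q * \<rho>\<^sup>2" "lam * \<rho> < q * \<rho>\<^sup>2 + 1"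
proof -
  have "((\<lambda>r. q * r\<^sup>2 + 1 - lam * r) \<longlongrightarrow> q * 1\<^sup>2 + 1 - lam * 1) (at_left (1::real))"
    by (intro tendsto_intros)
  then have "eventually (\<lambda>r. q * r\<^sup>2 + 1 - lam * r > 0) (at_left (1::real))"
    by (rule order_tendstoD) (use assms in simp)
  moreover have "eventually (\<lambda>r. r \<in> {3/4<..<1}) (at_left (1::real))"
    by (rule eventually_at_left_real) simp
  ultimately have "eventually (\<lambda>r. q * r\<^sup>2 + 1 - lam * r > 0 \<and> r \<in> {3/4<..<1}) (at_left (1::real))"
    by eventually_elim simp
  then obtain r where r: "q * r\<^sup>2 + 1 - lam * r > 0" "3/4 < r" "r < 1"
    using eventually_happens'[OF trivial_limit_at_left_real] by auto
  have "(3/4)\<^sup>2 \<le> r\<^sup>2" using r by (intro power_mono) auto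
  then have "2 * (3/4)\<^sup>2 \<le> q * r\<^sup>2" using assms by (intro mult_mono) auto
  then show ?thesis using r by (intro that[of r]) (auto simp: power2_eq_square)
qed

context regular_graph begin

text \<open>Polarisation: the Rayleigh bound for a + b and for a - b, where the mixed terms of the
  two right-hand sides cancel.\<close>

lemma inner_adj_le:
  assumes ray: "\<And>f. sum f V = 0 \<Longrightarrow> \<bar>inner_V (adj f) f\<bar> \<le> lam * inner_V f f"
    and "sum a V = 0" "sum b V = 0"
  shows "2 * \<bar>inner_V (adj a) b\<bar> \<le> lam * (inner_V a a + inner_V b b)"
proof -
  define s where "s = inner_V (adj (\<lambda>x. a x + b x)) (\<lambda>x. a x + b x)"
  define t where "t = inner_V (adj (\<lambda>x. a x - b x)) (\<lambda>x. a x - b x)"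
  have ab: "inner_V (adj b) a = inner_V (adj a) b" by (metis inner_adj inner_V_commute)
  have "s - t = 4 * inner_V (adj a) b"
    unfolding s_def t_def adj_add[abs_def] adj_diff[abs_def]
    by (simp add: inner_V_add_left inner_V_add_right inner_V_diff_left inner_V_diff_right ab)
  moreover have "\<bar>s\<bar> \<le> lam * (inner_V a a + 2 * inner_V a b + inner_V b b)"
    unfolding s_def using ray[of "\<lambda>x. a x + b x"] assms(2,3) inner_V_commute[of a b]
    by (simp add: sum.distrib inner_V_add_left inner_V_add_right algebra_simps)
  moreover have "\<bar>t\<bar> \<le> lam * (inner_V a a - 2 * inner_V a b + inner_V b b)"
    unfolding t_def using ray[of "\<lambda>x. a x - b x"] assms(2,3) inner_V_commute[of a b]
    by (simp add: sum_subtractf inner_V_diff_left inner_V_diff_right algebra_simps)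
  ultimately show ?thesis by (simp add: algebra_simps abs_le_iff) linarith
qed

definition lyap :: "real \<Rightarrow> real \<Rightarrow> ('a \<Rightarrow> real) \<Rightarrow> ('a \<Rightarrow> real) \<Rightarrow> real" where
  "lyap \<rho> Q a b = inner_V a a + inner_V b b - 2 * \<rho> / (Q + 1) * inner_V (adj a) b"

text \<open>The quadratic form is the inverse covariance of the autoregression
  \<open>r (k + 2) = (\<rho> A r (k + 1) - r k) / Q\<close>; its decrement is a square.\<close>

lemma lyap_decreasing:
  assumes Q: "1 \<le> Q" and c: "\<And>x. x \<in> V \<Longrightarrow> c x = (\<rho> * adj b x - a x) / Q"
  shows "lyap \<rho> Q b c \<le> lyap \<rho> Q a b"
proof -
  define \<alpha> \<beta> \<gamma> \<sigma> where abbr: "\<alpha> = inner_V (adj b) (adj b)" "\<beta> = inner_V (adj b) a" "\<gamma> = inner_V a a" "\<sigma> = inner_V b b"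
  define w where "w = (\<lambda>x. \<rho> * adj b x - (Q + 1) * a x)"
  have c': "c x = (1 / Q) * (\<rho> * adj b x - a x)" if "x \<in> V" for x using c[OF that] by simp
  have ab: "inner_V (adj a) b = \<beta>" unfolding abbr by (metis inner_adj inner_V_commute)
  have ab': "inner_V a (adj b) = \<beta>" unfolding abbr by (rule inner_V_commute)
  have ww: "inner_V w w = \<rho>\<^sup>2 * \<alpha> - 2 * (Q + 1) * \<rho> * \<beta> + (Q + 1)\<^sup>2 * \<gamma>"
    unfolding w_def
    by (simp only: inner_V_diff_left inner_V_diff_right inner_V_cmult_left inner_V_cmult_right ab' abbr(1,2,3)[symmetric])
       (simp add: power2_eq_square algebra_simps)
  have cc: "inner_V c c = (\<rho>\<^sup>2 * \<alpha> - 2 * \<rho> * \<beta> + \<gamma>) / Q\<^sup>2"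
  proof -
    have "inner_V c c = inner_V (\<lambda>x. (1 / Q) * (\<rho> * adj b x - a x)) (\<lambda>x. (1 / Q) * (\<rho> * adj b x - a x))"
      by (intro inner_V_cong c')
    also have "\<dots> = (1 / Q) * ((1 / Q) * (\<rho>\<^sup>2 * \<alpha> - 2 * \<rho> * \<beta> + \<gamma>))"
      by (simp only: inner_V_diff_left inner_V_diff_right inner_V_cmult_left inner_V_cmult_right ab' abbr(1,2,3)[symmetric])
         (simp add: power2_eq_square algebra_simps)
    finally show ?thesis by (simp add: power2_eq_square)
  qed
  have bc: "inner_V (adj b) c = (\<rho> * \<alpha> - \<beta>) / Q"
  proof -
    have "inner_V (adj b) c = inner_V (adj b) (\<lambda>x. (1 / Q) * (\<rho> * adj b x - a x))"
      by (intro inner_V_cong c' refl)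
    also have "\<dots> = (1 / Q) * (\<rho> * \<alpha> - \<beta>)"
      by (simp only: inner_V_diff_right inner_V_cmult_right abbr(1,2)[symmetric])
    finally show ?thesis by simp
  qed
  have "lyap \<rho> Q a b - lyap \<rho> Q b c =
      (\<gamma> + \<sigma> - 2 * \<rho> / (Q + 1) * \<beta>) - (\<sigma> + (\<rho>\<^sup>2 * \<alpha> - 2 * \<rho> * \<beta> + \<gamma>) / Q\<^sup>2 - 2 * \<rho> / (Q + 1) * ((\<rho> * \<alpha> - \<beta>) / Q))"
    by (simp only: lyap_def cc bc ab abbr(3,4))
  also have "\<dots> = (Q - 1) / (Q\<^sup>2 * (Q + 1)) * (\<rho>\<^sup>2 * \<alpha> - 2 * (Q + 1) * \<rho> * \<beta> + (Q + 1)\<^sup>2 * \<gamma>)"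
  proof -
    have "Q \<noteq> 0" "Q + 1 \<noteq> 0" using Q by auto
    then show ?thesis by (simp add: divide_simps) (simp add: power2_eq_square algebra_simps)
  qed
  also have "\<dots> = (Q - 1) / (Q\<^sup>2 * (Q + 1)) * inner_V w w" by (simp only: ww)
  also have "\<dots> \<ge> 0" using Q inner_V_self_nonneg[of w] by simp
  finally show ?thesis by simp
qed

text \<open>The rescaled functions \<open>s k\<close> / \<rho>^k satisfy the autoregression treated
  by \<open>lyap_decreasing\<close>, with Q = q \<rho>^2 \<ge> 1. On sum-zero functions, lam \<rho>
  < Q + 1 makes \<open>lyap\<close> positive definite with constant \<kappa>, so the rescaled
  functions stay bounded.\<close>

lemma recurrence_decay:
  fixes s :: "nat \<Rightarrow> 'a \<Rightarrow> real" and \<rho> lam q :: real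
  assumes ray: "\<And>f. sum f V = 0 \<Longrightarrow> \<bar>inner_V (adj f) f\<bar> \<le> lam * inner_V f f"
    and rho: "0 < \<rho>" "1 \<le> q * \<rho>\<^sup>2" "lam * \<rho> < q * \<rho>\<^sup>2 + 1"
    and zero: "\<And>k. sum (s k) V = 0"
    and rec: "\<And>k x. x \<in> V \<Longrightarrow> s (Suc (Suc k)) x = (adj (s (Suc k)) x - s k x) / q"
    and "x \<in> V"
  shows "(s k x)\<^sup>2 \<le> 2 / (1 - lam * \<rho> / (q * \<rho>\<^sup>2 + 1)) * (inner_V (s 0) (s 0) + inner_V (s 1) (s 1) / \<rho>\<^sup>2) * (\<rho> ^ k)\<^sup>2"
proof -
  define Q where "Q = q * \<rho>\<^sup>2"
  define \<kappa> where "\<kappa> = 1 - lam * \<rho> / (Q + 1)"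
  have Q: "1 \<le> Q" using rho by (simp add: Q_def)
  have \<kappa>: "0 < \<kappa>" using rho Q by (simp add: \<kappa>_def Q_def field_simps)
  have q: "q > 0" using rho(2) mult_nonpos_nonneg[of q "\<rho>\<^sup>2"] by force
  define r where "r k = (\<lambda>x. (1 / \<rho> ^ k) * s k x)" for k
  have rzero: "sum (r k) V = 0" for k using zero[of k] by (simp add: r_def sum_divide_distrib[symmetric])
  have rrec: "r (Suc (Suc k)) x = (\<rho> * adj (r (Suc k)) x - r k x) / Q" if "x \<in> V" for k x
    unfolding r_def adj_cmult Q_def using rho q by (simp add: rec[OF that] field_simps power2_eq_square)
  have cross: "2 * \<bar>inner_V (adj (r k)) (r l)\<bar> \<le> lam * (inner_V (r k) (r k) + inner_V (r l) (r l))" for k l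
    by (rule inner_adj_le[OF ray]) (use rzero in auto)
  have cross': "\<bar>2 * \<rho> / (Q + 1) * inner_V (adj (r k)) (r l)\<bar> \<le> (lam * \<rho> / (Q + 1)) * (inner_V (r k) (r k) + inner_V (r l) (r l))" for k l
  proof -
    have "\<bar>2 * \<rho> / (Q + 1) * inner_V (adj (r k)) (r l)\<bar> = \<rho> / (Q + 1) * (2 * \<bar>inner_V (adj (r k)) (r l)\<bar>)"
      using Q rho by (simp add: abs_mult)
    also have "\<dots> \<le> \<rho> / (Q + 1) * (lam * (inner_V (r k) (r k) + inner_V (r l) (r l)))"
      using Q rho cross by (intro mult_left_mono) auto
    finally show ?thesis by (simp add: mult_ac)
  qed
  have lower: "\<kappa> * (inner_V (r k) (r k) + inner_V (r (Suc k)) (r (Suc k))) \<le> lyap \<rho> Q (r k) (r (Suc k))" for k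
    using abs_le_D1[OF cross'[of k "Suc k"]] unfolding lyap_def \<kappa>_def left_diff_distrib mult_1 by (rule diff_left_mono)
  have upper: "lyap \<rho> Q (r 0) (r 1) \<le> 2 * (inner_V (r 0) (r 0) + inner_V (r 1) (r 1))"
  proof -
    have "lam * \<rho> / (Q + 1) \<le> 1" using \<kappa> by (simp add: \<kappa>_def)
    then have "(lam * \<rho> / (Q + 1)) * (inner_V (r 0) (r 0) + inner_V (r 1) (r 1)) \<le> 1 * (inner_V (r 0) (r 0) + inner_V (r 1) (r 1))"
      using inner_V_self_nonneg by (intro mult_right_mono add_nonneg_nonneg) auto
    moreover have "A - t \<le> 2 * A" if "c \<le> 1 * A" "\<bar>t\<bar> \<le> c" for A t c :: real
      using that by linarith
    ultimately show ?thesis using cross'[of 0 1] unfolding lyap_def by blast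
  qed
  have dec: "lyap \<rho> Q (r k) (r (Suc k)) \<le> lyap \<rho> Q (r 0) (r 1)" for k
  proof (induction k)
    case (Suc k)
    have "lyap \<rho> Q (r (Suc k)) (r (Suc (Suc k))) \<le> lyap \<rho> Q (r k) (r (Suc k))"
      by (rule lyap_decreasing[OF Q]) (rule rrec)
    then show ?case using Suc by simp
  qed auto
  have "\<kappa> * (r k x)\<^sup>2 \<le> \<kappa> * (inner_V (r k) (r k) + inner_V (r (Suc k)) (r (Suc k)))"
    using \<kappa> sq_le_inner[OF \<open>x \<in> V\<close>, of "r k"] inner_V_self_nonneg[of "r (Suc k)"]
    by (intro mult_left_mono) auto
  also have "\<dots> \<le> 2 * (inner_V (r 0) (r 0) + inner_V (r 1) (r 1))"
    using lower[of k] dec[of k] upper by linarith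
  also have "inner_V (r 0) (r 0) = inner_V (s 0) (s 0)" by (simp add: r_def)
  also have "inner_V (r 1) (r 1) = inner_V (s 1) (s 1) / \<rho>\<^sup>2"
    unfolding r_def inner_V_cmult_left inner_V_cmult_right by (simp add: power2_eq_square)
  finally have *: "(r k x)\<^sup>2 \<le> 2 / \<kappa> * (inner_V (s 0) (s 0) + inner_V (s 1) (s 1) / \<rho>\<^sup>2)"
    using \<kappa> by (simp add: field_simps)
  have "s k x = r k x * \<rho> ^ k" using rho by (simp add: r_def)
  then have "(s k x)\<^sup>2 = (r k x)\<^sup>2 * (\<rho> ^ k)\<^sup>2" by (simp add: power_mult_distrib)
  also have "\<dots> \<le> 2 / \<kappa> * (inner_V (s 0) (s 0) + inner_V (s 1) (s 1) / \<rho>\<^sup>2) * (\<rho> ^ k)\<^sup>2"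
    by (intro mult_right_mono *) auto
  finally show ?thesis by (simp add: \<kappa>_def Q_def)
qed

text \<open>For k \<ge> 1 and x in V this is the number of non-backtracking walks of length k from x
  to v, divided by (d-1)^(k-1): an entry of a Chebyshev-type polynomial in the adjacency
  matrix.\<close>

definition inflow :: "'a \<Rightarrow> nat \<Rightarrow> 'a \<Rightarrow> real" where
  "inflow v k x = (\<Sum>y\<in>E `` {x}. hit k y x v)"

lemma sum_nxt_edge: "(x, y) \<in> E \<Longrightarrow> (\<Sum>z\<in>nxt y x. h z) = (\<Sum>z\<in>E `` {x}. h z) - (h y :: real)"
  by (simp add: nxt_eq sum_diff1)

text \<open>Each neighbour z is a permitted next step for d - 1 of the d possible previous vertices,
  which cancels the denominator.\<close>

lemma inflow_Suc: "x \<in> V \<Longrightarrow> inflow v (Suc k) x = (\<Sum>z\<in>E `` {x}. hit k x z v)"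
proof -
  assume x: "x \<in> V"
  let ?S = "\<Sum>z\<in>E `` {x}. hit k x z v"
  have "inflow v (Suc k) x = (\<Sum>y\<in>E `` {x}. (?S - hit k x y v) / real (d - 1))"
    unfolding inflow_def by (intro sum.cong) (auto simp: sum_nxt_edge card_nxt x)
  also have "\<dots> = (real d * ?S - ?S) / real (d - 1)"
    by (simp add: sum_divide_distrib[symmetric] sum_subtractf card_nbrs[OF x])
  also have "\<dots> = ?S" using degree_ge_3 by (simp add: of_nat_diff field_simps)
  finally show ?thesis .
qed

text \<open>Allowing the step back from z to x gives the \<open>adj\<close> term; the forbidden
  contributions \<open>hit k z x v\<close> add up to \<open>inflow v k x\<close>.\<close>

lemma inflow_rec: "x \<in> V \<Longrightarrow> inflow v (Suc (Suc k)) x = (adj (inflow v (Suc k)) x - inflow v k x) / real (d - 1)"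
proof -
  assume x: "x \<in> V"
  have "inflow v (Suc (Suc k)) x = (\<Sum>z\<in>E `` {x}. (inflow v (Suc k) z - hit k z x v) / real (d - 1))"
    unfolding inflow_Suc[OF x]
    by (intro sum.cong) (auto simp: sum_nxt_edge card_nxt E_sym E_in_V inflow_Suc)
  also have "\<dots> = (adj (inflow v (Suc k)) x - inflow v k x) / real (d - 1)"
    by (simp add: sum_divide_distrib[symmetric] sum_subtractf adj_def inflow_def)
  finally show ?thesis .
qed

lemma inflow_0: "x \<in> V \<Longrightarrow> inflow v 0 x = (if x = v then real d else 0)"
  by (simp add: inflow_def card_nbrs)

lemma inflow_1: "x \<in> V \<Longrightarrow> inflow v 1 x = (if (x, v) \<in> E then 1 else 0)"
  using inflow_Suc[of x v 0] by (simp add: sum.delta[where a = v, simplified eq_commute])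

text \<open>Conservation of mass; it makes \<open>inflow v k\<close> minus d/n a sum-zero function,
  to which the spectral bound applies.\<close>

lemma sum_inflow: "v \<in> V \<Longrightarrow> sum (inflow v k) V = real d"
proof (induction k rule: induct_nat_012)
  case 0
  then show ?case by (simp add: inflow_0 finite_V)
next
  case 1
  have "sum (inflow v 1) V = (\<Sum>x\<in>V. if (x, v) \<in> E then 1 else 0)"
    by (intro sum.cong inflow_1) auto
  also have "\<dots> = (\<Sum>x\<in>E `` {v}. 1)"
    by (intro sum.mono_neutral_cong_right finite_V) (auto dest: E_sym E_in_V)
  finally show ?case using 1 by (simp add: card_nbrs)
next
  case (ge2 k)
  have "sum (inflow v (Suc (Suc k))) V = (real d * real d - real d) / real (d - 1)"
    using ge2 by (simp add: inflow_rec sum_divide_distrib[symmetric] sum_subtractf sum_adj)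
  also have "real d * real d - real d = real d * real (d - 1)"
    using degree_ge_3 by (simp add: of_nat_diff algebra_simps)
  finally show ?case using degree_ge_3 by simp
qed

text \<open>\<open>recurrence_decay\<close> controls the sum over previous vertices. To recover a
  single state with y adjacent to x, subtract the forbidden step: \<open>hit (Suc k) y x v\<close>
  is \<open>inflow v (Suc k) x\<close> minus \<open>hit k x y v\<close>, over d - 1. The reversed
  edge enters divided by at least 2, so induction closes. If y is not adjacent to x, as at the
  start, then \<open>hit\<close> is \<open>inflow\<close> / d.\<close>

lemma hit_mixing:
  assumes ray: "\<And>f. sum f V = 0 \<Longrightarrow> \<bar>inner_V (adj f) f\<bar> \<le> lam * inner_V f f"
    and rho: "3 / 4 \<le> \<rho>" "\<rho> < 1" "1 \<le> real (d - 1) * \<rho>\<^sup>2" "lam * \<rho> < real (d - 1) * \<rho>\<^sup>2 + 1"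
    and v: "v \<in> V" and x: "x \<in> V"
  shows "\<bar>hit k y x v - 1 / real (card V)\<bar> \<le>
    (2 * sqrt (6 * (real d)\<^sup>2 / (1 - lam * \<rho> / (real (d - 1) * \<rho>\<^sup>2 + 1))) + 1) * \<rho> ^ k"
proof -
  define \<kappa> where "\<kappa> = 1 - lam * \<rho> / (real (d - 1) * \<rho>\<^sup>2 + 1)"
  define q where "q = real (d - 1)"
  define C1 where "C1 = sqrt (6 * (real d)\<^sup>2 / \<kappa>)"
  define n where "n = real (card V)"
  have q2: "2 \<le> q" using degree_ge_3 by (simp add: q_def)
  have "0 < 1 - a / b" if "a < b" "0 < b" for a b :: real using that by simp
  moreover have "0 < real (d - 1) * \<rho>\<^sup>2 + 1" using rho(3) by linarith
  ultimately have \<kappa>: "0 < \<kappa>" unfolding \<kappa>_def using rho(4) by blast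
  have C1: "0 \<le> C1" using \<kappa> by (simp add: C1_def)
  have n: "1 \<le> n" using v finite_V by (auto simp: n_def Suc_le_eq card_gt_0_iff)
  define s where "s k = (\<lambda>x. inflow v k x - d / n)" for k
  have norm: "inner_V (s k) (s k) \<le> inner_V (inflow v k) (inflow v k)" for k
  proof -
    have "inner_V (s k) (s k) = (\<Sum>x\<in>V. inflow v k x * inflow v k x - 2 * (d / n) * inflow v k x + (d / n)\<^sup>2)"
      unfolding inner_V_def s_def by (intro sum.cong) (auto simp: power2_eq_square algebra_simps)
    also have "\<dots> = inner_V (inflow v k) (inflow v k) - 2 * (d / n) * sum (inflow v k) V + n * (d / n)\<^sup>2"
      unfolding inner_V_def by (simp add: sum.distrib sum_subtractf sum_distrib_left n_def)
    also have "\<dots> = inner_V (inflow v k) (inflow v k) - d\<^sup>2 / n"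
      using n sum_inflow[OF v, of k] by (simp add: power2_eq_square field_simps)
    finally show ?thesis using n by simp
  qed
  have n0: "inner_V (s 0) (s 0) \<le> (real d)\<^sup>2"
  proof -
    have "inner_V (inflow v 0) (inflow v 0) = (\<Sum>x\<in>V. if x = v then (real d)\<^sup>2 else 0)"
      unfolding inner_V_def by (intro sum.cong) (auto simp: inflow_0 power2_eq_square)
    then show ?thesis using norm[of 0] v finite_V by simp
  qed
  have n1: "inner_V (s 1) (s 1) \<le> real d"
  proof -
    have "inner_V (inflow v 1) (inflow v 1) = (\<Sum>x\<in>V. inflow v 1 x)"
      unfolding inner_V_def by (intro sum.cong) (auto simp: inflow_1 simp del: One_nat_def)
    then show ?thesis using norm[of 1] sum_inflow[OF v, of 1] by simp
  qed
  have decay: "\<bar>s k x\<bar> \<le> C1 * \<rho> ^ k" if x: "x \<in> V" for k x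
  proof -
    have "(s k x)\<^sup>2 \<le> 2 / \<kappa> * (inner_V (s 0) (s 0) + inner_V (s 1) (s 1) / \<rho>\<^sup>2) * (\<rho> ^ k)\<^sup>2"
      unfolding \<kappa>_def
    proof (rule recurrence_decay[OF ray])
      show "sum (s k) V = 0" for k
        using sum_inflow[OF v, of k] n by (simp add: s_def sum_subtractf n_def[symmetric])
      show "s (Suc (Suc k)) x = (adj (s (Suc k)) x - s k x) / real (d - 1)" if "x \<in> V" for k x
      proof -
        have "adj (s (Suc k)) x = adj (inflow v (Suc k)) x - d * (d / n)"
          unfolding s_def using adj_diff[of "inflow v (Suc k)" "\<lambda>_. d / n" x] adj_const[OF that, of "d / n"] by simp
        moreover have "d * (d / n) - d / n = (d / n) * q" 
          using degree_ge_3 by (simp add: q_def of_nat_diff right_diff_distrib)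
        ultimately show ?thesis using q2 inflow_rec[OF that, of v k] unfolding s_def q_def[symmetric]
          by (simp add: field_simps)
      qed
    qed (use rho x degree_ge_3 in \<open>auto simp: of_nat_diff\<close>)
    \<comment> \<open>The initial energy is at most d^2 + 2d, since 1/\<rho>^2 \<le> 16/9; this
      explains the 6 d^2 in \<open>C1\<close>.\<close>
    also have "\<dots> \<le> 2 / \<kappa> * (3 * (real d)\<^sup>2) * (\<rho> ^ k)\<^sup>2"
    proof -
      have "(3/4)\<^sup>2 \<le> \<rho>\<^sup>2" using rho by (intro power_mono) auto
      then have "1 / \<rho>\<^sup>2 \<le> 2" using rho by (simp add: field_simps power2_eq_square)
      then have "inner_V (s 1) (s 1) * (1 / \<rho>\<^sup>2) \<le> real d * 2" using n1 inner_V_self_nonneg[of "s 1"]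
        by (intro mult_mono) auto
      then have "inner_V (s 1) (s 1) / \<rho>\<^sup>2 \<le> real d * 2"
        by (simp only: times_divide_eq_right mult_1_right)
      moreover have "real d \<le> (real d)\<^sup>2" using degree_ge_3 by (simp add: power2_eq_square)
      ultimately have "inner_V (s 0) (s 0) + inner_V (s 1) (s 1) / \<rho>\<^sup>2 \<le> 3 * (real d)\<^sup>2"
        using n0 by linarith
      then show ?thesis using \<kappa> by (intro mult_right_mono mult_left_mono) auto
    qed
    also have "\<dots> = (C1 * \<rho> ^ k)\<^sup>2" using \<kappa> by (simp add: C1_def power_mult_distrib)
    finally show ?thesis using C1 rho by (auto simp: abs_le_square_iff[symmetric] abs_mult)
  qed
  have edge: "\<bar>hit k y x v - 1 / n\<bar> \<le> (2 * C1 + 1) * \<rho> ^ k" if "(x, y) \<in> E" for k x y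
    using that
  proof (induction k arbitrary: x y)
    case 0
    have "\<bar>hit 0 y x v - 1 / n\<bar> \<le> 1" using n by (auto simp: abs_le_iff field_simps)
    then show ?case using C1 by simp
  next
    case (Suc k)
    have xV: "x \<in> V" using Suc.prems E_in_V by blast
    have "hit (Suc k) y x v - 1 / n = (s (Suc k) x - (hit k x y v - 1 / n)) / q"
    proof -
      have "hit (Suc k) y x v = (inflow v (Suc k) x - hit k x y v) / q"
        using Suc.prems xV by (simp add: sum_nxt_edge card_nxt inflow_Suc q_def)
      moreover have "real d = q + 1" using degree_ge_3 by (simp add: q_def of_nat_diff)
      moreover have "H - 1 / n = (I - D / n - (b - 1 / n)) / q" if "H = (I - b) / q" "D = q + 1" for H I b D :: real
        using q2 n by (simp add: that field_simps)
      ultimately show ?thesis unfolding s_def by blast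
    qed
    then have "\<bar>hit (Suc k) y x v - 1 / n\<bar> \<le> (\<bar>s (Suc k) x\<bar> + \<bar>hit k x y v - 1 / n\<bar>) / q"
      using q2 by (simp add: abs_divide divide_right_mono)
    also have "\<dots> \<le> (C1 * \<rho> ^ Suc k + (2 * C1 + 1) * \<rho> ^ k) / q"
      using q2 decay[OF xV, of "Suc k"] Suc.IH[OF E_sym[OF Suc.prems]] by (intro divide_right_mono add_mono) auto
    also have "\<dots> \<le> (C1 * \<rho> ^ Suc k + (2 * C1 + 1) * \<rho> ^ k) / 2"
      using q2 C1 rho by (intro divide_left_mono) auto
    also have "\<dots> = (C1 * \<rho> + (2 * C1 + 1)) / 2 * \<rho> ^ k" by (simp add: algebra_simps)
    \<comment> \<open>Equivalent to 2 \<open>C1\<close> + 1 \<le> (3 \<open>C1\<close> + 2) \<rho>,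
      which holds for \<rho> \<ge> 3/4.\<close>
    also have "\<dots> \<le> ((2 * C1 + 1) * \<rho>) * \<rho> ^ k"
    proof (intro mult_right_mono)
      have "C1 * (3/4) \<le> C1 * \<rho>" using C1 rho by (intro mult_left_mono) auto
      then show "(C1 * \<rho> + (2 * C1 + 1)) / 2 \<le> (2 * C1 + 1) * \<rho>"
        using rho(1) C1 by (simp add: algebra_simps)
    qed (use rho in auto)
    finally show ?case by (simp add: mult_ac)
  qed
  show ?thesis
  proof (cases "(x, y) \<in> E")
    case True
    then show ?thesis using edge unfolding C1_def n_def \<kappa>_def by blast
  next
    case False
    have "\<bar>hit k y x v - 1 / n\<bar> \<le> (2 * C1 + 1) * \<rho> ^ k"
    proof (cases k)
      case 0
      have "\<bar>hit 0 y x v - 1 / n\<bar> \<le> 1" using n by (auto simp: abs_le_iff field_simps)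
      then show ?thesis using C1 0 by simp
    next
      case (Suc j)
      have "nxt y x = E `` {x}" using False by (auto simp: nxt_def)
      then have "hit k y x v = inflow v (Suc j) x / d"
        using x Suc by (simp add: inflow_Suc card_nbrs)
      then have "hit k y x v - 1 / n = s k x / d"
        using degree_ge_3 Suc by (simp add: s_def diff_divide_distrib)
      then have "\<bar>hit k y x v - 1 / n\<bar> \<le> \<bar>s k x\<bar> / 1"
        using degree_ge_3 by (simp add: abs_divide) (intro divide_left_mono[of 1, simplified], auto)
      also have "\<dots> \<le> C1 * \<rho> ^ k" using decay[OF x] by simp
      also have "\<dots> \<le> (2 * C1 + 1) * \<rho> ^ k" using C1 rho by (intro mult_right_mono) auto
      finally show ?thesis .
    qed
    then show ?thesis unfolding C1_def n_def \<kappa>_def .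
  qed
qed

end

section \<open>Factorial moments of visit counts\<close>

lemma bernoulli_power_ge:
  fixes x c :: real
  assumes "0 \<le> x" "0 \<le> c"
  shows "x ^ Suc m + real (Suc m) * c * x ^ m \<le> (x + c) ^ Suc m"
proof (induction m)
  case (Suc m)
  have "x ^ Suc (Suc m) + real (Suc (Suc m)) * c * x ^ Suc m
      \<le> (x + c) * (x ^ Suc m + real (Suc m) * c * x ^ m)"
    using assms by (simp add: algebra_simps)
  also have "\<dots> \<le> (x + c) * (x + c) ^ Suc m"
    using Suc assms by (intro mult_left_mono) auto
  finally show ?case by simp
qed auto

lemma bernoulli_power_diff_ge:
  fixes x :: real
  assumes "1 \<le> x"
  shows "x ^ Suc m - real (Suc m) * x ^ m \<le> (x - 1) ^ Suc m"
proof (induction m)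
  case (Suc m)
  have "x ^ Suc (Suc m) - real (Suc (Suc m)) * x ^ Suc m \<le> (x - 1) * (x ^ Suc m - real (Suc m) * x ^ m)"
    using assms by (simp add: algebra_simps)
  also have "\<dots> \<le> (x - 1) * (x - 1) ^ Suc m"
    using Suc assms by (intro mult_left_mono) auto
  finally show ?case by simp
qed auto

text \<open>\<open>psi\<close> and \<open>chi\<close> are explicit super- and subsolutions of the renewal recursion for the moments,
  where short gaps have total weight \<open>\<beta>\<close> and are ignored for the lower bound.\<close>

definition psi :: "real \<Rightarrow> real \<Rightarrow> nat \<Rightarrow> nat \<Rightarrow> real" where
  "psi c \<beta> m k = (c * real k + real m * \<beta>) ^ m / fact m"

definition chi :: "real \<Rightarrow> nat \<Rightarrow> nat \<Rightarrow> nat \<Rightarrow> real" where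
  "chi c \<tau> m k = (c * real (k - m * Suc \<tau>)) ^ m / fact m"

lemma psi_nonneg: "0 \<le> c \<Longrightarrow> 0 \<le> \<beta> \<Longrightarrow> 0 \<le> psi c \<beta> m k"
  by (simp add: psi_def)

lemma psi_mono: "0 \<le> c \<Longrightarrow> 0 \<le> \<beta> \<Longrightarrow> j \<le> k \<Longrightarrow> psi c \<beta> m j \<le> psi c \<beta> m k"
  unfolding psi_def by (intro divide_right_mono power_mono add_mono mult_left_mono) auto

lemma chi_nonneg: "0 \<le> c \<Longrightarrow> 0 \<le> chi c \<tau> m k"
  by (simp add: chi_def)

text \<open>Discrete integration: by Bernoulli each summand, times m + 1, is at most an increment of
  the next power, and these telescope. Raising the shift from m \<beta> to (m+1) \<beta> absorbs the
  \<beta> term.\<close>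

lemma psi_Suc_ge:
  assumes "0 \<le> c" "0 \<le> \<beta>"
  shows "\<beta> * psi c \<beta> m k + c * (\<Sum>j<k. psi c \<beta> m j) \<le> psi c \<beta> (Suc m) k"
proof -
  define b where "b = real m * \<beta>"
  have b: "0 \<le> b" using assms by (simp add: b_def)
  have sum: "(\<Sum>j<k. real (Suc m) * c * (c * real j + b) ^ m) \<le> (c * real k + b) ^ Suc m"
  proof (induction k)
    case 0
    then show ?case using b by simp
  next
    case (Suc k)
    have "(\<Sum>j<Suc k. real (Suc m) * c * (c * real j + b) ^ m)
        \<le> (c * real k + b) ^ Suc m + real (Suc m) * c * (c * real k + b) ^ m"
      using Suc by simp
    also have "\<dots> \<le> (c * real k + b + c) ^ Suc m"
      using assms b by (intro bernoulli_power_ge) auto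
    finally show ?case by (simp add: algebra_simps)
  qed
  have "real (Suc m) * \<beta> * (c * real k + b) ^ m + (\<Sum>j<k. real (Suc m) * c * (c * real j + b) ^ m)
      \<le> (c * real k + b) ^ Suc m + real (Suc m) * \<beta> * (c * real k + b) ^ m"
    using sum by simp
  also have "\<dots> \<le> (c * real k + b + \<beta>) ^ Suc m"
    using assms b by (intro bernoulli_power_ge) auto
  also have "c * real k + b + \<beta> = c * real k + real (Suc m) * \<beta>"
    by (simp add: b_def algebra_simps)
  finally have "(real (Suc m) * \<beta> * (c * real k + b) ^ m + (\<Sum>j<k. real (Suc m) * c * (c * real j + b) ^ m)) / fact (Suc m)
      \<le> psi c \<beta> (Suc m) k"
    unfolding psi_def by (rule divide_right_mono) simp
  moreover have "\<beta> * psi c \<beta> m k + c * (\<Sum>j<k. psi c \<beta> m j) =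
      (real (Suc m) * \<beta> * (c * real k + b) ^ m + (\<Sum>j<k. real (Suc m) * c * (c * real j + b) ^ m)) / fact (Suc m)"
  proof -
    have eq: "psi c \<beta> m j = real (Suc m) * (c * real j + b) ^ m / fact (Suc m)" for j
      unfolding psi_def b_def by (simp add: divide_simps del: of_nat_Suc)
    show ?thesis unfolding eq
      by (simp add: add_divide_distrib sum_divide_distrib sum_distrib_left mult_ac del: of_nat_Suc fact_Suc)
  qed
  ultimately show ?thesis by simp
qed

text \<open>Each visit discards the gaps below \<tau>, and comparing a sum with an integral loses
  one more step, hence \<open>Suc \<tau>\<close>. Truncated subtraction yields 0 when so many
  windows do not fit into k.\<close>

lemma chi_Suc_le:
  assumes "0 \<le> c"
  shows "chi c \<tau> (Suc m) k \<le> c * (\<Sum>j<k - \<tau>. chi c \<tau> m j)"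
proof -
  define M where "M = m * Suc \<tau>"
  have sum: "real (N - M) ^ Suc m \<le> real (Suc m) * (\<Sum>j\<le>N. real (j - M) ^ m)" for N
  proof (induction N)
    case (Suc N)
    show ?case
    proof (cases "Suc N \<le> M")
      case True
      then show ?thesis by (auto intro!: mult_nonneg_nonneg sum_nonneg)
    next
      case False
      then have eq: "real (N - M) = real (Suc N - M) - 1" and "1 \<le> real (Suc N - M)" by (auto simp: of_nat_diff)
      from bernoulli_power_diff_ge[OF this(2), of m]
      have "real (Suc N - M) ^ Suc m \<le> real (N - M) ^ Suc m + real (Suc m) * real (Suc N - M) ^ m"
        unfolding eq by linarith
      also have "\<dots> \<le> real (Suc m) * (\<Sum>j\<le>N. real (j - M) ^ m) + real (Suc m) * real (Suc N - M) ^ m"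
        using Suc by (intro add_right_mono)
      finally show ?thesis by (simp only: sum.atMost_Suc distrib_left)
    qed
  qed (auto)
  show ?thesis
  proof (cases "\<tau> < k")
    case False
    then show ?thesis by (simp add: chi_def)
  next
    case True
    define N where "N = k - Suc \<tau>"
    have N: "{..<k - \<tau>} = {..N}" "k - Suc m * Suc \<tau> = N - M" using True by (auto simp: N_def M_def)
    have "chi c \<tau> (Suc m) k = c ^ Suc m * real (N - M) ^ Suc m / fact (Suc m)"
      by (simp only: chi_def N power_mult_distrib)
    also have "\<dots> \<le> c ^ Suc m * (real (Suc m) * (\<Sum>j\<le>N. real (j - M) ^ m)) / fact (Suc m)"
      using sum[of N] assms by (intro divide_right_mono mult_left_mono) auto
    also have "\<dots> = c ^ Suc m * (\<Sum>j\<le>N. real (j - M) ^ m) / fact m"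
      by (simp add: divide_simps del: of_nat_Suc)
    also have "\<dots> = c * (\<Sum>j<k - \<tau>. chi c \<tau> m j)"
      unfolding N chi_def by (simp add: M_def sum_distrib_left sum_divide_distrib power_mult_distrib mult_ac)
    finally show ?thesis .
  qed
qed

text \<open>Here i + 1 is the time until the next counted visit and \<phi> bounds what happens
  afterwards. Early times have total weight \<beta> and are charged the largest value
  \<open>\<phi> k\<close>; later ones are charged c each.\<close>

lemma convolution_le:
  fixes h \<phi> :: "nat \<Rightarrow> real"
  assumes h0: "\<And>i. 0 \<le> h i" and hs: "(\<Sum>i<\<tau>. h i) \<le> \<beta>" and hc: "\<And>i. \<tau> \<le> i \<Longrightarrow> h i \<le> c"
    and p0: "\<And>j. 0 \<le> \<phi> j" and pm: "\<And>i j. i \<le> j \<Longrightarrow> \<phi> i \<le> \<phi> j" and c: "0 \<le> c"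
  shows "(\<Sum>i<k. h i * \<phi> (k - Suc i)) \<le> \<beta> * \<phi> k + c * (\<Sum>j<k. \<phi> j)"
proof -
  have "(\<Sum>i<k. h i * \<phi> (k - Suc i)) \<le> (\<Sum>i<k. (if i < \<tau> then h i * \<phi> k else 0) + c * \<phi> (k - Suc i))"
  proof (intro sum_mono)
    fix i
    show "h i * \<phi> (k - Suc i) \<le> (if i < \<tau> then h i * \<phi> k else 0) + c * \<phi> (k - Suc i)"
      using mult_left_mono[OF pm[of "k - Suc i" k] h0[of i]] mult_right_mono[OF hc[of i] p0[of "k - Suc i"]]
        mult_nonneg_nonneg[OF c p0[of "k - Suc i"]] by auto
  qed
  also have "\<dots> = (\<Sum>i<k. if i < \<tau> then h i * \<phi> k else 0) + c * (\<Sum>i<k. \<phi> (k - Suc i))"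
    by (simp add: sum.distrib sum_distrib_left)
  also have "(\<Sum>i<k. \<phi> (k - Suc i)) = (\<Sum>j<k. \<phi> j)" by (rule sum.nat_diff_reindex)
  also have "(\<Sum>i<k. if i < \<tau> then h i * \<phi> k else 0) = (\<Sum>i\<in>{..<k} \<inter> {..<\<tau>}. h i) * \<phi> k"
    by (simp add: sum.If_cases sum_distrib_right lessThan_def Int_def)
  also have "\<dots> \<le> (\<Sum>i<\<tau>. h i) * \<phi> k"
    by (intro mult_right_mono sum_mono2 p0) (auto simp: h0)
  also have "\<dots> \<le> \<beta> * \<phi> k" by (intro mult_right_mono hs p0)
  finally show ?thesis by simp
qed

lemma convolution_ge:
  fixes h \<phi> :: "nat \<Rightarrow> real"
  assumes h0: "\<And>i. 0 \<le> h i" and hc: "\<And>i. \<tau> \<le> i \<Longrightarrow> c \<le> h i" and p0: "\<And>j. 0 \<le> \<phi> j"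
  shows "c * (\<Sum>j<k - \<tau>. \<phi> j) \<le> (\<Sum>i<k. h i * \<phi> (k - Suc i))"
proof -
  have "c * (\<Sum>j<k - \<tau>. \<phi> j) = (\<Sum>i<k - \<tau>. c * \<phi> (k - \<tau> - Suc i))"
    by (subst sum.nat_diff_reindex[symmetric]) (simp add: sum_distrib_left)
  also have "\<dots> \<le> (\<Sum>i<k - \<tau>. h (i + \<tau>) * \<phi> (k - Suc (i + \<tau>)))"
    using hc p0 by (intro sum_mono) (auto intro!: mult_right_mono simp: add.commute)
  also have "\<dots> = (\<Sum>i\<in>(\<lambda>i. i + \<tau>) ` {..<k - \<tau>}. h i * \<phi> (k - Suc i))"
    by (subst sum.reindex) (auto simp: inj_on_def)
  also have "\<dots> \<le> (\<Sum>i<k. h i * \<phi> (k - Suc i))"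
    by (intro sum_mono2) (auto simp: h0 p0)
  finally show ?thesis .
qed

context regular_graph begin

section \<open>Renewal inequalities for joint factorial moments\<close>

text \<open>Summing over the position of the first step that contributes to \<open>F\<close>.\<close>

lemma ev_first_visit_le:
  fixes a b :: "nat \<Rightarrow> real"
  assumes F0: "F [] = 0"
    and F: "\<And>z zs. F (z # zs) = F zs + (if z = u then A zs else 0) + (if z = v then B zs else 0)"
    and A: "\<And>j y. ev j A y u \<le> a j" and B: "\<And>j y. ev j B y v \<le> b j"
    and x: "x \<in> V"
  shows "ev k F y x \<le> (\<Sum>i<k. hit (Suc i) y x u * a (k - Suc i)) + (\<Sum>i<k. hit (Suc i) y x v * b (k - Suc i))"
  using x
proof (induction k arbitrary: y x)
  case 0
  then show ?case by (simp add: F0)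
next
  case (Suc k)
  define N where "N = real (card (nxt y x))"
  have zero: "ev k (\<lambda>_. 0) x z = 0" if "z \<in> V" for z using that by (rule ev_const)
  have "ev (Suc k) F y x = (\<Sum>z\<in>nxt y x. ev k F x z + (if z = u then ev k A x z else 0) + (if z = v then ev k B x z else 0)) / N"
    unfolding ev.simps F ev_add N_def
    by (intro arg_cong[where f = "\<lambda>s. s / _"] sum.cong) (auto simp: zero dest: nxt_in_V)
  also have "\<dots> \<le> (\<Sum>z\<in>nxt y x. (\<Sum>i<Suc k. hit i x z u * a (k - i)) + (\<Sum>i<Suc k. hit i x z v * b (k - i))) / N"
  proof (intro divide_right_mono sum_mono)
    fix z assume z: "z \<in> nxt y x"
    have "ev k F x z + (if z = u then ev k A x z else 0) + (if z = v then ev k B x z else 0)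
        \<le> ((\<Sum>i<k. hit (Suc i) x z u * a (k - Suc i)) + (\<Sum>i<k. hit (Suc i) x z v * b (k - Suc i)))
          + hit 0 x z u * a k + hit 0 x z v * b k"
      using Suc.IH[OF nxt_in_V[OF z], of x] A B by (intro add_mono) auto
    also have "\<dots> = (\<Sum>i<Suc k. hit i x z u * a (k - i)) + (\<Sum>i<Suc k. hit i x z v * b (k - i))"
      unfolding sum.lessThan_Suc_shift by simp
    finally show "ev k F x z + (if z = u then ev k A x z else 0) + (if z = v then ev k B x z else 0)
        \<le> (\<Sum>i<Suc k. hit i x z u * a (k - i)) + (\<Sum>i<Suc k. hit i x z v * b (k - i))" .
  qed (simp add: N_def)
  also have "\<dots> = (\<Sum>i<Suc k. hit (Suc i) y x u * a (Suc k - Suc i)) + (\<Sum>i<Suc k. hit (Suc i) y x v * b (Suc k - Suc i))"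
  proof -
    have "(\<Sum>z\<in>nxt y x. \<Sum>i<Suc k. hit i x z w * g (k - i)) / N = (\<Sum>i<Suc k. hit (Suc i) y x w * g (Suc k - Suc i))" for w g
      by (subst sum.swap) (simp add: N_def sum_divide_distrib sum_distrib_right del: sum.lessThan_Suc)
    then show ?thesis by (simp only: sum.distrib add_divide_distrib)
  qed
  finally show ?case .
qed

lemma ev_first_visit_ge:
  fixes a b :: "nat \<Rightarrow> real"
  assumes F0: "F [] = 0"
    and F: "\<And>z zs. F (z # zs) = F zs + (if z = u then A zs else 0) + (if z = v then B zs else 0)"
    and A: "\<And>j y. a j \<le> ev j A y u" and B: "\<And>j y. b j \<le> ev j B y v"
    and x: "x \<in> V"
  shows "(\<Sum>i<k. hit (Suc i) y x u * a (k - Suc i)) + (\<Sum>i<k. hit (Suc i) y x v * b (k - Suc i)) \<le> ev k F y x"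
proof -
  have neg: "ev j (\<lambda>zs. - G zs) y x = - ev j G y x" for j G y x
    using ev_cmult[of j "-1" G y x] by simp
  have "ev k (\<lambda>zs. - F zs) y x \<le> (\<Sum>i<k. hit (Suc i) y x u * - a (k - Suc i)) + (\<Sum>i<k. hit (Suc i) y x v * - b (k - Suc i))"
    by (rule ev_first_visit_le[where A = "\<lambda>zs. - A zs" and B = "\<lambda>zs. - B zs"]) (auto simp: F0 F neg A B x)
  then show ?thesis by (simp add: neg sum_negf)
qed

text \<open>For s = 0 the second vertex has no influence, so moments of one vertex are written
  \<open>moment u u r 0\<close>.\<close>

definition moment :: "'a \<Rightarrow> 'a \<Rightarrow> nat \<Rightarrow> nat \<Rightarrow> nat \<Rightarrow> 'a \<Rightarrow> 'a \<Rightarrow> real" where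
  "moment u v r s k y x = ev k (\<lambda>zs. real ((count_list zs u choose r) * (count_list zs v choose s))) y x"

text \<open>Pascal's rule: the first step is either among the chosen visits or not. The hypothesis
  ensures that one step cannot change both factors.\<close>

lemma count_choose_Cons:
  assumes "u \<noteq> v \<or> s = 0"
  shows "real ((count_list (z # zs) u choose r) * (count_list (z # zs) v choose s)) =
    real ((count_list zs u choose r) * (count_list zs v choose s))
    + (if z = u then if r = 0 then 0 else real ((count_list zs u choose (r - 1)) * (count_list zs v choose s)) else 0)
    + (if z = v then if s = 0 then 0 else real ((count_list zs u choose r) * (count_list zs v choose (s - 1))) else 0)"
  using assms by (cases r; cases s) (auto simp: algebra_simps)

lemma pascal_split:
  assumes "r + s = Suc m"
  shows "(if r = 0 then 0 else real (m choose (r - 1))) + (if s = 0 then 0 else real (m choose r)) = real (Suc m choose r)"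
  using assms by (cases r; cases s) (auto simp: binomial_eq_0)

text \<open>Induction on r + s, splitting by whether the first chosen visit is to u or to v. The
  walk then restarts there, which is why \<open>short\<close> is required from every point of U with
  arbitrary previous vertex, and for the initial state separately. The binomial coefficient counts
  the orders in which the visits interleave, so \<open>psi\<close> depends on r + s only.\<close>

lemma moment_upper:
  assumes uv: "u \<noteq> v \<or> s = 0" and c: "0 \<le> c" "0 \<le> \<beta>"
    and UV: "U \<subseteq> V" "u \<in> U" "s = 0 \<or> v \<in> U"
    and long: "\<And>i y x t. \<tau> \<le> i \<Longrightarrow> x \<in> V \<Longrightarrow> t \<in> U \<Longrightarrow> hit (Suc i) y x t \<le> c"
    and short: "\<And>y x t. x \<in> U \<Longrightarrow> t \<in> U \<Longrightarrow> (\<Sum>i<\<tau>. hit (Suc i) y x t) \<le> \<beta>"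
    and x: "x \<in> V" "\<And>t. t \<in> U \<Longrightarrow> (\<Sum>i<\<tau>. hit (Suc i) y x t) \<le> \<beta>"
  shows "moment u v r s k y x \<le> real ((r + s) choose r) * psi c \<beta> (r + s) k"
  using uv UV(3) x
proof (induction "r + s" arbitrary: r s k y x)
  case 0
  then show ?case by (simp add: moment_def psi_def ev_const)
next
  case (Suc m)
  note m = Suc(2)[symmetric]
  define A where "A = (\<lambda>zs. if r = 0 then 0 else real ((count_list zs u choose (r - 1)) * (count_list zs v choose s)))"
  define B where "B = (\<lambda>zs. if s = 0 then 0 else real ((count_list zs u choose r) * (count_list zs v choose (s - 1))))"
  define ca where "ca = (if r = 0 then 0 else real (m choose (r - 1)))"
  define cb where "cb = (if s = 0 then 0 else real (m choose r))"
  define \<phi> where "\<phi> = psi c \<beta> m"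
  have \<phi>0: "0 \<le> \<phi> j" for j using c by (simp add: \<phi>_def psi_nonneg)
  have conv: "(\<Sum>i<k. hit (Suc i) y x t * \<phi> (k - Suc i)) \<le> psi c \<beta> (Suc m) k" if "t \<in> U" for t
  proof -
    have "(\<Sum>i<k. hit (Suc i) y x t * \<phi> (k - Suc i)) \<le> \<beta> * \<phi> k + c * (\<Sum>j<k. \<phi> j)"
      by (rule convolution_le[where \<tau> = \<tau>])
        (use c long Suc.prems that in \<open>auto simp: \<phi>_def psi_nonneg psi_mono hit_nonneg simp del: hit.simps\<close>)
    also have "\<dots> \<le> psi c \<beta> (Suc m) k" unfolding \<phi>_def using c by (rule psi_Suc_ge)
    finally show ?thesis .
  qed
  have "moment u v r s k y x \<le> (\<Sum>i<k. hit (Suc i) y x u * (ca * \<phi> (k - Suc i))) + (\<Sum>i<k. hit (Suc i) y x v * (cb * \<phi> (k - Suc i)))"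
    unfolding moment_def
  proof (rule ev_first_visit_le[where A = A and B = B])
    show "real ((count_list [] u choose r) * (count_list [] v choose s)) = 0"
      using m by (cases r; cases s) auto
    show "real ((count_list (z # zs) u choose r) * (count_list (z # zs) v choose s)) =
      real ((count_list zs u choose r) * (count_list zs v choose s)) + (if z = u then A zs else 0) + (if z = v then B zs else 0)" for z zs
      unfolding A_def B_def by (rule count_choose_Cons) (use Suc.prems in auto)
    show "ev j A y u \<le> ca * \<phi> j" for j y
    proof (cases r)
      case 0
      then show ?thesis using UV by (simp add: A_def ca_def ev_const subset_iff)
    next
      case (Suc r')
      have "moment u v r' s j y u \<le> real ((r' + s) choose r') * psi c \<beta> (r' + s) j"
        by (rule Suc.hyps(1)) (use Suc m UV short Suc.prems in auto)
      then show ?thesis using Suc m by (simp add: A_def ca_def \<phi>_def moment_def)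
    qed
    show "ev j B y v \<le> cb * \<phi> j" for j y
    proof (cases s)
      case 0
      \<comment> \<open>For s = 0 it is not known that v lies in V, so \<open>ev_const\<close> does
        not apply.\<close>
      have "ev j (\<lambda>_. 0) y v = 0" using ev_cmult[of j 0 "\<lambda>_. 0"] by simp
      then show ?thesis using 0 by (simp add: B_def cb_def)
    next
      case (Suc s')
      have "moment u v r s' j y v \<le> real ((r + s') choose r) * psi c \<beta> (r + s') j"
        by (rule Suc.hyps(1)) (use Suc m UV short Suc.prems in auto)
      then show ?thesis using Suc m by (simp add: B_def cb_def \<phi>_def moment_def)
    qed
  qed (use Suc.prems in auto)
  also have "\<dots> = ca * (\<Sum>i<k. hit (Suc i) y x u * \<phi> (k - Suc i)) + cb * (\<Sum>i<k. hit (Suc i) y x v * \<phi> (k - Suc i))"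
    by (simp only: sum_distrib_left mult_ac)
  also have "\<dots> \<le> ca * psi c \<beta> (Suc m) k + cb * psi c \<beta> (Suc m) k"
  proof (intro add_mono)
    show "ca * (\<Sum>i<k. hit (Suc i) y x u * \<phi> (k - Suc i)) \<le> ca * psi c \<beta> (Suc m) k"
      by (intro mult_left_mono conv UV) (simp add: ca_def)
    show "cb * (\<Sum>i<k. hit (Suc i) y x v * \<phi> (k - Suc i)) \<le> cb * psi c \<beta> (Suc m) k"
      using conv[of v] Suc.prems(2) by (cases "s = 0") (auto simp: cb_def intro: mult_left_mono simp del: hit.simps)
  qed
  also have "\<dots> = real (Suc m choose r) * psi c \<beta> (Suc m) k"
    using pascal_split[OF m] by (simp add: ca_def cb_def distrib_right[symmetric] del: binomial_Suc_Suc)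
  finally show ?case by (simp only: m)
qed

text \<open>The same induction; short gaps contribute nonnegatively and are dropped, so no
  separation of the vertices enters.\<close>

lemma moment_lower:
  assumes uv: "u \<noteq> v \<or> s = 0" and c: "0 \<le> c"
    and UV: "U \<subseteq> V" "u \<in> U" "s = 0 \<or> v \<in> U"
    and long: "\<And>i y x t. \<tau> \<le> i \<Longrightarrow> x \<in> V \<Longrightarrow> t \<in> U \<Longrightarrow> c \<le> hit (Suc i) y x t"
    and x: "x \<in> V"
  shows "real ((r + s) choose r) * chi c \<tau> (r + s) k \<le> moment u v r s k y x"
  using uv UV(3) x
proof (induction "r + s" arbitrary: r s k y x)
  case 0
  then show ?case by (simp add: moment_def chi_def ev_const)
next
  case (Suc m)
  note m = Suc(2)[symmetric]
  define A where "A = (\<lambda>zs. if r = 0 then 0 else real ((count_list zs u choose (r - 1)) * (count_list zs v choose s)))"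
  define B where "B = (\<lambda>zs. if s = 0 then 0 else real ((count_list zs u choose r) * (count_list zs v choose (s - 1))))"
  define ca where "ca = (if r = 0 then 0 else real (m choose (r - 1)))"
  define cb where "cb = (if s = 0 then 0 else real (m choose r))"
  define \<phi> where "\<phi> = chi c \<tau> m"
  have conv: "chi c \<tau> (Suc m) k \<le> (\<Sum>i<k. hit (Suc i) y x t * \<phi> (k - Suc i))" if "t \<in> U" for t
  proof -
    have "chi c \<tau> (Suc m) k \<le> c * (\<Sum>j<k - \<tau>. \<phi> j)" unfolding \<phi>_def using c by (rule chi_Suc_le)
    also have "\<dots> \<le> (\<Sum>i<k. hit (Suc i) y x t * \<phi> (k - Suc i))"
      by (rule convolution_ge) (use c long Suc.prems that in \<open>auto simp: \<phi>_def chi_nonneg hit_nonneg simp del: hit.simps\<close>)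
    finally show ?thesis .
  qed
  have "real (Suc m choose r) * chi c \<tau> (Suc m) k = ca * chi c \<tau> (Suc m) k + cb * chi c \<tau> (Suc m) k"
    using pascal_split[OF m] by (simp add: ca_def cb_def distrib_right[symmetric] del: binomial_Suc_Suc)
  also have "\<dots> \<le> ca * (\<Sum>i<k. hit (Suc i) y x u * \<phi> (k - Suc i)) + cb * (\<Sum>i<k. hit (Suc i) y x v * \<phi> (k - Suc i))"
  proof (intro add_mono)
    show "ca * chi c \<tau> (Suc m) k \<le> ca * (\<Sum>i<k. hit (Suc i) y x u * \<phi> (k - Suc i))"
      by (intro mult_left_mono conv UV) (simp add: ca_def)
    show "cb * chi c \<tau> (Suc m) k \<le> cb * (\<Sum>i<k. hit (Suc i) y x v * \<phi> (k - Suc i))"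
      using conv[of v] Suc.prems(2) by (cases "s = 0") (auto simp: cb_def intro: mult_left_mono simp del: hit.simps)
  qed
  also have "\<dots> = (\<Sum>i<k. hit (Suc i) y x u * (ca * \<phi> (k - Suc i))) + (\<Sum>i<k. hit (Suc i) y x v * (cb * \<phi> (k - Suc i)))"
    by (simp only: sum_distrib_left mult_ac)
  also have "\<dots> \<le> moment u v r s k y x"
    unfolding moment_def
  proof (rule ev_first_visit_ge[where A = A and B = B])
    show "real ((count_list [] u choose r) * (count_list [] v choose s)) = 0"
      using m by (cases r; cases s) auto
    show "real ((count_list (z # zs) u choose r) * (count_list (z # zs) v choose s)) =
      real ((count_list zs u choose r) * (count_list zs v choose s)) + (if z = u then A zs else 0) + (if z = v then B zs else 0)" for z zs
      unfolding A_def B_def by (rule count_choose_Cons) (use Suc.prems in auto)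
    show "ca * \<phi> j \<le> ev j A y u" for j y
    proof (cases r)
      case 0
      then show ?thesis using UV by (simp add: A_def ca_def ev_const subset_iff)
    next
      case (Suc r')
      have "real ((r' + s) choose r') * chi c \<tau> (r' + s) j \<le> moment u v r' s j y u"
        by (rule Suc.hyps(1)) (use Suc m UV Suc.prems in auto)
      then show ?thesis using Suc m by (simp add: A_def ca_def \<phi>_def moment_def)
    qed
    show "cb * \<phi> j \<le> ev j B y v" for j y
    proof (cases s)
      case 0
      have "ev j (\<lambda>_. 0) y v = 0" using ev_cmult[of j 0 "\<lambda>_. 0"] by simp
      then show ?thesis using 0 by (simp add: B_def cb_def)
    next
      case (Suc s')
      have "real ((r + s') choose r) * chi c \<tau> (r + s') j \<le> moment u v r s' j y v"
        by (rule Suc.hyps(1)) (use Suc m UV Suc.prems in auto)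
      then show ?thesis using Suc m by (simp add: B_def cb_def \<phi>_def moment_def)
    qed
  qed (use Suc.prems in auto)
  finally show ?case by (simp only: m)
qed

end

section \<open>Bonferroni inequalities\<close>

text \<open>Inclusion-exclusion for the indicator of X = t, truncated after J + 1 terms.\<close>

definition bonf :: "nat \<Rightarrow> nat \<Rightarrow> nat \<Rightarrow> real" where
  "bonf J t X = (\<Sum>j\<le>J. (-1) ^ j * real (t + j choose t) * real (X choose (t + j)))"

lemma alternating_binomial_sum:
  "(\<Sum>j\<le>J. (-1) ^ j * real (Suc Z choose j)) = (-1) ^ J * real (Z choose J)"
  by (induction J) (auto simp: algebra_simps)

lemma bonf_eq: "bonf J t X = real (X choose t) * (\<Sum>j\<le>J. (-1) ^ j * real ((X - t) choose j))"
proof -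
  have "real (t + j choose t) * real (X choose (t + j)) = real (X choose t) * real ((X - t) choose j)" for j
  proof (cases "t + j \<le> X")
    case True
    have "(X choose (t + j)) * (t + j choose t) = (X choose t) * ((X - t) choose (t + j - t))"
      by (rule choose_mult) (use True in auto)
    then show ?thesis by (metis add_diff_cancel_left' mult.commute of_nat_mult)
  next
    case False
    then show ?thesis by (cases "t \<le> X") (auto simp: binomial_eq_0)
  qed
  then show ?thesis by (simp add: bonf_def sum_distrib_left mult_ac)
qed

text \<open>For X > t the truncated sum is (-1)^J times a product of binomial coefficients, so its
  sign is that of the last term kept; for X \<le> t it is exact.\<close>

lemma bonf_bounds:
  shows "even J \<Longrightarrow> (if X = t then 1 else 0) \<le> bonf J t X"
    and "odd J \<Longrightarrow> bonf J t X \<le> (if X = t then 1 else 0)"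
proof -
  consider "X < t" | "X = t" | Z where "X - t = Suc Z" "X \<noteq> t"
    by (metis linorder_neqE_nat less_imp_Suc_add add_diff_cancel_left' add_Suc_right less_irrefl)
  then have "bonf J t X = (if X = t then 1 else (-1) ^ J * \<bar>bonf J t X\<bar>)"
  proof cases
    case 1
    then show ?thesis by (simp add: bonf_eq binomial_eq_0)
  next
    case 2
    have "(\<Sum>j\<le>J. (-1) ^ j * real (0 choose j)) = 1" by (induction J) auto
    then show ?thesis using 2 by (simp add: bonf_eq)
  next
    case 3
    then show ?thesis by (simp add: bonf_eq alternating_binomial_sum abs_mult)
  qed
  then show "even J \<Longrightarrow> (if X = t then 1 else 0) \<le> bonf J t X"
    and "odd J \<Longrightarrow> bonf J t X \<le> (if X = t then 1 else 0)"
    by (auto split: if_splits)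
qed

lemma alternating_exp_error:
  "\<bar>(\<Sum>j\<le>J. (-1) ^ j / fact j) - exp (-1 :: real)\<bar> \<le> 3 / fact (Suc J)"
proof -
  obtain s :: real where s: "\<bar>s\<bar> \<le> \<bar>-1\<bar>" "exp (-1) = (\<Sum>m<Suc J. (-1) ^ m / fact m) + exp s / fact (Suc J) * (-1) ^ Suc J"
    using Maclaurin_exp_le by blast
  have "exp s \<le> exp 1" using s(1) by simp
  then have "exp s \<le> 3" using exp_le by linarith
  have "(\<Sum>j\<le>J. (-1) ^ j / fact j) - exp (-1 :: real) = - (exp s / fact (Suc J) * (-1) ^ Suc J)"
    using s(2) by (simp add: lessThan_Suc_atMost)
  also have "\<bar>\<dots>\<bar> = exp s / fact (Suc J)" by (simp add: abs_mult power_abs)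
  also have "\<dots> \<le> 3 / fact (Suc J)" using \<open>exp s \<le> 3\<close> by (intro divide_right_mono) auto
  finally show ?thesis .
qed

lemma sum_inverse_fact_le: "(\<Sum>j\<le>J. 1 / fact j) \<le> (3 :: real)"
proof -
  obtain s :: real where "exp 1 = (\<Sum>m<Suc J. 1 ^ m / fact m) + exp s / fact (Suc J) * 1 ^ Suc J"
    using Maclaurin_exp_le by blast
  then have "(\<Sum>j\<le>J. 1 / fact j) \<le> exp (1 :: real)"
    by (simp add: lessThan_Suc_atMost)
  then show ?thesis using exp_le by linarith
qed

section \<open>From factorial moments to the probabilities of exactly t visits\<close>

context regular_graph begin

definition visits :: "'a \<Rightarrow> nat \<Rightarrow> 'a list \<Rightarrow> real" where
  "visits u t zs = (if count_list zs u = t then 1 else 0)"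

text \<open>Since (t+j choose t) / (t+j)! = 1 / (t! j!), the ideal Poisson moments give a partial
  sum for exp(-1) over t!. The deviation \<eta> is weighted by the sum of 1/j!, at most 3.\<close>

lemma visits_ev_lower:
  assumes x: "x \<in> V" and J: "odd J"
    and moment: "\<And>r. r \<le> t + J \<Longrightarrow> \<bar>moment u u r 0 k y x * fact r - 1\<bar> \<le> \<eta>"
  shows "(exp (-1) - 3 / fact (Suc J) - 3 * \<eta>) / fact t \<le> ev k (visits u t) y x"
proof -
  define e where "e j = moment u u (t + j) 0 k y x" for j
  have "ev k (\<lambda>zs. bonf J t (count_list zs u)) y x = (\<Sum>j\<le>J. (-1) ^ j * real (t + j choose t) * e j)"
    unfolding bonf_def using x by (subst ev_sum) (auto simp: ev_cmult e_def moment_def)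
  also have "\<dots> = (\<Sum>j\<le>J. ((-1) ^ j / fact j + (-1) ^ j * (e j * fact (t + j) - 1) / fact j)) / fact t"
    unfolding sum_divide_distrib
    by (intro sum.cong) (auto simp: binomial_fact field_simps)
  also have "\<dots> \<ge> (exp (-1) - 3 / fact (Suc J) - 3 * \<eta>) / fact t"
  proof (intro divide_right_mono)
    have eta: "0 \<le> \<eta>" using moment[of 0] by linarith
    have "(\<Sum>j\<le>J. - (\<eta> / fact j)) \<le> (\<Sum>j\<le>J. (-1) ^ j * (e j * fact (t + j) - 1) / fact j)"
    proof (intro sum_mono)
      fix j assume "j \<in> {..J}"
      then have "\<bar>e j * fact (t + j) - 1\<bar> \<le> \<eta>" using moment[of "t + j"] by (simp add: e_def)
      then have "\<bar>(-1) ^ j * (e j * fact (t + j) - 1) / fact j\<bar> \<le> \<eta> / fact j"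
        by (simp add: abs_mult power_abs divide_right_mono)
      then show "- (\<eta> / fact j) \<le> (-1) ^ j * (e j * fact (t + j) - 1) / fact j" by linarith
    qed
    moreover have "(\<Sum>j\<le>J. - (\<eta> / fact j)) = - (\<eta> * (\<Sum>j\<le>J. 1 / fact j))"
      by (simp add: sum_negf sum_distrib_left)
    moreover have "\<eta> * (\<Sum>j\<le>J. 1 / fact j) \<le> \<eta> * 3"
      using eta sum_inverse_fact_le by (intro mult_left_mono)
    ultimately show "exp (-1) - 3 / fact (Suc J) - 3 * \<eta> \<le> (\<Sum>j\<le>J. ((-1) ^ j / fact j + (-1) ^ j * (e j * fact (t + j) - 1) / fact j))"
      using alternating_exp_error[of J] unfolding sum.distrib by linarith
  qed simp
  finally have "(exp (-1) - 3 / fact (Suc J) - 3 * \<eta>) / fact t \<le> ev k (\<lambda>zs. bonf J t (count_list zs u)) y x" .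
  also have "\<dots> \<le> ev k (visits u t) y x"
    by (intro ev_mono) (simp add: visits_def bonf_bounds(2)[OF J])
  finally show ?thesis .
qed

lemma visits_ev_le: "x \<in> V \<Longrightarrow> ev k (visits u t) y x \<le> moment u u t 0 k y x"
  unfolding moment_def by (intro ev_mono) (auto simp: visits_def)

text \<open>For even J each \<open>bonf\<close> dominates a nonnegative indicator, so the two bounds
  may be multiplied. A lower truncation may be negative and would not allow this; the second moment
  needs only the upper bound.\<close>

lemma visits_ev_pair_upper:
  assumes x: "x \<in> V" and J: "even J"
    and moment: "\<And>r s. r \<le> t + J \<Longrightarrow> s \<le> t + J \<Longrightarrow> \<bar>moment u v r s k y x * fact r * fact s - 1\<bar> \<le> \<eta>"
  shows "ev k (\<lambda>zs. visits u t zs * visits v t zs) y x \<le> ((exp (-1) + 3 / fact (Suc J))\<^sup>2 + 9 * \<eta>) / (fact t)\<^sup>2"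
proof -
  define e where "e i j = moment u v (t + i) (t + j) k y x" for i j
  define S where "S = (\<Sum>j\<le>J. (-1) ^ j / fact j :: real)"
  have eta: "0 \<le> \<eta>" using moment[of 0 0] by linarith
  have "ev k (\<lambda>zs. visits u t zs * visits v t zs) y x \<le>
      ev k (\<lambda>zs. bonf J t (count_list zs u) * bonf J t (count_list zs v)) y x"
  proof (intro ev_mono)
    have *: "0 \<le> visits w t zs \<and> visits w t zs \<le> bonf J t (count_list zs w)" for w zs
      using bonf_bounds(1)[OF J, of "count_list zs w" t] by (auto simp: visits_def)
    show "visits u t zs * visits v t zs \<le> bonf J t (count_list zs u) * bonf J t (count_list zs v)" for zs
      using *[of u zs] *[of v zs] by (intro mult_mono) auto
  qed
  also have "\<dots> = (\<Sum>i\<le>J. \<Sum>j\<le>J. ((-1) ^ i * (-1) ^ j * real (t + i choose t) * real (t + j choose t)) * e i j)"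
  proof -
    have "bonf J t (count_list zs u) * bonf J t (count_list zs v) =
        (\<Sum>i\<le>J. \<Sum>j\<le>J. ((-1) ^ i * (-1) ^ j * real (t + i choose t) * real (t + j choose t)) *
          real ((count_list zs u choose (t + i)) * (count_list zs v choose (t + j))))" for zs
      unfolding bonf_def sum_product by (intro sum.cong refl) (simp add: mult_ac)
    then show ?thesis using x by (simp add: ev_sum ev_cmult e_def moment_def)
  qed
  also have "\<dots> = (\<Sum>i\<le>J. \<Sum>j\<le>J. ((-1) ^ i / fact i * ((-1) ^ j / fact j)
      + (-1) ^ i * (-1) ^ j * (e i j * fact (t + i) * fact (t + j) - 1) / (fact i * fact j)) / (fact t)\<^sup>2)"
    by (intro sum.cong refl) (auto simp: binomial_fact field_simps power2_eq_square)
  also have "\<dots> \<le> (\<Sum>i\<le>J. \<Sum>j\<le>J. ((-1) ^ i / fact i * ((-1) ^ j / fact j) + \<eta> * (1 / fact i * (1 / fact j))) / (fact t)\<^sup>2)"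
  proof (intro sum_mono divide_right_mono add_left_mono)
    fix i j assume "i \<in> {..J}" "j \<in> {..J}"
    then have "\<bar>e i j * fact (t + i) * fact (t + j) - 1\<bar> \<le> \<eta>" using moment[of "t + i" "t + j"] by (simp add: e_def)
    then have "\<bar>(-1) ^ i * (-1) ^ j * (e i j * fact (t + i) * fact (t + j) - 1) / (fact i * fact j)\<bar> \<le> \<eta> / (fact i * fact j)"
      by (simp add: abs_mult power_abs divide_right_mono)
    from abs_le_D1[OF this]
    show "(-1) ^ i * (-1) ^ j * (e i j * fact (t + i) * fact (t + j) - 1) / (fact i * fact j) \<le> \<eta> * (1 / fact i * (1 / fact j))"
      by simp
  qed auto
  also have "\<dots> = (S\<^sup>2 + \<eta> * (\<Sum>j\<le>J. 1 / fact j)\<^sup>2) / (fact t)\<^sup>2"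
    unfolding S_def power2_eq_square[of "sum _ _"] sum_product sum_divide_distrib[symmetric]
    by (simp only: sum.distrib sum_distrib_left)
  also have "\<dots> \<le> ((exp (-1) + 3 / fact (Suc J))\<^sup>2 + \<eta> * 3\<^sup>2) / (fact t)\<^sup>2"
  proof (intro divide_right_mono add_mono mult_left_mono eta)
    have "\<bar>S\<bar> \<le> exp (-1) + 3 / fact (Suc J)"
      using alternating_exp_error[of J] unfolding S_def[symmetric] by (smt (verit) exp_gt_zero)
    then show "S\<^sup>2 \<le> (exp (-1) + 3 / fact (Suc J))\<^sup>2" by (metis abs_ge_zero power2_abs power_mono)
    show "(\<Sum>j\<le>J. 1 / fact j)\<^sup>2 \<le> (3::real)\<^sup>2" by (intro power_mono sum_inverse_fact_le sum_nonneg) auto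
  qed auto
  finally show ?thesis by (simp add: mult.commute)
qed

end

section \<open>The second moment method\<close>

lemma power_le_one_plus:
  fixes b :: real
  assumes "0 \<le> b" "m \<le> R" "real R * b \<le> 1"
  shows "(1 + b) ^ m \<le> 1 + 2 * (real R * b)"
proof -
  have "(1 + b) ^ m \<le> (1 + b) ^ R" using assms by (intro power_increasing) auto
  also have "\<dots> \<le> exp b ^ R" using assms exp_ge_add_one_self by (intro power_mono) auto
  also have "\<dots> = exp (real R * b)" by (simp add: exp_of_nat_mult)
  also have "\<dots> \<le> 1 + real R * b + (real R * b)\<^sup>2" using assms by (intro exp_bound) auto
  also have "(real R * b)\<^sup>2 \<le> real R * b"
    using assms mult_left_mono[of "real R * b" 1 "real R * b"] by (simp add: power2_eq_square)
  finally show ?thesis by linarith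
qed

lemma one_minus_power_ge:
  fixes a :: real
  assumes "0 \<le> a" "a \<le> 1" "m \<le> R"
  shows "1 - real R * a \<le> (1 - a) ^ m"
proof -
  have "1 + real R * - a \<le> (1 + - a) ^ R" using assms by (intro Bernoulli_inequality) auto
  also have "\<dots> \<le> (1 - a) ^ m" using assms by (simp add: power_decreasing)
  finally show ?thesis by simp
qed

text \<open>Here \<tau> is the mixing time, \<epsilon> the relative mixing error and R the largest
  order of moments in use. The three parts of \<eta> come from imperfect mixing, from short gaps (in
  \<open>psi\<close>) and from the discarded windows (in \<open>chi\<close>); the factor 2 is that
  of \<open>power_le_one_plus\<close>.\<close>

locale mixing_walk = regular_graph V E d for V :: "'a set" and E d +
  fixes h \<tau> R :: nat and \<epsilon> \<eta> :: real and w :: 'a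
  assumes w: "w \<in> V" and h: "1 \<le> h"
    and no_short: "no_short_cycle (2 * h)"
    and eps: "0 \<le> \<epsilon>" "\<epsilon> \<le> 1"
    and mix: "\<And>i y x v. \<tau> \<le> i \<Longrightarrow> x \<in> V \<Longrightarrow> v \<in> V \<Longrightarrow>
      \<bar>hit (Suc i) y x v - 1 / real (card V)\<bar> \<le> \<epsilon> / real (card V)"
    and R: "1 \<le> R"
    and eta_def: "\<eta> = 2 * (real R * (\<epsilon> + real R * (real \<tau> / real (d - 1) ^ h) + real R * real (Suc \<tau>) / real (card V)))"
    and eta: "\<eta> \<le> 1"
begin

definition "n = card V"
definition "\<beta> = real \<tau> / real (d - 1) ^ h"
definition "cu = (1 + \<epsilon>) / real n"
definition "cl = (1 - \<epsilon>) / real n"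
text \<open>From the start, vertices in its own ball can be hit too early for the bound \<beta>.
  Leaving them out changes the count of vertices by at most \<open>D\<close>.\<close>

definition "far = V - near h w"
definition "D = real (d ^ h)"

lemma n_pos: "0 < n"
  using w finite_V by (auto simp: n_def card_gt_0_iff)

lemma beta_nonneg: "0 \<le> \<beta>" and cu_nonneg: "0 \<le> cu" and cl_nonneg: "0 \<le> cl"
  using eps by (auto simp: \<beta>_def cu_def cl_def)

lemma hit_bounds: "\<tau> \<le> i \<Longrightarrow> x \<in> V \<Longrightarrow> v \<in> V \<Longrightarrow> cl \<le> hit (Suc i) y x v \<and> hit (Suc i) y x v \<le> cu"
  using mix[of i x v y] unfolding cl_def cu_def n_def add_divide_distrib diff_divide_distrib abs_le_iff
  by linarith

lemma short_sum_le:
  assumes "x \<in> V" "x = t \<or> t \<notin> near h x"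
  shows "(\<Sum>i<\<tau>. hit (Suc i) y x t) \<le> \<beta>"
proof -
  have "hit (Suc i) y x t \<le> 1 / real (d - 1) ^ h" for i
  proof (cases "Suc i < h")
    case True
    then show ?thesis using hit_short_zero[OF no_short _ True assms(2)] by (simp del: hit.simps)
  next
    case False
    then show ?thesis using hit_le_power_shift[OF no_short _ assms(1), of "Suc i"] by (simp del: hit.simps)
  qed
  then have "(\<Sum>i<\<tau>. hit (Suc i) y x t) \<le> (\<Sum>i<\<tau>. 1 / real (d - 1) ^ h)" by (rule sum_mono)
  then show ?thesis by (simp add: \<beta>_def)
qed

lemma binomial_times_fact: "real ((r + s) choose r) * (a / fact (r + s)) * fact r * fact s = a"
  using binomial_fact[of r "r + s", where 'a = real] by simp

lemma eta_parts:
  "real R * (\<epsilon> + real R * \<beta>) \<le> \<eta> / 2" "real R * (\<epsilon> + real R * real (Suc \<tau>) / real n) \<le> \<eta> / 2" "0 \<le> \<eta>"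
proof -
  have eq: "\<eta> / 2 = real R * (\<epsilon> + real R * \<beta> + real R * real (Suc \<tau>) / real n)"
    unfolding eta_def \<beta>_def n_def by simp
  have "0 \<le> real R * \<beta>" "0 \<le> real R * real (Suc \<tau>) / real n" using beta_nonneg by auto
  then show "real R * (\<epsilon> + real R * \<beta>) \<le> \<eta> / 2" "real R * (\<epsilon> + real R * real (Suc \<tau>) / real n) \<le> \<eta> / 2"
    unfolding eq by (auto intro!: mult_left_mono)
  have "0 \<le> \<eta> / 2" unfolding eq using eps \<open>0 \<le> real R * \<beta>\<close> beta_nonneg by (intro mult_nonneg_nonneg add_nonneg_nonneg) auto
  then show "0 \<le> \<eta>" by simp
qed

lemma psi_bound: "m \<le> R \<Longrightarrow> psi cu \<beta> m n \<le> (1 + \<eta>) / fact m"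
proof -
  assume m: "m \<le> R"
  have "cu * real n + real m * \<beta> \<le> 1 + (\<epsilon> + real R * \<beta>)"
    using n_pos m beta_nonneg by (simp add: cu_def mult_right_mono)
  then have "(cu * real n + real m * \<beta>) ^ m \<le> (1 + (\<epsilon> + real R * \<beta>)) ^ m"
    using cu_nonneg beta_nonneg by (intro power_mono) auto
  also have "\<dots> \<le> 1 + 2 * (real R * (\<epsilon> + real R * \<beta>))"
    using m eps beta_nonneg eta_parts eta by (intro power_le_one_plus) auto
  also have "\<dots> \<le> 1 + \<eta>" using eta_parts by simp
  finally show ?thesis unfolding psi_def by (rule divide_right_mono) simp
qed

lemma chi_bound: "m \<le> R \<Longrightarrow> (1 - \<eta>) / fact m \<le> chi cl \<tau> m n"
proof -
  assume m: "m \<le> R"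
  define q where "q = real R * real (Suc \<tau>) / real n"
  define a where "a = \<epsilon> + q"
  have q: "0 \<le> q" by (simp add: q_def)
  have a: "0 \<le> a" "real R * a \<le> \<eta> / 2" using eta_parts q eps by (auto simp: a_def q_def)
  have "1 * a \<le> real R * a" using R a by (intro mult_right_mono) auto
  then have a1: "a \<le> 1" using a eta by simp
  have "1 - \<eta> \<le> 1 - real R * a" using a eta_parts(3) by simp
  also have "\<dots> \<le> (1 - a) ^ m" using a a1 m by (intro one_minus_power_ge) auto
  also have "\<dots> \<le> (cl * real (n - m * Suc \<tau>)) ^ m"
  proof (intro power_mono)
    have "real n - real R * real (Suc \<tau>) \<le> real n - real (m * Suc \<tau>)"
      unfolding of_nat_mult using m by (intro diff_left_mono mult_right_mono) auto
    also have "\<dots> \<le> real (n - m * Suc \<tau>)" by linarith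
    finally have "(real n - real R * real (Suc \<tau>)) / real n \<le> real (n - m * Suc \<tau>) / real n"
      by (rule divide_right_mono) simp
    then have "1 - q \<le> real (n - m * Suc \<tau>) / real n"
      using n_pos by (simp add: q_def diff_divide_distrib)
    then have "(1 - \<epsilon>) * (1 - q) \<le> (1 - \<epsilon>) * (real (n - m * Suc \<tau>) / real n)"
      using eps by (intro mult_left_mono) auto
    also have "\<dots> = cl * real (n - m * Suc \<tau>)" by (simp add: cl_def)
    finally have "(1 - \<epsilon>) * (1 - q) \<le> cl * real (n - m * Suc \<tau>)" .
    moreover have "0 \<le> \<epsilon> * q" using eps q by simp
    ultimately show "1 - a \<le> cl * real (n - m * Suc \<tau>)" by (simp add: a_def algebra_simps)
  qed (use a1 in simp)
  finally show ?thesis unfolding chi_def by (rule divide_right_mono) simp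
qed

lemma moment_error:
  assumes uv: "u \<noteq> v \<or> s = 0" and UV: "U \<subseteq> V" "u \<in> U" "s = 0 \<or> v \<in> U"
    and sep: "\<And>x t. x \<in> U \<Longrightarrow> t \<in> U \<Longrightarrow> x = t \<or> t \<notin> near h x" "\<And>t. t \<in> U \<Longrightarrow> t \<notin> near h w"
    and m: "r + s \<le> R"
  shows "\<bar>moment u v r s n w w * fact r * fact s - 1\<bar> \<le> \<eta>"
proof -
  have "moment u v r s n w w \<le> real ((r + s) choose r) * psi cu \<beta> (r + s) n"
    by (rule moment_upper[where \<tau> = \<tau>, OF uv cu_nonneg beta_nonneg UV])
      (use hit_bounds UV short_sum_le sep w in \<open>auto simp: subset_iff simp del: hit.simps\<close>)
  also have "\<dots> \<le> real ((r + s) choose r) * ((1 + \<eta>) / fact (r + s))"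
    by (intro mult_left_mono psi_bound m) simp
  finally have "moment u v r s n w w * fact r * fact s \<le> real ((r + s) choose r) * ((1 + \<eta>) / fact (r + s)) * fact r * fact s"
    by (intro mult_right_mono) auto
  then have upper: "moment u v r s n w w * fact r * fact s \<le> 1 + \<eta>" by (simp only: binomial_times_fact)
  have "real ((r + s) choose r) * ((1 - \<eta>) / fact (r + s)) \<le> real ((r + s) choose r) * chi cl \<tau> (r + s) n"
    by (intro mult_left_mono chi_bound m) simp
  also have "\<dots> \<le> moment u v r s n w w"
    by (rule moment_lower[OF uv cl_nonneg UV]) (use hit_bounds UV w in \<open>auto simp: subset_iff simp del: hit.simps\<close>)
  finally have "real ((r + s) choose r) * ((1 - \<eta>) / fact (r + s)) * fact r * fact s \<le> moment u v r s n w w * fact r * fact s"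
    by (intro mult_right_mono) auto
  then have lower: "1 - \<eta> \<le> moment u v r s n w w * fact r * fact s" by (simp only: binomial_times_fact)
  show ?thesis using upper lower by linarith
qed

lemma moment_error_single:
  assumes "u \<in> far" "r \<le> R"
  shows "\<bar>moment u u r 0 n w w * fact r - 1\<bar> \<le> \<eta>"
  using moment_error[of u u 0 "{u}" r] assms by (auto simp: far_def)

lemma moment_error_pair:
  assumes "u \<in> far" "v \<in> far" "v \<notin> near h u" "r + s \<le> R"
  shows "\<bar>moment u v r s n w w * fact r * fact s - 1\<bar> \<le> \<eta>"
proof -
  have "u \<in> near h u" using h by (auto simp: near_def intro!: bexI[of _ 0])
  then have "u \<noteq> v" using assms(3) by auto
  then show ?thesis
    using assms near_sym[of u h v] by (intro moment_error[of u v s "{u, v}" r]) (auto simp: far_def)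
qed

section \<open>Concentration of the number of vertices visited t times\<close>

definition N where "N t zs = (\<Sum>u\<in>V. visits u t zs)"
definition N' where "N' t zs = (\<Sum>u\<in>far. visits u t zs)"
definition \<mu> where "\<mu> t = real n / (exp 1 * fact t)"

lemma finite_far: "finite far" and far_subset: "far \<subseteq> V"
  using finite_V by (auto simp: far_def)

lemma card_far_le: "real (card far) \<le> real n"
  using card_mono[OF finite_V far_subset] by (simp add: n_def)

lemma card_near_le: "x \<in> V \<Longrightarrow> real (card (near h x)) \<le> D"
  using card_near[of x h] unfolding D_def of_nat_le_iff .

lemma card_far_ge: "real n - D \<le> real (card far)"
proof -
  have "card V \<le> card far + card (near h w)"
    unfolding far_def using card_Un_le[of "V - near h w" "near h w"] finite_near[OF w] finite_V
      card_mono[of "(V - near h w) \<union> near h w" V] by fastforce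
  then have "real n \<le> real (card far) + real (card (near h w))" by (simp add: n_def)
  then show ?thesis using card_near_le[OF w] by linarith
qed

lemma D_ge_1: "1 \<le> D"
  using degree_ge_3 by (simp add: D_def)

lemma N_diff: "0 \<le> N t zs - N' t zs" "N t zs - N' t zs \<le> D"
proof -
  have "N t zs - N' t zs = (\<Sum>u\<in>V - far. visits u t zs)"
    unfolding N_def N'_def using sum_diff[OF finite_V far_subset, of "\<lambda>u. visits u t zs"] by simp
  moreover have "(\<Sum>u\<in>V - far. visits u t zs) \<le> (\<Sum>u\<in>near h w. 1)"
    using finite_near[OF w] by (intro order_trans[OF sum_mono sum_mono2]) (auto simp: far_def visits_def)
  ultimately show "0 \<le> N t zs - N' t zs" "N t zs - N' t zs \<le> D"
    using card_near_le[OF w] by (auto simp: visits_def intro!: sum_nonneg)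
qed

text \<open>The deviation is taken from the Poisson target \<open>\<mu> t\<close> rather than from
  the mean, so expanding the square needs only an upper bound for pairs and a lower bound for single
  vertices. Pairs within a common ball number at most n D and are bounded by one single probability
  each, which gives the relative error D t!/n.\<close>

lemma second_moment:
  assumes J: "even J" and R: "2 * (t + J + 1) \<le> R"
  defines "\<zeta> \<equiv> 9 * \<eta> + 15 / fact (Suc J)"
  shows "ev n (\<lambda>zs. (N' t zs - \<mu> t)\<^sup>2) w w \<le> (\<mu> t)\<^sup>2 * (27 * \<zeta> + 36 * D * fact t / real n)"
proof -
  define p where "p = (1 / fact t :: real)"
  define e where "e = exp (-1 :: real)"
  define \<theta> where "\<theta> = (1 / fact (Suc J) :: real)"
  have p: "0 < p" "p \<le> 1" by (auto simp: p_def fact_ge_1)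
  have e: "0 < e" "e \<le> 1" by (auto simp: e_def)
  have \<theta>: "0 < \<theta>" "\<theta> \<le> 1" by (auto simp: \<theta>_def fact_ge_1 simp del: fact_Suc)
  have \<zeta>: "\<zeta> = 9 * \<eta> + 15 * \<theta>" by (simp add: \<zeta>_def \<theta>_def)
  have \<zeta>0: "0 \<le> \<zeta>" using \<theta> eta_parts(3) by (simp add: \<zeta>)
  have \<mu>: "\<mu> t = real n * e * p" by (simp add: \<mu>_def e_def p_def exp_minus divide_inverse)
  have single: "p * (e - \<zeta>) \<le> ev n (visits u t) w w" if "u \<in> far" for u
  proof -
    have "(exp (-1) - 3 / fact (Suc (Suc J)) - 3 * \<eta>) / fact t \<le> ev n (visits u t) w w"
      \<comment> \<open>The lower bound takes an odd truncation, so it is applied with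
        \<open>Suc J\<close>; this is why R has to reach t + J + 1.\<close>
      by (rule visits_ev_lower[OF w]) (use J R moment_error_single[OF that] in auto)
    moreover have "3 / fact (Suc (Suc J)) \<le> 15 * \<theta>"
    proof -
      have "(fact (Suc J) :: real) \<le> fact (Suc (Suc J))" by (intro fact_mono) auto
      then have "3 / fact (Suc (Suc J)) \<le> 3 / (fact (Suc J) :: real)"
        by (intro divide_left_mono) (auto simp del: fact_Suc)
      also have "\<dots> \<le> 15 / fact (Suc J)" by (intro divide_right_mono) auto
      finally show ?thesis by (simp only: \<theta>_def times_divide_eq_right mult_1_right)
    qed
    then have "p * (e - \<zeta>) \<le> (exp (-1) - 3 / fact (Suc (Suc J)) - 3 * \<eta>) / fact t"
      using eta_parts(3) unfolding p_def e_def \<zeta> by (simp add: divide_right_mono del: fact_Suc)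
    ultimately show ?thesis by linarith
  qed
  have close: "ev n (visits u t) w w \<le> 2 * p" if "u \<in> far" for u
  proof -
    have "\<bar>moment u u t 0 n w w * fact t - 1\<bar> \<le> \<eta>" using R by (intro moment_error_single that) auto
    then have "moment u u t 0 n w w * fact t \<le> 2" using eta by linarith
    then have "moment u u t 0 n w w \<le> 2 * p" by (simp add: p_def field_simps)
    then show ?thesis using visits_ev_le[OF w, of n u t w] by linarith
  qed
  have pair: "ev n (\<lambda>zs. visits u t zs * visits v t zs) w w \<le> p\<^sup>2 * (e\<^sup>2 + \<zeta>) + (if v \<in> near h u then 2 * p else 0)"
    if uv: "u \<in> far" "v \<in> far" for u v
  proof (cases "v \<in> near h u")
    case True
    have "ev n (\<lambda>zs. visits u t zs * visits v t zs) w w \<le> ev n (visits u t) w w"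
      by (intro ev_mono) (auto simp: visits_def)
    moreover have "0 \<le> p\<^sup>2 * (e\<^sup>2 + \<zeta>)" using \<zeta>0 by simp
    ultimately show ?thesis using close[OF uv(1)] True by simp
  next
    case False
    have "ev n (\<lambda>zs. visits u t zs * visits v t zs) w w \<le> ((exp (-1) + 3 / fact (Suc J))\<^sup>2 + 9 * \<eta>) / (fact t)\<^sup>2"
      by (rule visits_ev_pair_upper[OF w J]) (use R moment_error_pair[OF uv False] in auto)
    also have "\<dots> = p\<^sup>2 * ((e + 3 * \<theta>)\<^sup>2 + 9 * \<eta>)"
      by (simp add: p_def e_def \<theta>_def power_divide del: fact_Suc)
    also have "\<dots> \<le> p\<^sup>2 * (e\<^sup>2 + \<zeta>)"
    proof (intro mult_left_mono)
      have "e * \<theta> \<le> 1 * \<theta>" "\<theta> * \<theta> \<le> 1 * \<theta>" using e \<theta> by (intro mult_right_mono; simp)+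
      then show "(e + 3 * \<theta>)\<^sup>2 + 9 * \<eta> \<le> e\<^sup>2 + \<zeta>"
        by (simp add: \<zeta> power2_eq_square algebra_simps)
    qed simp
    finally show ?thesis using False by simp
  qed
  have A: "ev n (\<lambda>zs. (N' t zs)\<^sup>2) w w \<le> (real n)\<^sup>2 * (p\<^sup>2 * (e\<^sup>2 + \<zeta>)) + real n * D * (2 * p)"
  proof -
    have "ev n (\<lambda>zs. (N' t zs)\<^sup>2) w w = (\<Sum>u\<in>far. \<Sum>v\<in>far. ev n (\<lambda>zs. visits u t zs * visits v t zs) w w)"
      unfolding N'_def power2_eq_square sum_product by (simp add: ev_sum w)
    also have "\<dots> \<le> (\<Sum>u\<in>far. \<Sum>v\<in>far. p\<^sup>2 * (e\<^sup>2 + \<zeta>) + (if v \<in> near h u then 2 * p else 0))"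
      by (intro sum_mono pair)
    also have "\<dots> = (real (card far))\<^sup>2 * (p\<^sup>2 * (e\<^sup>2 + \<zeta>)) + (\<Sum>u\<in>far. \<Sum>v\<in>far. if v \<in> near h u then 2 * p else 0)"
      by (simp add: sum.distrib power2_eq_square)
    also have "\<dots> \<le> (real n)\<^sup>2 * (p\<^sup>2 * (e\<^sup>2 + \<zeta>)) + real n * D * (2 * p)"
    proof (intro add_mono mult_right_mono power_mono card_far_le)
      have "(\<Sum>u\<in>far. \<Sum>v\<in>far. if v \<in> near h u then 2 * p else 0) \<le> (\<Sum>u\<in>far. D * (2 * p))"
      proof (intro sum_mono)
        fix u assume "u \<in> far"
        then have u: "u \<in> V" using far_subset by auto
        have "(\<Sum>v\<in>far. if v \<in> near h u then 2 * p else 0) = (\<Sum>v\<in>far \<inter> near h u. 2 * p)"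
          by (rule sum.inter_restrict[OF finite_far, symmetric])
        also have "\<dots> \<le> (\<Sum>v\<in>near h u. 2 * p)"
          using p finite_near[OF u] by (intro sum_mono2) auto
        also have "\<dots> \<le> D * (2 * p)" using card_near_le[OF u] p by (simp add: mult_right_mono)
        finally show "(\<Sum>v\<in>far. if v \<in> near h u then 2 * p else 0) \<le> D * (2 * p)" .
      qed
      also have "\<dots> = real (card far) * (D * (2 * p))" by simp
      also have "\<dots> \<le> real n * (D * (2 * p))" using card_far_le p D_ge_1 by (intro mult_right_mono) auto
      finally show "(\<Sum>u\<in>far. \<Sum>v\<in>far. if v \<in> near h u then 2 * p else 0) \<le> real n * D * (2 * p)" by simp
    qed (use p \<zeta>0 in auto)
    finally show ?thesis .
  qed
  have B: "p * ((real n - D) * e - real n * \<zeta>) \<le> ev n (N' t) w w"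
  proof -
    have "p * ((real n - D) * e - real n * \<zeta>) \<le> p * (real (card far) * e - real (card far) * \<zeta>)"
      using card_far_ge card_far_le p e \<zeta>0 by (intro mult_left_mono diff_mono mult_right_mono) auto
    also have "\<dots> = (\<Sum>u\<in>far. p * (e - \<zeta>))" by (simp add: algebra_simps)
    also have "\<dots> \<le> (\<Sum>u\<in>far. ev n (visits u t) w w)" by (intro sum_mono single)
    also have "\<dots> = ev n (N' t) w w" unfolding N'_def[abs_def] by (simp add: ev_sum w)
    finally show ?thesis .
  qed
  have "ev n (\<lambda>zs. (N' t zs - \<mu> t)\<^sup>2) w w = ev n (\<lambda>zs. (N' t zs)\<^sup>2 - (2 * \<mu> t) * N' t zs + (\<mu> t)\<^sup>2) w w"
    by (intro arg_cong[where f = "\<lambda>F. ev n F w w"] ext) (simp add: power2_eq_square algebra_simps)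
  also have "\<dots> = ev n (\<lambda>zs. (N' t zs)\<^sup>2) w w - 2 * \<mu> t * ev n (N' t) w w + (\<mu> t)\<^sup>2"
    by (simp add: ev_add ev_diff ev_cmult ev_const w)
  also have "\<dots> \<le> ((real n)\<^sup>2 * (p\<^sup>2 * (e\<^sup>2 + \<zeta>)) + real n * D * (2 * p))
      - 2 * \<mu> t * (p * ((real n - D) * e - real n * \<zeta>)) + (\<mu> t)\<^sup>2"
    using A B p e by (intro add_mono diff_mono mult_left_mono) (auto simp: \<mu>)
  also have "\<dots> = (real n * p)\<^sup>2 * \<zeta> * (1 + 2 * e) + 2 * real n * D * p * (1 + p * e\<^sup>2)"
    unfolding \<mu> by (simp add: power2_eq_square algebra_simps)
  also have "\<dots> \<le> (real n * p)\<^sup>2 * \<zeta> * 3 + 2 * real n * D * p * 2"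
  proof -
    have "p * e\<^sup>2 \<le> 1 * 1" using p e by (intro mult_mono) (auto simp: power_le_one)
    then show ?thesis using e p \<zeta>0 D_ge_1
      by (intro add_mono mult_left_mono mult_nonneg_nonneg) auto
  qed
  also have "\<dots> = (real n * p)\<^sup>2 * (3 * \<zeta> + 4 * D * fact t / real n)"
    using n_pos by (simp add: p_def power2_eq_square field_simps)
  \<comment> \<open>As exp(-1) \<ge> 1/3, the factor 9 e^2 is at least 1; it turns (n p)^2 into
    \<open>(\<mu> t)\<^sup>2\<close>.\<close>
  also have "\<dots> \<le> (real n * p)\<^sup>2 * ((9 * e\<^sup>2) * (3 * \<zeta> + 4 * D * fact t / real n))"
  proof -
    have "1 / 3 \<le> e" unfolding e_def exp_minus using exp_le by (simp add: field_simps)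
    then have "(1/3)\<^sup>2 \<le> e\<^sup>2" by (intro power_mono) auto
    then have "1 \<le> 9 * e\<^sup>2" by (simp add: power2_eq_square)
    then have "1 * (3 * \<zeta> + 4 * D * fact t / real n) \<le> (9 * e\<^sup>2) * (3 * \<zeta> + 4 * D * fact t / real n)"
      using \<zeta>0 D_ge_1 by (intro mult_right_mono) auto
    then show ?thesis by (intro mult_left_mono) auto
  qed
  also have "\<dots> = (\<mu> t)\<^sup>2 * (27 * \<zeta> + 36 * D * fact t / real n)"
    unfolding \<mu> by (simp add: power_mult_distrib algebra_simps)
  finally show ?thesis .
qed

text \<open>Large visit counts must be excluded near the start too. The first chosen visit is
  bounded crudely, by probability 1 at each of the first \<tau> times; after it the walk is at u
  itself, where \<open>moment_upper\<close> holds for every vertex. The price is a factor of order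
  \<tau> and one index of the factorial.\<close>

lemma moment_any_vertex:
  assumes u: "u \<in> V" and T: "1 \<le> T" "T \<le> R"
  shows "moment u u T 0 n w w \<le> 2 * (real \<tau> + 2) / fact (T - 1)"
proof -
  obtain T' where T': "T = Suc T'" using T by (cases T) auto
  define \<phi> where "\<phi> = psi cu \<beta> T'"
  have \<phi>0: "0 \<le> \<phi> j" for j using cu_nonneg beta_nonneg by (simp add: \<phi>_def psi_nonneg)
  have \<phi>mono: "\<phi> i \<le> \<phi> j" if "i \<le> j" for i j using cu_nonneg beta_nonneg that by (simp add: \<phi>_def psi_mono)
  have A: "ev j (\<lambda>zs. real ((count_list zs u choose T') * (count_list zs u choose 0))) y u \<le> \<phi> j" for j y
  proof -
    have "moment u u T' 0 j y u \<le> real ((T' + 0) choose T') * psi cu \<beta> (T' + 0) j"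
      by (rule moment_upper[where U = "{u}" and \<tau> = \<tau>])
        (use u hit_bounds short_sum_le cu_nonneg beta_nonneg in \<open>auto simp del: hit.simps\<close>)
    then show ?thesis by (simp add: moment_def \<phi>_def)
  qed
  have "moment u u T 0 n w w \<le> (\<Sum>i<n. hit (Suc i) w w u * \<phi> (n - Suc i)) + (\<Sum>i<n. hit (Suc i) w w u * (\<lambda>_. 0) (n - Suc i))"
    unfolding moment_def
  proof (rule ev_first_visit_le[where A = "\<lambda>zs. real ((count_list zs u choose T') * (count_list zs u choose 0))" and B = "\<lambda>_. 0"])
    show "ev j (\<lambda>_. 0) y u \<le> 0" for j y using u by (simp add: ev_const)
  qed (use A w T' in \<open>auto simp: algebra_simps\<close>)
  also have "\<dots> \<le> real \<tau> * \<phi> n + cu * (\<Sum>j<n. \<phi> j)"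
  proof -
    have "(\<Sum>i<\<tau>. hit (Suc i) w w u) \<le> (\<Sum>i<\<tau>. 1)" using hit_le_1[OF w] by (intro sum_mono)
    then have "(\<Sum>i<n. hit (Suc i) w w u * \<phi> (n - Suc i)) \<le> real \<tau> * \<phi> n + cu * (\<Sum>j<n. \<phi> j)"
      using hit_bounds[OF _ w u] \<phi>0 \<phi>mono cu_nonneg by (intro convolution_le) (auto simp: hit_nonneg simp del: hit.simps)
    then show ?thesis by simp
  qed
  also have "\<dots> \<le> real \<tau> * \<phi> n + cu * (\<Sum>j<n. \<phi> n)"
    using cu_nonneg \<phi>mono by (intro add_left_mono mult_left_mono sum_mono) auto
  also have "\<dots> = (real \<tau> + (1 + \<epsilon>)) * \<phi> n" using n_pos by (simp add: cu_def field_simps)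
  also have "\<dots> \<le> (real \<tau> + 2) * (2 / fact T')"
  proof (intro mult_mono)
    have "\<phi> n \<le> (1 + \<eta>) / fact T'" unfolding \<phi>_def using T T' by (intro psi_bound) auto
    also have "\<dots> \<le> 2 / fact T'" using eta by (intro divide_right_mono) auto
    finally show "\<phi> n \<le> 2 / fact T'" .
  qed (use eps \<phi>0 in auto)
  finally show ?thesis by (simp add: T' algebra_simps)
qed

text \<open>The bad indicator is dominated by a sum of Chebyshev terms over t and of binomials
  (visits to u choose T1) over u, each at least 1 on its own failure event. One \<alpha> of the
  allowed 2 \<alpha> pays for the ball around the start.\<close>

lemma prob_bad_le:
  assumes J: "even J" and R0: "2 * (T0 + J + 1) \<le> R" and T1: "1 \<le> T1" "T1 \<le> R"
    and \<alpha>: "0 < \<alpha>" and Dm: "3 * D * fact T0 / real n \<le> \<alpha>"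
  defines "\<zeta> \<equiv> 9 * \<eta> + 15 / fact (Suc J)"
  shows "ev n (\<lambda>zs. if (\<forall>t\<le>T0. \<bar>N t zs / \<mu> t - 1\<bar> \<le> 2 * \<alpha>) \<and> (\<forall>u\<in>V. count_list zs u < T1) then 0 else 1) w w
    \<le> real (Suc T0) * (27 * \<zeta> + 36 * D * fact T0 / real n) / \<alpha>\<^sup>2 + real n * (2 * (real \<tau> + 2) / fact (T1 - 1))"
proof -
  have \<mu>pos: "0 < \<mu> t" for t using n_pos by (simp add: \<mu>_def)
  define X where "X t zs = (1 / (\<alpha> * \<mu> t)\<^sup>2) * (N' t zs - \<mu> t)\<^sup>2" for t zs
  define Y where "Y u zs = real ((count_list zs u choose T1) * (count_list zs u choose 0))" for u :: 'a and zs
  have X0: "0 \<le> X t zs" and Y0: "0 \<le> Y u zs" for t zs u by (auto simp: X_def Y_def)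
  have "ev n (\<lambda>zs. if (\<forall>t\<le>T0. \<bar>N t zs / \<mu> t - 1\<bar> \<le> 2 * \<alpha>) \<and> (\<forall>u\<in>V. count_list zs u < T1) then 0 else 1) w w
      \<le> ev n (\<lambda>zs. (\<Sum>t\<le>T0. X t zs) + (\<Sum>u\<in>V. Y u zs)) w w"
  proof (intro ev_mono)
    fix zs
    have sums: "0 \<le> (\<Sum>t\<le>T0. X t zs)" "0 \<le> (\<Sum>u\<in>V. Y u zs)" by (auto intro!: sum_nonneg X0 Y0)
    consider (good) "(\<forall>t\<le>T0. \<bar>N t zs / \<mu> t - 1\<bar> \<le> 2 * \<alpha>) \<and> (\<forall>u\<in>V. count_list zs u < T1)"
      | (dev) t where "t \<le> T0" "2 * \<alpha> < \<bar>N t zs / \<mu> t - 1\<bar>" | (many) u where "u \<in> V" "T1 \<le> count_list zs u"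
      by (meson not_le)
    then show "(if (\<forall>t\<le>T0. \<bar>N t zs / \<mu> t - 1\<bar> \<le> 2 * \<alpha>) \<and> (\<forall>u\<in>V. count_list zs u < T1) then 0 else 1)
        \<le> (\<Sum>t\<le>T0. X t zs) + (\<Sum>u\<in>V. Y u zs)"
    proof cases
      case good
      then show ?thesis using sums by simp
    next
      case dev
      have "D \<le> \<alpha> * \<mu> t"
      proof -
        have "exp 1 * fact t \<le> (3 * fact T0 :: real)"
          using exp_le dev(1) by (intro mult_mono fact_mono) auto
        then have "D * (exp 1 * fact t) \<le> D * (3 * fact T0)" using D_ge_1 by (intro mult_left_mono) auto
        also have "\<dots> \<le> \<alpha> * real n" using Dm n_pos by (simp add: field_simps)
        finally show ?thesis by (simp add: \<mu>_def field_simps)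
      qed
      moreover have "2 * (\<alpha> * \<mu> t) < \<bar>N t zs - \<mu> t\<bar>"
      proof -
        have "N t zs / \<mu> t - 1 = (N t zs - \<mu> t) / \<mu> t" using \<mu>pos[of t] by (simp add: field_simps)
        then show ?thesis using dev(2) \<mu>pos[of t] by (simp add: abs_divide field_simps)
      qed
      ultimately have "\<alpha> * \<mu> t \<le> \<bar>N' t zs - \<mu> t\<bar>" using N_diff[of t zs] by linarith
      then have "(\<alpha> * \<mu> t)\<^sup>2 \<le> (N' t zs - \<mu> t)\<^sup>2"
        using \<alpha> \<mu>pos[of t] by (metis abs_le_square_iff abs_of_pos mult_pos_pos)
      then have "1 \<le> X t zs" using \<alpha> \<mu>pos[of t] by (simp add: X_def)
      also have "X t zs \<le> (\<Sum>t\<le>T0. X t zs)" using dev(1) by (intro member_le_sum) (auto simp: X0)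
      finally show ?thesis using sums by simp
    next
      case many
      have "1 \<le> count_list zs u choose T1" using many(2) by (simp add: Suc_le_eq)
      then have "1 \<le> Y u zs" unfolding Y_def by simp
      also have "Y u zs \<le> (\<Sum>u\<in>V. Y u zs)" using many(1) finite_V by (intro member_le_sum) (auto simp: Y0)
      finally show ?thesis using sums by simp
    qed
  qed
  also have "\<dots> = (\<Sum>t\<le>T0. ev n (X t) w w) + (\<Sum>u\<in>V. moment u u T1 0 n w w)"
    unfolding ev_add moment_def Y_def by (simp add: ev_sum w)
  also have "\<dots> \<le> (\<Sum>t\<le>T0. (27 * \<zeta> + 36 * D * fact T0 / real n) / \<alpha>\<^sup>2) + (\<Sum>u\<in>V. 2 * (real \<tau> + 2) / fact (T1 - 1))"
  proof (intro add_mono sum_mono)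
    fix t assume "t \<in> {..T0}"
    then have t: "t \<le> T0" by simp
    have "ev n (X t) w w = 1 / (\<alpha> * \<mu> t)\<^sup>2 * ev n (\<lambda>zs. (N' t zs - \<mu> t)\<^sup>2) w w"
      unfolding X_def[abs_def] by (rule ev_cmult)
    also have "\<dots> \<le> 1 / (\<alpha> * \<mu> t)\<^sup>2 * ((\<mu> t)\<^sup>2 * (27 * \<zeta> + 36 * D * fact t / real n))"
      unfolding \<zeta>_def using R0 t by (intro mult_left_mono second_moment J) auto
    also have "\<dots> = (27 * \<zeta> + 36 * D * fact t / real n) / \<alpha>\<^sup>2"
      using \<mu>pos[of t] by (simp add: power_mult_distrib)
    also have "\<dots> \<le> (27 * \<zeta> + 36 * D * fact T0 / real n) / \<alpha>\<^sup>2"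
      using D_ge_1 t by (intro divide_right_mono add_left_mono mult_left_mono fact_mono) auto
    finally show "ev n (X t) w w \<le> (27 * \<zeta> + 36 * D * fact T0 / real n) / \<alpha>\<^sup>2" .
  qed (rule moment_any_vertex[OF _ T1])
  also have "\<dots> = real (Suc T0) * (27 * \<zeta> + 36 * D * fact T0 / real n) / \<alpha>\<^sup>2 + real n * (2 * (real \<tau> + 2) / fact (T1 - 1))"
    by (simp add: n_def)
  finally show ?thesis .
qed

end

section \<open>Asymptotics\<close>

text \<open>\<open>visit_threshold\<close> over a real variable, as real asymptotics
  requires.\<close>

definition threshold :: "real \<Rightarrow> real \<Rightarrow> real" where
  "threshold a x = (1 + a * (ln (ln (ln x)) / ln (ln x))) * (ln x / ln (ln x))"

text \<open>Common bound for F!/n at the lower threshold and n/F! at the upper one; it is smaller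
  than every power of 1 / ln x.\<close>

definition decay :: "real \<Rightarrow> real \<Rightarrow> real" where
  "decay \<delta> x = exp (- (\<delta> / 2) * (ln x * ln (ln (ln x)) / ln (ln x)))"

text \<open>With a in place of 1 - \<delta>, F ln F equals ln x + (a - 1) ln x lnlnln x / lnln x to
  leading orders: the -1 comes from ln F = lnln x - lnlnln x + o(1). This is why the transition
  occurs at a = 1. The upper case differs by the term F, which is of lower order.\<close>

lemma threshold_lower_fact:
  assumes "\<delta> > 0"
  shows "\<forall>\<^sub>F x in at_top. exp (threshold (1 - \<delta>) x * ln (threshold (1 - \<delta>) x) - ln x) \<le> decay \<delta> x"
proof -
  have "((\<lambda>x::real. (threshold (1 - \<delta>) x * ln (threshold (1 - \<delta>) x) - ln x) / (ln x * ln (ln (ln x)) / ln (ln x))) \<longlongrightarrow> -\<delta>) at_top"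
    using assms unfolding threshold_def by real_asymp
  then have "\<forall>\<^sub>F x in at_top. (threshold (1 - \<delta>) x * ln (threshold (1 - \<delta>) x) - ln x) / (ln x * ln (ln (ln x)) / ln (ln x)) < - (\<delta> / 2)"
    by (rule order_tendstoD) (use assms in simp)
  moreover have "\<forall>\<^sub>F x in at_top. 0 < ln x * ln (ln (ln x)) / ln (ln (x::real))" by real_asymp
  ultimately show ?thesis
    unfolding decay_def exp_le_cancel_iff by eventually_elim (simp only: pos_divide_less_eq less_imp_le)
qed

lemma threshold_upper_fact:
  assumes "\<delta> > 0"
  shows "\<forall>\<^sub>F x in at_top. exp (ln x - threshold (1 + \<delta>) x * (ln (threshold (1 + \<delta>) x) - 1)) \<le> decay \<delta> x"
proof -
  have "((\<lambda>x::real. (ln x - threshold (1 + \<delta>) x * (ln (threshold (1 + \<delta>) x) - 1)) / (ln x * ln (ln (ln x)) / ln (ln x))) \<longlongrightarrow> -\<delta>) at_top"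
    using assms unfolding threshold_def by real_asymp
  then have "\<forall>\<^sub>F x in at_top. (ln x - threshold (1 + \<delta>) x * (ln (threshold (1 + \<delta>) x) - 1)) / (ln x * ln (ln (ln x)) / ln (ln x)) < - (\<delta> / 2)"
    by (rule order_tendstoD) (use assms in simp)
  moreover have "\<forall>\<^sub>F x in at_top. 0 < ln x * ln (ln (ln x)) / ln (ln (x::real))" by real_asymp
  ultimately show ?thesis
    unfolding decay_def exp_le_cancel_iff by eventually_elim (simp only: pos_divide_less_eq less_imp_le)
qed

text \<open>The value of \<eta> after replacing R by 21 ln x, \<tau> by K ln x + 1 and (d-1)^(-h) by
  q / (ln x)^5. It is of order (ln x)^(-2).\<close>

definition eta_bound :: "real \<Rightarrow> real \<Rightarrow> real \<Rightarrow> real" where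
  "eta_bound K q x = 2 * (21 * ln x * (1 / x + 21 * ln x * ((K * ln x + 1) * q / ln x ^ 5) + 21 * ln x * ((K * ln x + 2) / x)))"

text \<open>The right-hand side of \<open>prob_bad_le\<close>: ln x + 1 bounds the number of values
  t, \<open>ln x powr a\<close> bounds \<open>D\<close>, the squared factor is 1/\<alpha>^2, and 21
  ln x compensates for (T1 - 1)! in place of T1!.\<close>

definition error_bound :: "real \<Rightarrow> real \<Rightarrow> real \<Rightarrow> real \<Rightarrow> real \<Rightarrow> real" where
  "error_bound K q a \<delta> x =
    (ln x + 1) * (27 * (9 * eta_bound K q x + 15 / x) + 36 * (ln x powr a * decay \<delta> x)) * (2 * ln (ln (ln x)))\<^sup>2
    + 2 * (K * ln x + 3) * (21 * ln x * decay \<delta> x)"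

lemma eta_bound_le: "0 < K \<Longrightarrow> 0 < q \<Longrightarrow> \<forall>\<^sub>F x in at_top. eta_bound K q x \<le> 1"
  unfolding eta_bound_def by real_asymp

lemma error_bound_tendsto:
  assumes "0 < K" "0 < q" "0 < \<delta>"
  shows "(error_bound K q a \<delta> \<longlongrightarrow> 0) at_top"
proof -
  have "((\<lambda>x. (ln x + 1) * (27 * (9 * eta_bound K q x + 15 / x)) * (2 * ln (ln (ln x)))\<^sup>2) \<longlongrightarrow> 0) at_top"
    using assms unfolding eta_bound_def by real_asymp
  moreover have "((\<lambda>x. (ln x + 1) * (36 * (ln x powr a * decay \<delta> x)) * (2 * ln (ln (ln x)))\<^sup>2) \<longlongrightarrow> 0) at_top"
    using assms unfolding decay_def by real_asymp
  moreover have "((\<lambda>x. 2 * (K * ln x + 3) * (21 * ln x * decay \<delta> x)) \<longlongrightarrow> 0) at_top"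
    using assms unfolding decay_def by real_asymp
  ultimately have "((\<lambda>x. (ln x + 1) * (27 * (9 * eta_bound K q x + 15 / x)) * (2 * ln (ln (ln x)))\<^sup>2
      + (ln x + 1) * (36 * (ln x powr a * decay \<delta> x)) * (2 * ln (ln (ln x)))\<^sup>2
      + 2 * (K * ln x + 3) * (21 * ln x * decay \<delta> x)) \<longlongrightarrow> 0 + 0 + 0) at_top"
    by (intro tendsto_add)
  then show ?thesis unfolding error_bound_def[abs_def] by (simp only: distrib_left distrib_right add_0)
qed

section \<open>Factorials at the thresholds, rounding, and counting of visits\<close>

lemma fact_floor_le:
  assumes "1 \<le> F"
  shows "fact (nat \<lfloor>F\<rfloor>) \<le> exp (F * ln F :: real)"
proof -
  define T where "T = nat \<lfloor>F\<rfloor>"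
  have T: "1 \<le> T" "real T \<le> F" using assms by (auto simp: T_def le_nat_iff le_floor_iff)
  have "fact T \<le> (of_nat (T ^ T) :: real)" by (rule fact_le_power)
  also have "\<dots> = real T ^ T" by simp
  also have "\<dots> = exp (real T * ln (real T))" using T by (simp add: exp_of_nat_mult)
  also have "\<dots> \<le> exp (F * ln F)"
    using T assms unfolding exp_le_cancel_iff by (intro mult_mono) auto
  finally show ?thesis by (simp add: T_def)
qed

text \<open>One term of the exponential series gives T! \<ge> (T/e)^T; from F \<ge> 3 on, ln F \<ge>
  1 makes the exponent monotone, so T may be replaced by F.\<close>

lemma fact_ge_exp:
  assumes "3 \<le> F" "F \<le> real T"
  shows "exp (F * (ln F - 1)) \<le> fact T"
proof -
  have T: "0 < real T" using assms by simp
  obtain s where "exp (real T) = (\<Sum>m<Suc T. real T ^ m / fact m) + exp s / fact (Suc T) * real T ^ Suc T"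
    using Maclaurin_exp_le by blast
  moreover have "0 \<le> (\<Sum>m<T. real T ^ m / fact m)" by (intro sum_nonneg) auto
  moreover have "0 \<le> exp s / fact (Suc T) * real T ^ Suc T" by auto
  ultimately have *: "real T ^ T / fact T \<le> exp (real T)" by (simp add: sum.lessThan_Suc del: fact_Suc power_Suc)
  have "1 \<le> ln F"
  proof -
    have "exp 1 \<le> F" using exp_le assms by linarith
    then show ?thesis using assms by (simp add: ln_ge_iff)
  qed
  then have "F * (ln F - 1) \<le> real T * (ln (real T) - 1)"
    using assms by (intro mult_mono) auto
  then have "exp (F * (ln F - 1)) \<le> exp (real T * ln (real T) - real T)"
    by (simp add: algebra_simps)
  also have "\<dots> = real T ^ T / exp (real T)"
    using T by (simp add: exp_diff exp_of_nat_mult)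
  also have "\<dots> \<le> fact T" using * by (simp add: field_simps)
  finally show ?thesis .
qed

lemma two_power_le_fact: "2 ^ J \<le> (fact (Suc J) :: real)"
proof (induction J)
  case (Suc J)
  have "2 * 2 ^ J \<le> real (Suc (Suc J)) * fact (Suc J)"
    using Suc by (intro mult_mono) auto
  then show ?case by (simp only: fact_Suc[of "Suc J"] power_Suc)
qed auto

lemma card_visits_eq_count:
  "card {i. 1 \<le> i \<and> i < length (w # zs) \<and> (w # zs) ! i = v} = count_list zs v"
proof -
  have "bij_betw Suc {i. i < length zs \<and> zs ! i = v} {i. 1 \<le> i \<and> i < length (w # zs) \<and> (w # zs) ! i = v}"
    by (rule bij_betwI[of _ _ _ "\<lambda>i. i - 1"]) auto
  then have "card {i. 1 \<le> i \<and> i < length (w # zs) \<and> (w # zs) ! i = v} = card {i. i < length zs \<and> zs ! i = v}"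
    by (rule bij_betw_same_card[symmetric])
  also have "\<dots> = length (filter (\<lambda>x. x = v) zs)" by (simp add: length_filter_conv_card)
  also have "\<dots> = count_list zs v" by (induction zs) auto
  finally show ?thesis .
qed

lemma num_visited_Cons: "num_visited G (w # zs) t = card {v \<in> pverts G. count_list zs v = t}"
  unfolding num_visited_def card_visits_eq_count ..

lemma ceiling_floor_bounds:
  fixes x :: real
  assumes "0 \<le> x"
  shows "x \<le> real (nat \<lceil>x\<rceil>)" "real (nat \<lceil>x\<rceil>) \<le> x + 1" "real (nat \<lfloor>x\<rfloor>) \<le> x" "x < real (nat \<lfloor>x\<rfloor>) + 1"
  using assms by linarith+

text \<open>Rounding h down costs a single factor q. Balls grow with base d instead of d - 1, which
  changes the exponent of L but leaves their size a power of L.\<close>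

lemma degree_power_bounds:
  fixes L q dd :: real
  assumes L: "1 < L" and q: "1 < q" and dd: "1 \<le> dd"
  defines "h \<equiv> nat \<lfloor>5 * log q L\<rfloor>"
  shows "dd ^ h \<le> L powr (5 * ln dd / ln q)" "L ^ 5 \<le> q * q ^ h" "real h \<le> 5 * log q L"
proof -
  have pos: "0 \<le> 5 * log q L" using L q by simp
  note h = ceiling_floor_bounds(3,4)[OF pos, folded h_def]
  show "real h \<le> 5 * log q L" by (rule h)
  have "dd ^ h = dd powr real h" using dd by (simp add: powr_realpow)
  also have "\<dots> \<le> dd powr (5 * log q L)" using dd h by (intro powr_mono) auto
  also have "\<dots> = L powr (5 * ln dd / ln q)" using dd L by (simp add: powr_def log_def mult_ac)
  finally show "dd ^ h \<le> L powr (5 * ln dd / ln q)" .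
  have "L ^ 5 = L powr 5" using L by simp
  also have "\<dots> = (q powr log q L) powr 5" using L q by simp
  also have "\<dots> = q powr (5 * log q L)" by (simp add: powr_powr mult.commute)
  also have "\<dots> \<le> q powr (real (Suc h))" using h q by (intro powr_mono) auto
  also have "\<dots> = q * q ^ h" using q by (simp add: powr_realpow del: of_nat_Suc)
  finally show "L ^ 5 \<le> q * q ^ h" .
qed

text \<open>B is built from d, lam and \<delta> alone, and the eventual range of n precedes the
  quantifiers over G and w; so the bound applies along any sequence of graphs and starts.\<close>

lemma visits_concentration:
  fixes d :: nat and lam \<delta> :: real
  assumes d: "3 \<le> d" and lam: "lam < real d" and \<delta>: "0 < \<delta>"
  obtains B :: "real \<Rightarrow> real" where "(B \<longlongrightarrow> 0) at_top"
    "\<forall>\<^sub>F n in sequentially. \<forall>(G :: 'a pair_pre_digraph) w.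
       ndl_graph n d lam G \<longrightarrow> ereal (10 * log (real d - 1) (ln (real n))) < ereal_of_enat (girth G) \<longrightarrow> w \<in> pverts G \<longrightarrow>
       1 - B (real n) \<le> measure_pmf.prob (nb_walk G w n)
        {ws. (\<forall>t::nat. real t < visit_threshold n (1 - \<delta>) \<longrightarrow>
                \<bar>real (num_visited G ws t) / (real n / (exp 1 * fact t)) - 1\<bar>
                  \<le> 1 / ln (ln (ln (real n)))) \<and>
             (\<forall>t::nat. real t > visit_threshold n (1 + \<delta>) \<longrightarrow> num_visited G ws t = 0)}"
proof -
  define q where "q = real (d - 1)"
  have q: "2 \<le> q" and dq: "real d = q + 1" using d by (auto simp: q_def of_nat_diff)
  obtain \<rho> where \<rho>: "3 / 4 \<le> \<rho>" "\<rho> < 1" "1 \<le> q * \<rho>\<^sup>2" "lam * \<rho> < q * \<rho>\<^sup>2 + 1"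
    using contraction_rate_exists[of q lam] q lam dq by auto
  define C where "C = 2 * sqrt (6 * (real d)\<^sup>2 / (1 - lam * \<rho> / (real (d - 1) * \<rho>\<^sup>2 + 1))) + 1"
  \<comment> \<open>Running for K ln n steps makes the power of \<rho> at most n^(-3). One factor n
    pays for the constant C \<le> n, and the rest is \<epsilon>/n with \<epsilon> = 1/n.\<close>
  define K where "K = 3 / (- ln \<rho>)"
  have ln\<rho>: "ln \<rho> < 0" using \<rho> by simp
  have K: "0 < K" using ln\<rho> by (simp add: K_def)
  define a where "a = 5 * ln (real d) / ln q"
  have ev: "\<forall>\<^sub>F x in at_top.
      C \<le> x \<and> 2 < ln x \<and> 1 \<le> 5 * log q (ln x) \<and> 0 < ln (ln (ln x)) \<and> eta_bound K q x \<le> 1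
      \<and> 1 \<le> threshold (1 - \<delta>) x \<and> threshold (1 - \<delta>) x \<le> ln x
      \<and> 3 \<le> threshold (1 + \<delta>) x \<and> threshold (1 + \<delta>) x + 1 \<le> 20 * ln x
      \<and> exp (threshold (1 - \<delta>) x * ln (threshold (1 - \<delta>) x) - ln x) \<le> decay \<delta> x
      \<and> exp (ln x - threshold (1 + \<delta>) x * (ln (threshold (1 + \<delta>) x) - 1)) \<le> decay \<delta> x
      \<and> 3 * (ln x powr a * decay \<delta> x) \<le> 1 / (2 * ln (ln (ln x)))"
  proof (intro eventually_conj)
    show "\<forall>\<^sub>F x in at_top. C \<le> x" by (rule eventually_ge_at_top)
    show "\<forall>\<^sub>F x::real in at_top. 2 < ln x" by real_asymp
    have "1 < q" using q by simp
    then show "\<forall>\<^sub>F x in at_top. 1 \<le> 5 * log q (ln x)" unfolding log_def by real_asymp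
    show "\<forall>\<^sub>F x::real in at_top. 0 < ln (ln (ln x))" by real_asymp
    show "\<forall>\<^sub>F x in at_top. eta_bound K q x \<le> 1" using K q by (intro eta_bound_le) auto
    show "\<forall>\<^sub>F x in at_top. 1 \<le> threshold (1 - \<delta>) x" unfolding threshold_def by real_asymp
    show "\<forall>\<^sub>F x in at_top. threshold (1 - \<delta>) x \<le> ln x" unfolding threshold_def by real_asymp
    show "\<forall>\<^sub>F x in at_top. 3 \<le> threshold (1 + \<delta>) x" unfolding threshold_def by real_asymp
    show "\<forall>\<^sub>F x in at_top. threshold (1 + \<delta>) x + 1 \<le> 20 * ln x" unfolding threshold_def by real_asymp
    show "\<forall>\<^sub>F x in at_top. 3 * (ln x powr a * decay \<delta> x) \<le> 1 / (2 * ln (ln (ln x)))"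
      using \<delta> unfolding decay_def by real_asymp
  qed (intro threshold_lower_fact threshold_upper_fact \<delta>)+
  show ?thesis
  proof (rule that[of "error_bound K q a \<delta>"])
    show "(error_bound K q a \<delta> \<longlongrightarrow> 0) at_top"
      using K q \<delta> by (intro error_bound_tendsto) auto
    show "\<forall>\<^sub>F n in sequentially. \<forall>(G :: 'a pair_pre_digraph) w.
       ndl_graph n d lam G \<longrightarrow> ereal (10 * log (real d - 1) (ln (real n))) < ereal_of_enat (girth G) \<longrightarrow> w \<in> pverts G \<longrightarrow>
       1 - error_bound K q a \<delta> (real n) \<le> measure_pmf.prob (nb_walk G w n)
        {ws. (\<forall>t::nat. real t < visit_threshold n (1 - \<delta>) \<longrightarrow>
                \<bar>real (num_visited G ws t) / (real n / (exp 1 * fact t)) - 1\<bar>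
                  \<le> 1 / ln (ln (ln (real n)))) \<and>
             (\<forall>t::nat. real t > visit_threshold n (1 + \<delta>) \<longrightarrow> num_visited G ws t = 0)}"
      using eventually_compose_filterlim[OF ev filterlim_real_sequentially]
    proof eventually_elim
      case (elim n)
      define L where "L = ln (real n)"
      define M where "M = ln (ln (ln (real n)))"
      define F1 where "F1 = threshold (1 - \<delta>) (real n)"
      define F2 where "F2 = threshold (1 + \<delta>) (real n)"
      define X where "X = decay \<delta> (real n)"
      have L2: "2 < L" using elim by (simp add: L_def)
      have n0: "0 < real n" using L2 by (cases "n = 0") (auto simp: L_def)
      have expL: "exp L = real n" using n0 by (simp add: L_def)
      have c: "C \<le> real n" "1 \<le> 5 * log q L" "0 < M" "eta_bound K q (real n) \<le> 1"
        "1 \<le> F1" "F1 \<le> L" "3 \<le> F2" "F2 + 1 \<le> 20 * L"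
        "exp (F1 * ln F1 - L) \<le> X" "exp (L - F2 * (ln F2 - 1)) \<le> X" "3 * (L powr a * X) \<le> 1 / (2 * M)"
        using elim unfolding L_def M_def F1_def F2_def X_def by blast+
      define h where "h = nat \<lfloor>5 * log q L\<rfloor>"
      define \<tau> where "\<tau> = nat \<lceil>K * L\<rceil>"
      \<comment> \<open>Large enough for 2 (T0 + J + 1) \<le> 6 L + 6 and for T1 \<le> F2 + 1 \<le>
        20 L.\<close>
      define R where "R = nat \<lceil>20 * L\<rceil>"
      \<comment> \<open>Even, and at least 2 L, so that (J+1)! \<ge> 2^J \<ge> exp(J/2) \<ge>
        n.\<close>
      define J where "J = 2 * nat \<lceil>L\<rceil>"
      define T0 where "T0 = nat \<lfloor>F1\<rfloor>"
      define T1 where "T1 = nat \<lceil>F2\<rceil>"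
      define \<alpha> where "\<alpha> = 1 / (2 * M)"
      have dpow: "real d ^ h \<le> L powr a" "L ^ 5 \<le> q * q ^ h" "real h \<le> 5 * log q L"
        using degree_power_bounds[of L q "real d"] L2 q d unfolding a_def h_def by auto
      have KL: "0 \<le> K * L" using K L2 by simp
      have \<tau>: "K * L \<le> real \<tau>" "real \<tau> \<le> K * L + 1"
        using ceiling_floor_bounds[OF KL] by (simp_all add: \<tau>_def)
      have R_bounds: "20 * L \<le> real R" "real R \<le> 21 * L"
        using ceiling_floor_bounds(1,2)[of "20 * L"] L2 unfolding R_def by linarith+
      have "real J = 2 * real (nat \<lceil>L\<rceil>)" "even J" by (simp_all add: J_def)
      then have J: "2 * L \<le> real J" "real J \<le> 2 * L + 2" "even J"
        using ceiling_floor_bounds(1,2)[of L] L2 by linarith+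
      have T0: "real T0 \<le> F1" using ceiling_floor_bounds(3)[of F1] c by (simp add: T0_def)
      have T1: "F2 \<le> real T1" "real T1 \<le> F2 + 1" using ceiling_floor_bounds(1,2)[of F2] c by (simp_all add: T1_def)
      show ?case
      proof (intro allI impI)
        fix G :: "'a pair_pre_digraph" and w
        assume ndl: "ndl_graph n d lam G"
          and girth: "ereal (10 * log (real d - 1) (ln (real n))) < ereal_of_enat (girth G)"
          and w: "w \<in> pverts G"
        have rg: "regular_graph (pverts G) (parcs G) d" using ndl d by (rule ndl_graph_regular)
        interpret regular_graph "pverts G" "parcs G" d by (rule rg)
        have cardV: "card (pverts G) = n" using ndl by (simp add: ndl_graph_def)
        define \<eta> where "\<eta> = 2 * (real R * (1 / real n + real R * (real \<tau> / q ^ h) + real R * real (Suc \<tau>) / real n))"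
        have \<eta>: "\<eta> \<le> eta_bound K q (real n)"
        proof -
          have "real \<tau> / q ^ h \<le> (K * L + 1) * q / L ^ 5"
          proof -
            have "real \<tau> / q ^ h \<le> (K * L + 1) / q ^ h" using \<tau> q by (intro divide_right_mono) auto
            also have "\<dots> \<le> (K * L + 1) * q / L ^ 5"
            proof -
              have "(K * L + 1) * L ^ 5 \<le> (K * L + 1) * (q * q ^ h)" using dpow KL by (intro mult_left_mono) auto
              then show ?thesis using q L2 by (simp add: divide_le_eq le_divide_eq mult_ac)
            qed
            finally show ?thesis .
          qed
          then have "real R * (real \<tau> / q ^ h) \<le> 21 * L * ((K * L + 1) * q / L ^ 5)"
            using R_bounds L2 q by (intro mult_mono) auto
          moreover have "real R * real (Suc \<tau>) / real n \<le> 21 * L * ((K * L + 2) / real n)"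
          proof -
            have "real R * (real (Suc \<tau>) / real n) \<le> 21 * L * ((K * L + 2) / real n)"
              using R_bounds L2 \<tau> by (intro mult_mono divide_right_mono) auto
            then show ?thesis by simp
          qed
          ultimately have "1 / real n + real R * (real \<tau> / q ^ h) + real R * real (Suc \<tau>) / real n
              \<le> 1 / real n + 21 * L * ((K * L + 1) * q / L ^ 5) + 21 * L * ((K * L + 2) / real n)"
            by linarith
          moreover have "0 \<le> 1 / real n + real R * (real \<tau> / q ^ h) + real R * real (Suc \<tau>) / real n"
            using q by simp
          ultimately have "real R * (1 / real n + real R * (real \<tau> / q ^ h) + real R * real (Suc \<tau>) / real n)
              \<le> 21 * L * (1 / real n + 21 * L * ((K * L + 1) * q / L ^ 5) + 21 * L * ((K * L + 2) / real n))"
            using R_bounds L2 by (intro mult_mono) auto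
          then show ?thesis
            unfolding \<eta>_def eta_bound_def L_def[symmetric] by simp
        qed
        interpret mixing_walk "pverts G" "parcs G" d h \<tau> R "1 / real n" \<eta> w
        proof
          show "w \<in> pverts G" by (rule w)
          show "1 \<le> h" using c(2) by (simp add: h_def le_nat_iff le_floor_iff)
          show "no_short_cycle (2 * h)"
          proof (rule girth_imp_no_short_cycle[OF rg])
            have "ereal_of_enat (enat (2 * h)) = ereal (2 * real h)" by simp
            also have "\<dots> \<le> ereal (10 * log (real d - 1) (ln (real n)))"
              using dpow(3) by (simp add: dq L_def)
            also note girth
            finally show "enat (2 * h) < girth G" by (simp only: ereal_of_enat_less_iff)
          qed
          show "0 \<le> 1 / real n" "1 / real n \<le> 1" using n0 by auto
          show "\<bar>hit (Suc i) y x v - 1 / real (card (pverts G))\<bar> \<le> 1 / real n / real (card (pverts G))"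
            if i: "\<tau> \<le> i" and x: "x \<in> pverts G" and v: "v \<in> pverts G" for i y x v
          proof -
            have "\<bar>hit (Suc i) y x v - 1 / real (card (pverts G))\<bar> \<le> C * \<rho> ^ Suc i"
              unfolding C_def
            proof (rule hit_mixing)
              show "\<bar>inner_V (adj f) f\<bar> \<le> lam * inner_V f f" if "sum f (pverts G) = 0" for f
                using ndl_graph_eigenvalue_le[OF ndl d lam] that
                by (intro rayleigh_bound) (auto simp: adj_def)
            qed (use \<rho> x v d in \<open>auto simp: q_def of_nat_diff\<close>)
            also have "\<dots> \<le> real n * (1 / real n ^ 3)"
            proof (rule mult_mono)
              have "\<rho> ^ Suc i \<le> \<rho> ^ \<tau>" using \<rho> i by (intro power_decreasing) auto
              also have "\<dots> = exp (real \<tau> * ln \<rho>)" using \<rho> by (simp add: exp_of_nat_mult)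
              also have "\<dots> \<le> exp (K * L * ln \<rho>)"
                using \<tau> ln\<rho> by (simp add: mult_right_mono_neg)
              also have "K * L * ln \<rho> = - (3 * L)" using ln\<rho> by (simp add: K_def)
              also have "exp (- (3 * L)) = 1 / real n ^ 3"
                by (simp add: exp_minus divide_inverse expL[symmetric] flip: exp_of_nat_mult)
              finally show "\<rho> ^ Suc i \<le> 1 / real n ^ 3" .
            qed (use c \<rho> in auto)
            also have "\<dots> = 1 / real n / real (card (pverts G))"
              using n0 by (simp add: cardV power3_eq_cube)
            finally show ?thesis .
          qed
          show "1 \<le> R" using R_bounds L2 by linarith
          show "\<eta> = 2 * (real R * (1 / real n + real R * (real \<tau> / real (d - 1) ^ h) + real R * real (Suc \<tau>) / real (card (pverts G))))"
            by (simp add: \<eta>_def q_def cardV)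
          show "\<eta> \<le> 1" using \<eta> c by linarith
        qed
        have n_eq: "local.n = n" by (simp add: n_def cardV)
        have Dle: "D \<le> L powr a" using dpow(1) by (simp add: D_def)
        have T0fact: "fact T0 / real n \<le> X"
        proof -
          have "fact T0 / real n \<le> exp (F1 * ln F1) / exp L"
            unfolding expL T0_def using c by (intro divide_right_mono fact_floor_le) auto
          then show ?thesis using c(9) by (simp add: exp_diff)
        qed
        have DT0: "D * fact T0 / real n \<le> L powr a * X"
        proof -
          have "D * (fact T0 / real n) \<le> L powr a * X"
            using Dle T0fact D_ge_1 by (intro mult_mono) auto
          then show ?thesis by simp
        qed
        define A where "A = {ws. (\<forall>t::nat. real t < visit_threshold n (1 - \<delta>) \<longrightarrow>
                \<bar>real (num_visited G ws t) / (real n / (exp 1 * fact t)) - 1\<bar>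
                  \<le> 1 / ln (ln (ln (real n)))) \<and>
             (\<forall>t::nat. real t > visit_threshold n (1 + \<delta>) \<longrightarrow> num_visited G ws t = 0)}"
        define bad where "bad zs = (if (\<forall>t\<le>T0. \<bar>N t zs / \<mu> t - 1\<bar> \<le> 2 * \<alpha>) \<and> (\<forall>u\<in>pverts G. count_list zs u < T1) then 0 else 1 :: real)" for zs
        have thr: "visit_threshold n (1 - \<delta>) = F1" "visit_threshold n (1 + \<delta>) = F2"
          by (simp_all add: visit_threshold_def F1_def F2_def threshold_def)
        have N_eq: "N t zs = real (num_visited G (w # zs) t)" for t zs
        proof -
          have "N t zs = (\<Sum>u\<in>pverts G. if count_list zs u = t then 1 else 0)"
            by (simp add: N_def visits_def)
          also have "\<dots> = real (card {u \<in> pverts G. count_list zs u = t})"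
            using finite_V by (simp add: sum.If_cases Int_def)
          finally show ?thesis by (simp add: num_visited_Cons)
        qed
        have good: "1 - bad zs \<le> indicator A (w # zs)" for zs
        proof (cases "(\<forall>t\<le>T0. \<bar>N t zs / \<mu> t - 1\<bar> \<le> 2 * \<alpha>) \<and> (\<forall>u\<in>pverts G. count_list zs u < T1)")
          case True
          have "w # zs \<in> A"
            unfolding A_def thr mem_Collect_eq
          proof (intro conjI allI impI)
            fix t :: nat assume "real t < F1"
            then have "t \<le> T0" by (simp add: T0_def le_nat_iff le_floor_iff)
            then have "\<bar>N t zs / \<mu> t - 1\<bar> \<le> 2 * \<alpha>" using True by blast
            then show "\<bar>real (num_visited G (w # zs) t) / (real n / (exp 1 * fact t)) - 1\<bar> \<le> 1 / ln (ln (ln (real n)))"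
              unfolding N_eq \<mu>_def n_eq \<alpha>_def M_def[symmetric] by simp
          next
            fix t :: nat assume "F2 < real t"
            then have "T1 \<le> t" unfolding T1_def by (simp add: nat_le_iff ceiling_le_iff)
            then have "{v \<in> pverts G. count_list zs v = t} = {}" using True by auto
            then show "num_visited G (w # zs) t = 0" by (simp only: num_visited_Cons card.empty)
          qed
          moreover have "bad zs = 0" unfolding bad_def using True by (rule if_P)
          ultimately show ?thesis by simp
        next
          case False
          then have "bad zs = 1" unfolding bad_def by (rule if_not_P)
          then show ?thesis by simp
        qed
        have "ev n bad w w \<le> real (Suc T0) * (27 * (9 * \<eta> + 15 / fact (Suc J)) + 36 * D * fact T0 / real n) / \<alpha>\<^sup>2
            + real n * (2 * (real \<tau> + 2) / fact (T1 - 1))"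
          unfolding bad_def[abs_def]
        proof (rule prob_bad_le[unfolded n_eq])
          show "even J" by (rule J)
          show "2 * (T0 + J + 1) \<le> R"
          proof -
            have "2 * real T0 + 2 * real J + 2 \<le> real R" using T0 J(2) R_bounds(1) c(6) L2 by linarith
            then have "real (2 * (T0 + J + 1)) \<le> real R" by simp
            then show ?thesis by (simp only: of_nat_le_iff)
          qed
          show "1 \<le> T1" using T1 c by linarith
          show "T1 \<le> R"
          proof -
            have "real T1 \<le> real R" using T1(2) R_bounds(1) c(8) by linarith
            then show ?thesis by simp
          qed
          show "0 < \<alpha>" using c by (simp add: \<alpha>_def)
          have "3 * (D * fact T0 / real n) \<le> 3 * (L powr a * X)" using DT0 by simp
          also have "\<dots> \<le> \<alpha>" using c(11) by (simp add: \<alpha>_def)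
          finally show "3 * D * fact T0 / real n \<le> \<alpha>" by (simp add: mult.assoc)
        qed
        also have "\<dots> \<le> error_bound K q a \<delta> (real n)"
          unfolding error_bound_def X_def[symmetric] M_def[symmetric]
          unfolding L_def[symmetric]
        proof (rule add_mono)
          have "15 / fact (Suc J) \<le> 15 / real n"
          proof -
            have "real n = exp L" by (simp add: expL)
            also have "\<dots> \<le> exp (real J * ln 2)"
            proof -
              have "exp (1 / 2) \<le> (2 :: real)" using exp_bound[of "1 / 2 :: real"] by (simp add: power2_eq_square)
              then have "1 / 2 \<le> ln (2::real)" by (subst ln_ge_iff) auto
              then have "(2 * L) * (1 / 2) \<le> real J * ln 2" using J L2 by (intro mult_mono) auto
              then show ?thesis by simp
            qed
            also have "\<dots> = 2 ^ J" by (simp add: exp_of_nat_mult)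
            also have "\<dots> \<le> fact (Suc J)" by (rule two_power_le_fact)
            finally show ?thesis using n0 by (intro divide_left_mono) (auto simp del: fact_Suc)
          qed
          then have "27 * (9 * \<eta> + 15 / fact (Suc J)) + 36 * D * fact T0 / real n
              \<le> 27 * (9 * eta_bound K q (real n) + 15 / real n) + 36 * (L powr a * X)"
            using \<eta> DT0 by (simp add: mult.assoc del: fact_Suc)
          moreover have "0 \<le> 27 * (9 * \<eta> + 15 / fact (Suc J)) + 36 * D * fact T0 / real n"
            using eta_parts(3) D_ge_1 by (simp del: fact_Suc)
          ultimately have "real (Suc T0) * (27 * (9 * \<eta> + 15 / fact (Suc J)) + 36 * D * fact T0 / real n)
              \<le> (L + 1) * (27 * (9 * eta_bound K q (real n) + 15 / real n) + 36 * (L powr a * X))"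
            using T0 c L2 by (intro mult_mono) auto
          then have "real (Suc T0) * (27 * (9 * \<eta> + 15 / fact (Suc J)) + 36 * D * fact T0 / real n) * (2 * M)\<^sup>2
              \<le> (L + 1) * (27 * (9 * eta_bound K q (real n) + 15 / real n) + 36 * (L powr a * X)) * (2 * M)\<^sup>2"
            by (rule mult_right_mono) simp
          moreover have "y / \<alpha>\<^sup>2 = y * (2 * M)\<^sup>2" for y using c by (simp add: \<alpha>_def power_divide)
          ultimately show "real (Suc T0) * (27 * (9 * \<eta> + 15 / fact (Suc J)) + 36 * D * fact T0 / real n) / \<alpha>\<^sup>2
              \<le> (L + 1) * (27 * (9 * eta_bound K q (real n) + 15 / real n) + 36 * (L powr a * X)) * (2 * M)\<^sup>2"
            by simp
        next
          have T1pos: "0 < T1" using T1 c by linarith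
          \<comment> \<open>The index lost in \<open>moment_any_vertex\<close> reappears as the
            factor T1 \<le> 21 L, which is harmless against \<open>decay\<close>.\<close>
          have "real n / fact (T1 - 1) = real T1 * (real n / fact T1)"
            using T1pos by (simp add: fact_reduce[of T1])
          also have "\<dots> \<le> (21 * L) * X"
          proof (rule mult_mono)
            have "real n / fact T1 \<le> exp L / exp (F2 * (ln F2 - 1))"
              unfolding expL using c T1 by (intro divide_left_mono fact_ge_exp) auto
            then show "real n / fact T1 \<le> X" using c(10) by (simp add: exp_diff)
          qed (use T1 c L2 in auto)
          finally have "(2 * (real \<tau> + 2)) * (real n / fact (T1 - 1)) \<le> (2 * (K * L + 3)) * (21 * L * X)"
            using \<tau> KL by (intro mult_mono) auto
          then show "real n * (2 * (real \<tau> + 2) / fact (T1 - 1)) \<le> 2 * (K * L + 3) * (21 * L * X)"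
            by (simp add: mult_ac)
        qed
        finally have "1 - error_bound K q a \<delta> (real n) \<le> ev n (\<lambda>zs. 1 - bad zs) w w"
          by (simp add: ev_diff ev_const w)
        also have "\<dots> \<le> ev n (\<lambda>zs. indicator A (w # zs)) w w" by (intro ev_mono good)
        also have "\<dots> = measure_pmf.prob (nb_walk G w n) A"
          by (rule prob_nb_walk[OF rg w, symmetric])
        finally show "1 - error_bound K q a \<delta> (real n) \<le> measure_pmf.prob (nb_walk G w n)
          {ws. (\<forall>t::nat. real t < visit_threshold n (1 - \<delta>) \<longrightarrow>
                \<bar>real (num_visited G ws t) / (real n / (exp 1 * fact t)) - 1\<bar>
                  \<le> 1 / ln (ln (ln (real n)))) \<and>
             (\<forall>t::nat. real t > visit_threshold n (1 + \<delta>) \<longrightarrow> num_visited G ws t = 0)}"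
          unfolding A_def .
      qed
    qed
  qed
qed

theorem theorem1p5:
  fixes d :: nat and lam :: real and S :: "nat set"
    and G :: "nat \<Rightarrow> 'a pair_pre_digraph" and g :: "nat \<Rightarrow> real" and w0 :: "nat \<Rightarrow> 'a"
  assumes "d \<ge> 3" and "lam < real d"
    and "infinite S"
    and "\<And>n. n \<in> S \<Longrightarrow> ndl_graph n d lam (G n)"
    and "\<And>n. n \<in> S \<Longrightarrow> ereal_of_enat (girth (G n)) \<ge> ereal (g n)"
    and "\<And>n. n \<in> S \<Longrightarrow> g n > 10 * log (real d - 1) (ln (real n))"
    and "\<And>n. n \<in> S \<Longrightarrow> w0 n \<in> pverts (G n)"
  shows "\<forall>\<delta>::real. \<delta> > 0 \<longrightarrow>
    ((\<lambda>n. measure_pmf.prob (nb_walk (G n) (w0 n) n)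
        {ws. (\<forall>t::nat. real t < visit_threshold n (1 - \<delta>) \<longrightarrow>
                \<bar>real (num_visited (G n) ws t) / (real n / (exp 1 * fact t)) - 1\<bar>
                  \<le> 1 / ln (ln (ln (real n)))) \<and>
             (\<forall>t::nat. real t > visit_threshold n (1 + \<delta>) \<longrightarrow> num_visited (G n) ws t = 0)})
      \<longlongrightarrow> 1) (inf sequentially (principal S))"
proof (intro allI impI)
  fix \<delta> :: real assume \<delta>: "\<delta> > 0"
  define A where "A n = {ws. (\<forall>t::nat. real t < visit_threshold n (1 - \<delta>) \<longrightarrow>
                \<bar>real (num_visited (G n) ws t) / (real n / (exp 1 * fact t)) - 1\<bar>
                  \<le> 1 / ln (ln (ln (real n)))) \<and>
             (\<forall>t::nat. real t > visit_threshold n (1 + \<delta>) \<longrightarrow> num_visited (G n) ws t = 0)}" for n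
  obtain B :: "real \<Rightarrow> real" where B: "(B \<longlongrightarrow> 0) at_top"
    and ev: "\<forall>\<^sub>F n in sequentially. \<forall>(G :: 'a pair_pre_digraph) w.
       ndl_graph n d lam G \<longrightarrow> ereal (10 * log (real d - 1) (ln (real n))) < ereal_of_enat (girth G) \<longrightarrow> w \<in> pverts G \<longrightarrow>
       1 - B (real n) \<le> measure_pmf.prob (nb_walk G w n)
        {ws. (\<forall>t::nat. real t < visit_threshold n (1 - \<delta>) \<longrightarrow>
                \<bar>real (num_visited G ws t) / (real n / (exp 1 * fact t)) - 1\<bar>
                  \<le> 1 / ln (ln (ln (real n)))) \<and>
             (\<forall>t::nat. real t > visit_threshold n (1 + \<delta>) \<longrightarrow> num_visited G ws t = 0)}"
    by (rule visits_concentration[OF assms(1,2) \<delta>])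
  have girth: "ereal (10 * log (real d - 1) (ln (real n))) < ereal_of_enat (girth (G n))" if "n \<in> S" for n
  proof -
    have "ereal (10 * log (real d - 1) (ln (real n))) < ereal (g n)" using assms(6)[OF that] by simp
    also have "\<dots> \<le> ereal_of_enat (girth (G n))" by (rule assms(5)[OF that])
    finally show ?thesis .
  qed
  have lower: "\<forall>\<^sub>F n in inf sequentially (principal S). 1 - B (real n) \<le> measure_pmf.prob (nb_walk (G n) (w0 n) n) (A n)"
    unfolding eventually_inf_principal
    using ev
  proof eventually_elim
    case (elim n)
    show ?case
    proof
      assume "n \<in> S"
      from elim[rule_format, OF assms(4)[OF this] girth[OF this] assms(7)[OF this]]
      show "1 - B (real n) \<le> measure_pmf.prob (nb_walk (G n) (w0 n) n) (A n)"
        unfolding A_def .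
    qed
  qed
  have "((\<lambda>n. measure_pmf.prob (nb_walk (G n) (w0 n) n) (A n)) \<longlongrightarrow> 1) (inf sequentially (principal S))"
  \<comment> \<open>The upper half of the sandwich holds because a probability is at most 1.\<close>
  proof (rule tendsto_sandwich[OF lower])
    have "((\<lambda>n. 1 - B (real n)) \<longlongrightarrow> 1 - 0) sequentially"
      using filterlim_compose[OF B filterlim_real_sequentially] by (intro tendsto_intros)
    then show "((\<lambda>n. 1 - B (real n)) \<longlongrightarrow> 1) (inf sequentially (principal S))"
      by (intro tendsto_mono[OF inf_le1]) simp
  qed auto
  then show "((\<lambda>n. measure_pmf.prob (nb_walk (G n) (w0 n) n)
        {ws. (\<forall>t::nat. real t < visit_threshold n (1 - \<delta>) \<longrightarrow>
                \<bar>real (num_visited (G n) ws t) / (real n / (exp 1 * fact t)) - 1\<bar>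
                  \<le> 1 / ln (ln (ln (real n)))) \<and>
             (\<forall>t::nat. real t > visit_threshold n (1 + \<delta>) \<longrightarrow> num_visited (G n) ws t = 0)})
      \<longlongrightarrow> 1) (inf sequentially (principal S))"
    unfolding A_def .
qed

end
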